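(* Let $T$ be an $n$-by-$n$ upper triangular matrix, $n$ a power of 2, and let $\underline{s}>0$ be a lower bound for all the values of $\mathrm{sep}(A,B)$ encountered during the recursive eigenvector algorithm $EVecR(T)$. If $n$-by-$n$ matrices can be multiplied in $O(n^{\omega+\eta})$ operations with $\omega+\eta>2$, then $EVecR(T)$ performs $O(n^{\omega+\eta})$ arithmetic operations. Moreover, if the matrix multiplication used is stable, then there is a constant $c'$ such that, to first order in $\varepsilon$, the error $err(n)$ in the eigenvector matrix of $T$ computed by $EVecR(T)$, measured in the 2-norm, satisfies $$ err(n)=O\left(n^{c'}\,\varepsilon\left(\frac{\|T\|}{\underline{s}}\right)^{2+\log_2 n}\right). $$
   Context: $\|\cdot\|$ is the 2-norm. $\mathrm{sep}(A,B)=\sigma_{\min}(I\otimes A-B^T\otimes I)=\min_{\|R\|_F=1}\|AR-RB\|_F$. Arithmetic is floating point with machine epsilon $\varepsilon$. Stable matrix multiplication means that the computed product of $n$-by-$n$ matrices satisfies $\|C_{comp}-A\cdot B\|\le\mu(n)\varepsilon\|A\|\,\|B\|+O(\varepsilon^2)$ with $\mu(n)$ bounded by a polynomial in $n$. Algorithm $V=EVecR(T)$: if $n=1$ return $V=1$. Otherwise write $T=\left[\begin{array}{cc}A&C\\0&B\end{array}\right]$ with $\frac n2$-by-$\frac n2$ blocks; (a) $R=SylR(A,B,C)$; (b) $V_A=EVecR(A)$; (c) $V_B=EVecR(B)$; (d) $V=\left[\begin{array}{cc}V_A&R\cdot V_B\\0&V_B\end{array}\right]$; (e) for $i=n/2+1,\dots,n$,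 divide column $i$ of $V$ by its 2-norm. The values of $\mathrm{sep}(A,B)$ encountered are those for the diagonal blocks $A,B$ at all levels of the recursion. Algorithm $R=SylR(A,B,C)$, solving $AR-RB=-C$ for upper triangular $N$-by-$N$ matrices $A,B$ ($N$ a power of 2): if $N=1$ return $-C/(A-B)$. Otherwise partition all matrices into $\frac N2$-by-$\frac N2$ blocks and compute in order $R_{21}=SylR(A_{22},B_{11},C_{21})$; $R_{11}=SylR(A_{11},B_{11},C_{11}+A_{12}R_{21})$; $R_{22}=SylR(A_{22},B_{22},C_{22}-R_{21}B_{12})$; $R_{12}=SylR(A_{11},B_{22},C_{12}-R_{11}B_{12}+A_{12}R_{22})$. All matrix products are computed by the given matrix multiplication algorithm. *)

theory Defs
  imports
    Complex_Main
    "HOL-Library.Landau_Symbols"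
    "HOL-Computational_Algebra.Polynomial"
    "Jordan_Normal_Form.Matrix"
begin

definition vnorm :: "complex vec \<Rightarrow> real" where
  "vnorm v = sqrt (\<Sum>i<dim_vec v. (cmod (v $ i))\<^sup>2)"

definition mnorm :: "complex mat \<Rightarrow> real" where
  "mnorm A = Sup {vnorm (A *\<^sub>v v) | v. v \<in> carrier_vec (dim_col A) \<and> vnorm v = 1}"

definition fnorm :: "complex mat \<Rightarrow> real" where
  "fnorm A = sqrt (\<Sum>i<dim_row A. \<Sum>j<dim_col A. (cmod (A $$ (i, j)))\<^sup>2)"

definition sep :: "complex mat \<Rightarrow> complex mat \<Rightarrow> real" where
  "sep A B = Inf {fnorm (A * R - R * B) | R.
     R \<in> carrier_mat (dim_row A) (dim_row B) \<and> fnorm R = 1}"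

text \<open>The operations available to the algorithms.  A matrix product returns the computed
  product together with the number of arithmetic operations spent on it; the algorithms below
  likewise return a result paired with an operation count.  Each scalar operation costs one;
  complex conjugation is exact and free, negation is exact and counted.\<close>

record arith =
  add :: "complex \<Rightarrow> complex \<Rightarrow> complex"
  sub :: "complex \<Rightarrow> complex \<Rightarrow> complex"
  mul :: "complex \<Rightarrow> complex \<Rightarrow> complex"
  quot :: "complex \<Rightarrow> complex \<Rightarrow> complex"
  root2 :: "complex \<Rightarrow> complex"
  matmul :: "complex mat \<Rightarrow> complex mat \<Rightarrow> complex mat \<times> nat"

definition exact :: arith where
  "exact = \<lparr> add = (+), sub = (-), mul = (*), quot = (/), root2 = csqrt,
             matmul = (\<lambda>A B. (A * B, 0)) \<rparr>"

text \<open>Standard model of rounding.  The constant \<open>\<kappa>\<close> is 1 for real arithmetic; for complex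
  operations carried out in real floating point it is a modest constant.\<close>

definition fp_arith :: "real \<Rightarrow> real \<Rightarrow> arith \<Rightarrow> bool" where
  "fp_arith \<kappa> \<epsilon> ar \<longleftrightarrow>
     (\<forall>x y. cmod (add ar x y - (x + y)) \<le> \<kappa> * \<epsilon> * cmod (x + y)) \<and>
     (\<forall>x y. cmod (sub ar x y - (x - y)) \<le> \<kappa> * \<epsilon> * cmod (x - y)) \<and>
     (\<forall>x y. cmod (mul ar x y - x * y) \<le> \<kappa> * \<epsilon> * cmod (x * y)) \<and>
     (\<forall>x y. y \<noteq> 0 \<longrightarrow> cmod (quot ar x y - x / y) \<le> \<kappa> * \<epsilon> * cmod (x / y)) \<and>
     (\<forall>x. cmod (root2 ar x - csqrt x) \<le> \<kappa> * \<epsilon> * cmod (csqrt x))"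

definition square_matmul :: "arith \<Rightarrow> bool" where
  "square_matmul ar \<longleftrightarrow>
     (\<forall>n. \<forall>A \<in> carrier_mat n n. \<forall>B \<in> carrier_mat n n. fst (matmul ar A B) \<in> carrier_mat n n)"

text \<open>In the next two definitions \<open>fl \<epsilon>\<close> is the arithmetic with machine epsilon \<open>\<epsilon>\<close>.\<close>

definition matmul_cost_bounded :: "(real \<Rightarrow> arith) \<Rightarrow> real \<Rightarrow> bool" where
  "matmul_cost_bounded fl \<gamma> \<longleftrightarrow>
     (\<exists>M \<in> O(\<lambda>n. real n powr \<gamma>). \<forall>\<epsilon> \<in> {0<..<1}. \<forall>n \<ge> 1.
        \<forall>A \<in> carrier_mat n n. \<forall>B \<in> carrier_mat n n. real (snd (matmul (fl \<epsilon>) A B)) \<le> M n)"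

text \<open>The second-order remainder has to be uniform over operands of bounded norm, since the
  algorithms multiply matrices which themselves vary with \<open>\<epsilon>\<close>.\<close>

definition stable_matmul :: "(real \<Rightarrow> arith) \<Rightarrow> bool" where
  "stable_matmul fl \<longleftrightarrow>
     (\<exists>\<mu> :: nat \<Rightarrow> real. (\<exists>p :: real poly. \<forall>n. \<mu> n \<le> poly p (real n)) \<and>
        (\<forall>n \<ge> 1. \<forall>\<rho>. \<exists>K. \<forall>\<^sub>F \<epsilon> in at_right 0.
           \<forall>A \<in> carrier_mat n n. \<forall>B \<in> carrier_mat n n. mnorm A \<le> \<rho> \<longrightarrow> mnorm B \<le> \<rho> \<longrightarrow>
             mnorm (fst (matmul (fl \<epsilon>) A B) - A * B)
               \<le> \<mu> n * \<epsilon> * mnorm A * mnorm B + K * \<epsilon>\<^sup>2))"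

definition mat_add :: "arith \<Rightarrow> complex mat \<Rightarrow> complex mat \<Rightarrow> complex mat \<times> nat" where
  "mat_add ar X Y =
     (mat (dim_row X) (dim_col X) (\<lambda>ij. add ar (X $$ ij) (Y $$ ij)), dim_row X * dim_col X)"

definition mat_sub :: "arith \<Rightarrow> complex mat \<Rightarrow> complex mat \<Rightarrow> complex mat \<times> nat" where
  "mat_sub ar X Y =
     (mat (dim_row X) (dim_col X) (\<lambda>ij. sub ar (X $$ ij) (Y $$ ij)), dim_row X * dim_col X)"

text \<open>In both recursions the matrices have dimension \<open>2 ^ k\<close>.\<close>

fun SylR :: "arith \<Rightarrow> nat \<Rightarrow> complex mat \<Rightarrow> complex mat \<Rightarrow> complex mat \<Rightarrow> complex mat \<times> nat" where
  "SylR ar 0 A B C =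
     (mat 1 1 (\<lambda>_. quot ar (- (C $$ (0, 0))) (sub ar (A $$ (0, 0)) (B $$ (0, 0)))), 3)"
| "SylR ar (Suc k) A B C =
     (let m = 2 ^ k;
          (A11, A12, A21, A22) = split_block A m m;
          (B11, B12, B21, B22) = split_block B m m;
          (C11, C12, C21, C22) = split_block C m m;
          (R21, t1) = SylR ar k A22 B11 C21;
          (P1, t2) = matmul ar A12 R21;
          (D11, t3) = mat_add ar C11 P1;
          (R11, t4) = SylR ar k A11 B11 D11;
          (P2, t5) = matmul ar R21 B12;
          (D22, t6) = mat_sub ar C22 P2;
          (R22, t7) = SylR ar k A22 B22 D22;
          (P3, t8) = matmul ar R11 B12;
          (E12, t9) = mat_sub ar C12 P3;
          (P4, t10) = matmul ar A12 R22;
          (D12, t11) = mat_add ar E12 P4;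
          (R12, t12) = SylR ar k A11 B22 D12
      in (four_block_mat R11 R12 R21 R22,
          t1 + t2 + t3 + t4 + t5 + t6 + t7 + t8 + t9 + t10 + t11 + t12))"

fun sum_squares :: "arith \<Rightarrow> (nat \<Rightarrow> complex) \<Rightarrow> nat \<Rightarrow> complex \<times> nat" where
  "sum_squares ar f 0 = (0, 0)"
| "sum_squares ar f (Suc i) =
     (let (x, t) = sum_squares ar f i in (add ar x (mul ar (cnj (f i)) (f i)), t + 2))"

definition col_norm :: "arith \<Rightarrow> complex mat \<Rightarrow> nat \<Rightarrow> complex \<times> nat" where
  "col_norm ar V j =
     (let (x, t) = sum_squares ar (\<lambda>i. V $$ (i, j)) (dim_row V) in (root2 ar x, t + 1))"

text \<open>Columns are indexed from 0, so the second half of them starts at index \<open>m\<close>.\<close>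

definition normalize_cols_from :: "arith \<Rightarrow> nat \<Rightarrow> complex mat \<Rightarrow> complex mat \<times> nat" where
  "normalize_cols_from ar m V =
     (mat (dim_row V) (dim_col V)
        (\<lambda>(i, j). if j < m then V $$ (i, j) else quot ar (V $$ (i, j)) (fst (col_norm ar V j))),
      \<Sum>j = m..<dim_col V. snd (col_norm ar V j) + dim_row V)"

fun EVecR :: "arith \<Rightarrow> nat \<Rightarrow> complex mat \<Rightarrow> complex mat \<times> nat" where
  "EVecR ar 0 T = (1\<^sub>m 1, 0)"
| "EVecR ar (Suc k) T =
     (let m = 2 ^ k;
          (A, C, Z, B) = split_block T m m;
          (R, t1) = SylR ar k A B C;
          (VA, t2) = EVecR ar k A;
          (VB, t3) = EVecR ar k B;
          (P, t4) = matmul ar R VB;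
          (V, t5) = normalize_cols_from ar m (four_block_mat VA P (0\<^sub>m m m) VB)
      in (V, t1 + t2 + t3 + t4 + t5))"

fun encountered_seps :: "nat \<Rightarrow> complex mat \<Rightarrow> real set" where
  "encountered_seps 0 T = {}"
| "encountered_seps (Suc k) T =
     (let (A, C, Z, B) = split_block T (2 ^ k) (2 ^ k)
      in {sep A B} \<union> encountered_seps k A \<union> encountered_seps k B)"

definition EVecR_input :: "nat \<Rightarrow> nat \<Rightarrow> complex mat \<Rightarrow> real \<Rightarrow> bool" where
  "EVecR_input n k T s \<longleftrightarrow>
     n = 2 ^ k \<and> T \<in> carrier_mat n n \<and> upper_triangular T \<and>
     s > 0 \<and> (\<forall>\<sigma> \<in> encountered_seps k T. s \<le> \<sigma>)"

text \<open>Computed minus exact-arithmetic output of the algorithm.\<close>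

definition EVecR_error :: "arith \<Rightarrow> nat \<Rightarrow> complex mat \<Rightarrow> real" where
  "EVecR_error ar k T = mnorm (fst (EVecR ar k T) - fst (EVecR exact k T))"

end

theory Submission
  imports
    Defs
    "HOL-Analysis.L2_Norm"
    "Jordan_Normal_Form.Char_Poly"
begin

text \<open>
The operation count is a divide-and-conquer recurrence.  With \<open>g = 2 powr (\<omega> + \<eta>)\<close>, a product at level
\<open>k\<close> costs \<open>O(g ^ k)\<close>; the Sylvester solver makes four recursive calls and the eigenvector recursion two,
and \<open>g > 4\<close> makes the cost of the top level dominate (\<open>SylR_cost\<close>, \<open>EVecR_cost\<close>).

For the error, the Sylvester solver comes first.  Its computed solution has a residual of size
\<open>poly(n) * \<epsilon> * \<parallel>T\<parallel> * \<parallel>R\<parallel>\<close> (\<open>SylR_residual\<close>): the residual of a block equation is the sum of the residuals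
of its four smaller equations and of a few local rounding errors, so nothing is amplified.
Dividing once by the separation gives the accuracy of \<open>R\<close>, of order \<open>poly(n) * \<epsilon> * (\<parallel>T\<parallel> / s)\<^sup>2\<close>
(\<open>SylR_exact_error\<close>).

In the eigenvector recursion, a column \<open>v\<close> of \<open>V\<^sub>B\<close> becomes \<open>[R v; v]\<close> up to normalization, and its error
\<open>\<delta>\<close> becomes \<open>[R \<delta>; \<delta>]\<close>.  Bounding this by the 2-norm of \<open>R\<close> fails: since the separation is defined by
the Frobenius norm, it only gives \<open>\<parallel>R\<parallel> \<le> sqrt n * \<parallel>T\<parallel> / s\<close>, and a factor \<open>sqrt n\<close> per level accumulates to
\<open>n\<close> raised to a multiple of \<open>log n\<close>.  The remedy is to measure \<open>\<delta>\<close> relative to the matrix.  If \<open>\<delta> = Y u\<close>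
with \<open>Y B = B Y\<close>, then \<open>R Y\<close> solves \<open>A (R Y) - (R Y) B = - C Y\<close>, hence \<open>\<parallel>R Y\<parallel>\<^sub>F \<le> (\<parallel>C\<parallel> / s) * \<parallel>Y\<parallel>\<^sub>F\<close>
without any power of \<open>n\<close>, and the block matrix \<open>[0, R Y; 0, Y]\<close>, which carries \<open>[R \<delta>; \<delta>]\<close>, commutes with
\<open>T\<close>, so that the argument can be repeated at the next level (\<open>commutant_span_lower\<close>; similarly
\<open>commutant_span_upper\<close> for the columns of \<open>V\<^sub>A\<close>).  A rounding error pays a factor \<open>sqrt n\<close> only once, when
it enters with \<open>Y = 1\<close>, and then grows by \<open>1 + \<parallel>T\<parallel> / s\<close> per level.  The normalization is harmless because
the computed column is compared with a nonnegative multiple of the exact one (\<open>column_step\<close>).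
Summing over the levels yields a bound \<open>poly(n) * \<epsilon> * (1 + \<parallel>T\<parallel> / s) ^ (2 + log\<^sub>2 n)\<close>
(\<open>EVecR_columns_accurate\<close>), and \<open>\<parallel>T\<parallel> / s \<ge> 1 / 2\<close> for \<open>n \<ge> 2\<close> allows \<open>1 + \<parallel>T\<parallel> / s\<close> to be replaced by
\<open>3 * \<parallel>T\<parallel> / s\<close> at the cost of another power of \<open>n\<close>.

All estimates hold for sufficiently small \<open>\<epsilon>\<close> with some slack in the constants.  The slack absorbs the
second-order terms, so it suffices to know that the computed matrices converge to the exact
ones (\<open>SylR_tendsto\<close>).
\<close>

section \<open>The 2-norm, the Frobenius norm and block partitions\<close>

abbreviation sq_mat :: "nat \<Rightarrow> complex mat set" where
  "sq_mat n \<equiv> carrier_mat n n"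

text \<open>Addressing the blocks of a partition by indices \<open>p, q \<in> {0, 1}\<close> lets each block law be stated once
instead of four times.\<close>

definition blk :: "nat \<Rightarrow> nat \<Rightarrow> nat \<Rightarrow> complex mat \<Rightarrow> complex mat" where
  "blk m p q A = mat m m (\<lambda>(i, j). A $$ (i + p * m, j + q * m))"

lemma blk_carrier [simp]: "blk m p q A \<in> sq_mat m"
  and blk_dim [simp]: "dim_row (blk m p q A) = m" "dim_col (blk m p q A) = m"
  and blk_index: "i < m \<Longrightarrow> j < m \<Longrightarrow> blk m p q A $$ (i, j) = A $$ (i + p * m, j + q * m)"
  by (auto simp: blk_def)

lemma split_block_blk:
  assumes "A \<in> sq_mat (2 * m)"
  shows "split_block A m m = (blk m 0 0 A, blk m 0 1 A, blk m 1 0 A, blk m 1 1 A)"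
  using assms by (auto simp: split_block_def Let_def blk_def intro!: eq_matI)

lemma four_block_blk:
  assumes "A \<in> sq_mat (2 * m)"
  shows "A = four_block_mat (blk m 0 0 A) (blk m 0 1 A) (blk m 1 0 A) (blk m 1 1 A)"
  using split_block[OF split_block_blk[OF assms], of m m] assms by auto

lemma blk_four_block:
  assumes "A \<in> sq_mat m" "B \<in> sq_mat m" "C \<in> sq_mat m" "D \<in> sq_mat m"
  shows "blk m 0 0 (four_block_mat A B C D) = A" "blk m 0 (Suc 0) (four_block_mat A B C D) = B"
    "blk m (Suc 0) 0 (four_block_mat A B C D) = C" "blk m (Suc 0) (Suc 0) (four_block_mat A B C D) = D"
  using assms by (auto simp: blk_def intro!: eq_matI)

lemma four_block_carrier_double:
  assumes "A \<in> sq_mat m" "D \<in> sq_mat m"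
  shows "four_block_mat A B C D \<in> sq_mat (2 * m)"
  using four_block_carrier_mat[OF assms] by (simp add: mult_2)

lemma vnorm_L2: "vnorm v = L2_set (\<lambda>i. cmod (v $ i)) {..<dim_vec v}"
  by (simp add: vnorm_def L2_set_def)

lemma vnorm_nonneg [simp]: "0 \<le> vnorm v"
  by (simp add: vnorm_L2)

lemma vnorm_sq: "(vnorm v)\<^sup>2 = (\<Sum>i<dim_vec v. (cmod (v $ i))\<^sup>2)"
  by (simp add: vnorm_def sum_nonneg)

lemma fnorm_nonneg [simp]: "0 \<le> fnorm A"
  by (simp add: fnorm_def sum_nonneg)

lemma fnorm_sq: "(fnorm A)\<^sup>2 = (\<Sum>i<dim_row A. \<Sum>j<dim_col A. (cmod (A $$ (i, j)))\<^sup>2)"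
  by (simp add: fnorm_def sum_nonneg)

lemma fnorm_L2: "fnorm A = L2_set (\<lambda>ij. cmod (A $$ ij)) ({..<dim_row A} \<times> {..<dim_col A})"
  by (simp add: fnorm_def L2_set_def sum.cartesian_product)

lemma fnorm_sq_cols: "(fnorm A)\<^sup>2 = (\<Sum>j<dim_col A. (vnorm (col A j))\<^sup>2)"
  unfolding fnorm_sq vnorm_sq by (subst sum.swap) (auto intro!: sum.cong)

lemma vnorm_triangle:
  assumes "x \<in> carrier_vec n" "y \<in> carrier_vec n"
  shows "vnorm (x + y) \<le> vnorm x + vnorm y"
proof -
  have "vnorm (x + y) \<le> L2_set (\<lambda>i. cmod (x $ i) + cmod (y $ i)) {..<n}"
    unfolding vnorm_L2 using assms by (auto intro!: L2_set_mono norm_triangle_ineq)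
  also have "\<dots> \<le> vnorm x + vnorm y"
    unfolding vnorm_L2 using assms by (auto intro!: L2_set_triangle_ineq)
  finally show ?thesis .
qed

lemma vnorm_smult [simp]: "vnorm (c \<cdot>\<^sub>v x) = cmod c * vnorm x"
  unfolding vnorm_L2 by (simp add: L2_set_right_distrib[symmetric] norm_mult cong: L2_set_cong_simp)

lemma fnorm_triangle:
  assumes "A \<in> carrier_mat n m" "B \<in> carrier_mat n m"
  shows "fnorm (A + B) \<le> fnorm A + fnorm B"
proof -
  have "fnorm (A + B) \<le> L2_set (\<lambda>ij. cmod (A $$ ij) + cmod (B $$ ij)) ({..<n} \<times> {..<m})"
    unfolding fnorm_L2 using assms by (auto intro!: L2_set_mono norm_triangle_ineq)
  also have "\<dots> \<le> fnorm A + fnorm B"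
    unfolding fnorm_L2 using assms by (auto intro!: L2_set_triangle_ineq)
  finally show ?thesis .
qed

lemma fnorm_smult [simp]: "fnorm (c \<cdot>\<^sub>m A) = cmod c * fnorm A"
proof -
  have "(fnorm (c \<cdot>\<^sub>m A))\<^sup>2 = (cmod c * fnorm A)\<^sup>2"
    unfolding power_mult_distrib fnorm_sq by (simp add: norm_mult power_mult_distrib sum_distrib_left)
  then show ?thesis by (simp add: power2_eq_iff_nonneg)
qed

lemma fnorm_cong_cmod:
  assumes "dim_row A = dim_row B" "dim_col A = dim_col B"
    and "\<And>i j. i < dim_row B \<Longrightarrow> j < dim_col B \<Longrightarrow> cmod (A $$ (i, j)) = cmod (B $$ (i, j))"
  shows "fnorm A = fnorm B"
  unfolding fnorm_def using assms by auto

lemma fnorm_uminus [simp]: "fnorm (- A) = fnorm A"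
  by (rule fnorm_cong_cmod) auto

lemma fnorm_minus_le:
  assumes "A \<in> carrier_mat n m" "B \<in> carrier_mat n m"
  shows "fnorm (A - B) \<le> fnorm A + fnorm B"
proof -
  have "A - B = A + - B" using assms by auto
  then show ?thesis using fnorm_triangle[of A n m "- B"] assms by simp
qed

lemma fnorm_le_entrywise:
  assumes "X \<in> carrier_mat n m" "Y \<in> carrier_mat n m" "0 \<le> c"
    and "\<And>i j. i < n \<Longrightarrow> j < m \<Longrightarrow> cmod (X $$ (i, j)) \<le> c * cmod (Y $$ (i, j))"
  shows "fnorm X \<le> c * fnorm Y"
proof -
  have "fnorm X \<le> L2_set (\<lambda>ij. c * cmod (Y $$ ij)) ({..<n} \<times> {..<m})"
    unfolding fnorm_L2 using assms by (auto intro!: L2_set_mono)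
  also have "\<dots> = c * fnorm Y"
    unfolding fnorm_L2 using assms by (simp add: L2_set_right_distrib)
  finally show ?thesis .
qed

lemma vnorm_le_entrywise:
  assumes "dim_vec x = dim_vec y" "0 \<le> c"
    and "\<And>i. i < dim_vec y \<Longrightarrow> cmod (x $ i) \<le> c * cmod (y $ i)"
  shows "vnorm x \<le> c * vnorm y"
proof -
  have "vnorm x \<le> L2_set (\<lambda>i. c * cmod (y $ i)) {..<dim_vec y}"
    unfolding vnorm_L2 using assms by (auto intro!: L2_set_mono)
  also have "\<dots> = c * vnorm y"
    unfolding vnorm_L2 using assms by (simp add: L2_set_right_distrib)
  finally show ?thesis .
qed

lemma cmod_le_fnorm:
  assumes "i < dim_row A" "j < dim_col A" shows "cmod (A $$ (i, j)) \<le> fnorm A"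
  unfolding fnorm_L2 using assms member_le_L2_set[of "{..<dim_row A} \<times> {..<dim_col A}" "(i,j)" "\<lambda>ij. cmod (A $$ ij)"]
  by auto

lemma fnorm_eq_0_iff:
  assumes "A \<in> carrier_mat n m" shows "fnorm A = 0 \<longleftrightarrow> A = 0\<^sub>m n m"
  unfolding fnorm_L2 using assms by (subst L2_set_eq_0_iff) (auto intro!: eq_matI)

lemma vnorm_eq_0_iff:
  assumes "x \<in> carrier_vec n" shows "vnorm x = 0 \<longleftrightarrow> x = 0\<^sub>v n"
  unfolding vnorm_L2 using assms by (subst L2_set_eq_0_iff) (auto intro!: eq_vecI)

lemma sum_lessThan_add: "(\<Sum>i<n + m. f i) = (\<Sum>i<n. f i) + (\<Sum>i<(m::nat). f (i + n))"
  for f :: "nat \<Rightarrow> real"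
proof -
  have "(\<Sum>i<n + m. f i) = (\<Sum>i<n. f i) + (\<Sum>i\<in>{n..<n + m}. f i)"
    by (subst sum.union_disjoint[symmetric]) (auto intro!: sum.cong)
  also have "(\<Sum>i\<in>{n..<n + m}. f i) = (\<Sum>i<m. f (i + n))"
    using sum.shift_bounds_nat_ivl[of f 0 n m] by (simp add: lessThan_atLeast0 add.commute)
  finally show ?thesis .
qed

lemma fnorm_sq_blk:
  assumes "A \<in> sq_mat (2 * m)"
  shows "(fnorm A)\<^sup>2 = (fnorm (blk m 0 0 A))\<^sup>2 + (fnorm (blk m 0 1 A))\<^sup>2
    + (fnorm (blk m 1 0 A))\<^sup>2 + (fnorm (blk m 1 1 A))\<^sup>2"
  unfolding fnorm_sq using assms
  by (simp add: mult_2 sum_lessThan_add sum.distrib blk_index)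

lemma fnorm_blk_le:
  assumes "A \<in> sq_mat (2 * m)" "p \<le> 1" "q \<le> 1"
  shows "fnorm (blk m p q A) \<le> fnorm A"
proof (rule power2_le_imp_le)
  have "p = 0 \<or> p = 1" "q = 0 \<or> q = 1" using assms by auto
  then show "(fnorm (blk m p q A))\<^sup>2 \<le> (fnorm A)\<^sup>2"
    unfolding fnorm_sq_blk[OF assms(1)] by (elim disjE) (simp_all add: sum_power2_ge_zero)
qed simp

lemma sqrt_sum4_le:
  fixes a b c d :: real
  assumes "0 \<le> a" "0 \<le> b" "0 \<le> c" "0 \<le> d" "0 \<le> x" "x\<^sup>2 = a\<^sup>2 + b\<^sup>2 + c\<^sup>2 + d\<^sup>2"
  shows "x \<le> a + b + c + d"
proof (rule power2_le_imp_le)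
  have "0 \<le> a * b" "0 \<le> a * c" "0 \<le> a * d" "0 \<le> b * c" "0 \<le> b * d" "0 \<le> c * d"
    using assms by auto
  then show "x\<^sup>2 \<le> (a + b + c + d)\<^sup>2"
    unfolding assms(6) by (simp add: power2_eq_square algebra_simps)
qed (use assms in auto)

lemma fnorm_le_sum_blk:
  assumes "A \<in> sq_mat (2 * m)"
  shows "fnorm A \<le> fnorm (blk m 0 0 A) + fnorm (blk m 0 1 A) + fnorm (blk m 1 0 A) + fnorm (blk m 1 1 A)"
  using fnorm_sq_blk[OF assms] by (intro sqrt_sum4_le) auto

lemma vnorm_append_sq: "(vnorm (x @\<^sub>v y))\<^sup>2 = (vnorm x)\<^sup>2 + (vnorm y)\<^sup>2"
  unfolding vnorm_sq by (simp add: sum_lessThan_add)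

lemma vnorm_append_le: "vnorm x \<le> vnorm (x @\<^sub>v y)" "vnorm y \<le> vnorm (x @\<^sub>v y)"
  by (rule power2_le_imp_le; simp add: vnorm_append_sq)+

lemma vnorm_zero [simp]: "vnorm (0\<^sub>v n) = 0"
  by (simp add: vnorm_def)

lemma vnorm_append_zero [simp]: "vnorm (x @\<^sub>v 0\<^sub>v n) = vnorm x" "vnorm (0\<^sub>v n @\<^sub>v x) = vnorm x"
  using vnorm_append_sq[of x "0\<^sub>v n"] vnorm_append_sq[of "0\<^sub>v n" x] by (simp_all add: power2_eq_iff_nonneg)

lemma scalar_prod_cmod_le:
  assumes "x \<in> carrier_vec n" "y \<in> carrier_vec n"
  shows "cmod (x \<bullet> y) \<le> vnorm x * vnorm y"
proof -
  have "cmod (x \<bullet> y) \<le> (\<Sum>i<n. \<bar>cmod (x $ i)\<bar> * \<bar>cmod (y $ i)\<bar>)"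
    unfolding scalar_prod_def using assms
    by (auto simp: norm_mult lessThan_atLeast0 intro!: order_trans[OF norm_sum])
  also have "\<dots> \<le> vnorm x * vnorm y"
    unfolding vnorm_L2 using assms L2_set_mult_ineq[of "\<lambda>i. cmod (x $ i)" "\<lambda>i. cmod (y $ i)" "{..<n}"] by auto
  finally show ?thesis .
qed

lemma vnorm_mult_le_fnorm:
  assumes "A \<in> carrier_mat n m" "x \<in> carrier_vec m"
  shows "vnorm (A *\<^sub>v x) \<le> fnorm A * vnorm x"
proof (rule power2_le_imp_le)
  have "(vnorm (A *\<^sub>v x))\<^sup>2 = (\<Sum>i<n. (cmod (row A i \<bullet> x))\<^sup>2)"
    unfolding vnorm_sq using assms by auto
  also have "\<dots> \<le> (\<Sum>i<n. (vnorm (row A i))\<^sup>2 * (vnorm x)\<^sup>2)"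
    unfolding power_mult_distrib[symmetric] using assms
    by (intro sum_mono power_mono scalar_prod_cmod_le) auto
  also have "\<dots> = (fnorm A * vnorm x)\<^sup>2"
    unfolding power_mult_distrib fnorm_sq sum_distrib_right vnorm_sq[of "row A _"] using assms
    by (auto intro!: sum.cong)
  finally show "(vnorm (A *\<^sub>v x))\<^sup>2 \<le> (fnorm A * vnorm x)\<^sup>2" .
qed simp

lemma mnorm_set_bdd:
  assumes "A \<in> carrier_mat n m"
  shows "bdd_above {vnorm (A *\<^sub>v v) | v. v \<in> carrier_vec (dim_col A) \<and> vnorm v = 1}"
  using vnorm_mult_le_fnorm[OF assms] assms by (intro bdd_aboveI[of _ "fnorm A"]) force

lemma vnorm_mult_le:
  assumes A: "A \<in> carrier_mat n m" and x: "x \<in> carrier_vec m"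
  shows "vnorm (A *\<^sub>v x) \<le> mnorm A * vnorm x"
proof (cases "vnorm x = 0")
  case True
  then show ?thesis using vnorm_mult_le_fnorm[OF A x] by simp
next
  case False
  define y where "y = complex_of_real (1 / vnorm x) \<cdot>\<^sub>v x"
  have y: "y \<in> carrier_vec m" "vnorm y = 1" using x False by (auto simp: y_def norm_divide)
  have "vnorm (A *\<^sub>v y) \<le> mnorm A" unfolding mnorm_def
    by (rule cSup_upper[OF _ mnorm_set_bdd[OF A]]) (use y A in auto)
  moreover have "A *\<^sub>v y = complex_of_real (1 / vnorm x) \<cdot>\<^sub>v (A *\<^sub>v x)"
    unfolding y_def using A x by (simp add: mult_mat_vec)
  ultimately have "1 / vnorm x * vnorm (A *\<^sub>v x) \<le> mnorm A" using False by (simp add: norm_divide)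
  then show ?thesis using False by (simp add: field_simps pos_divide_le_eq less_le)
qed

lemma unit_vec_vnorm: assumes "i < n" shows "vnorm (unit_vec n i) = 1"
proof -
  have "(vnorm (unit_vec n i))\<^sup>2 = (\<Sum>k<n. if k = i then 1 else 0)" unfolding vnorm_sq
    using assms by (intro sum.cong) (auto simp: index_unit_vec)
  then have "(vnorm (unit_vec n i))\<^sup>2 = 1" using assms by simp
  then show ?thesis by (metis one_power2 power2_eq_iff_nonneg vnorm_nonneg zero_le_one)
qed

lemma mnorm_le:
  assumes A: "A \<in> carrier_mat n m" "m > 0"
    and le: "\<And>x. x \<in> carrier_vec m \<Longrightarrow> vnorm x = 1 \<Longrightarrow> vnorm (A *\<^sub>v x) \<le> c"
  shows "mnorm A \<le> c"
  unfolding mnorm_def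
proof (rule cSup_least)
  have "unit_vec m 0 \<in> carrier_vec m" "vnorm (unit_vec m 0) = 1" using unit_vec_vnorm[of 0 m] A by auto
  then show "{vnorm (A *\<^sub>v v) |v. v \<in> carrier_vec (dim_col A) \<and> vnorm v = 1} \<noteq> {}" using A by blast
qed (use A le in auto)

lemma mnorm_le_fnorm:
  assumes "A \<in> carrier_mat n m" "m > 0" shows "mnorm A \<le> fnorm A"
  using vnorm_mult_le_fnorm[OF assms(1)] assms by (intro mnorm_le) force+

lemma mnorm_nonneg: assumes "A \<in> carrier_mat n m" "m > 0" shows "0 \<le> mnorm A"
  using order_trans[OF vnorm_nonneg vnorm_mult_le[OF assms(1), of "unit_vec m 0"]] unit_vec_vnorm[of 0 m] assms by simp

text \<open>The mixed bounds, here and with the factors exchanged, use the 2-norm of one factor and the Frobenius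
norm of the other and lose no power of the dimension.  This matters: a factor \<open>sqrt n\<close> lost at each of the \<open>log\<^sub>2 n\<close> levels of the eigenvector
recursion would add up to more than any power of \<open>n\<close>.\<close>

lemma fnorm_mult_le:
  assumes A: "A \<in> carrier_mat n m" "m > 0" and B: "B \<in> carrier_mat m l"
  shows "fnorm (A * B) \<le> mnorm A * fnorm B"
proof (rule power2_le_imp_le)
  have "(fnorm (A * B))\<^sup>2 = (\<Sum>j<l. (vnorm (A *\<^sub>v col B j))\<^sup>2)"
    unfolding fnorm_sq_cols using A B by (auto intro!: sum.cong simp: col_mult2[OF A(1) B])
  also have "\<dots> \<le> (\<Sum>j<l. (mnorm A * vnorm (col B j))\<^sup>2)"
    using A B by (intro sum_mono power_mono vnorm_mult_le) auto
  also have "\<dots> = (mnorm A * fnorm B)\<^sup>2"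
    unfolding power_mult_distrib fnorm_sq_cols sum_distrib_left using B by simp
  finally show "(fnorm (A * B))\<^sup>2 \<le> (mnorm A * fnorm B)\<^sup>2" .
qed (simp add: mnorm_nonneg[OF A])

lemma fnorm_transpose: "fnorm (transpose_mat A) = fnorm A"
  unfolding fnorm_def by (subst sum.swap) simp

text \<open>For \<open>z = A\<^sup>T x\<close> one has \<open>\<parallel>z\<parallel>\<^sup>2 = x \<bullet> (A c)\<close> with \<open>c\<close> the entrywise conjugate of \<open>z\<close>, so Cauchy-Schwarz
bounds \<open>\<parallel>z\<parallel>\<close> by the 2-norm of \<open>A\<close>.\<close>

lemma mnorm_transpose_le:
  assumes A: "A \<in> sq_mat n" "n > 0"
  shows "mnorm (transpose_mat A) \<le> mnorm A"
proof (rule mnorm_le[of _ n n])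
  fix x :: "complex vec" assume x: "x \<in> carrier_vec n" "vnorm x = 1"
  define z where "z = transpose_mat A *\<^sub>v x"
  define c where "c = map_vec cnj z"
  have z: "z \<in> carrier_vec n" "c \<in> carrier_vec n" using A x by (auto simp: z_def c_def)
  have "vnorm c = vnorm z" by (simp add: vnorm_def c_def)
  have "complex_of_real ((vnorm z)\<^sup>2) = (\<Sum>i<n. complex_of_real ((cmod (z $ i))\<^sup>2))"
    unfolding vnorm_sq using z by simp
  also have "\<dots> = z \<bullet> c"
    unfolding scalar_prod_def complex_norm_square using z by (auto simp: c_def lessThan_atLeast0 intro!: sum.cong)
  also have "\<dots> = x \<bullet> (A *\<^sub>v c)"
    using transpose_vec_mult_scalar[OF A(1) z(2) x(1)] unfolding z_def by simp
  finally have "(vnorm z)\<^sup>2 = cmod (x \<bullet> (A *\<^sub>v c))"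
    by (metis abs_of_nonneg norm_of_real zero_le_power2)
  also have "\<dots> \<le> vnorm x * vnorm (A *\<^sub>v c)"
    using x A z by (intro scalar_prod_cmod_le) auto
  also have "\<dots> \<le> mnorm A * vnorm z"
    using vnorm_mult_le[OF A(1) z(2)] x \<open>vnorm c = vnorm z\<close> by simp
  finally have "vnorm z * vnorm z \<le> mnorm A * vnorm z" by (simp add: power2_eq_square)
  then show "vnorm (transpose_mat A *\<^sub>v x) \<le> mnorm A"
    unfolding z_def[symmetric] using mnorm_nonneg[OF A] vnorm_nonneg[of z]
    by (metis mult_right_le_imp_le less_eq_real_def)
qed (use A in auto)

lemma fnorm_mult_le_right:
  assumes A: "A \<in> carrier_mat l n" and B: "B \<in> sq_mat n" "n > 0"
  shows "fnorm (A * B) \<le> fnorm A * mnorm B"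
proof -
  have "fnorm (A * B) = fnorm (transpose_mat B * transpose_mat A)"
    using A B by (simp add: transpose_mult[symmetric] fnorm_transpose)
  also have "\<dots> \<le> mnorm (transpose_mat B) * fnorm (transpose_mat A)"
    using A B by (intro fnorm_mult_le[of _ n n _ l]) auto
  also have "\<dots> \<le> mnorm B * fnorm A"
    unfolding fnorm_transpose using mnorm_transpose_le[OF B] by (simp add: mult_right_mono)
  finally show ?thesis by (simp add: mult.commute)
qed

lemma fnorm_le_sqrt_mnorm:
  assumes A: "A \<in> carrier_mat n m" "m > 0"
  shows "fnorm A \<le> sqrt m * mnorm A"
proof (rule power2_le_imp_le)
  have "vnorm (col A j) \<le> mnorm A" if "j < m" for j
  proof -
    have "col A j = A *\<^sub>v unit_vec m j"
      using col_mult2[OF A(1) one_carrier_mat that] that by (simp add: right_mult_one_mat[OF A(1)])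
    then show ?thesis using vnorm_mult_le[OF A(1), of "unit_vec m j"] unit_vec_vnorm[OF that] by simp
  qed
  then have "(\<Sum>j<m. (vnorm (col A j))\<^sup>2) \<le> (\<Sum>j<m. (mnorm A)\<^sup>2)"
    by (intro sum_mono power_mono) auto
  then show "(fnorm A)\<^sup>2 \<le> (sqrt m * mnorm A)\<^sup>2"
    unfolding fnorm_sq_cols power_mult_distrib using A by simp
qed (simp add: mnorm_nonneg[OF A])

lemma vnorm_col_le_fnorm:
  assumes "j < dim_col A" shows "vnorm (col A j) \<le> fnorm A"
proof (rule power2_le_imp_le)
  show "(vnorm (col A j))\<^sup>2 \<le> (fnorm A)\<^sup>2"
    unfolding fnorm_sq_cols using assms by (intro member_le_sum) auto
qed simp

lemma fnorm_le_cols: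
  assumes "A \<in> carrier_mat n m" "\<And>j. j < m \<Longrightarrow> vnorm (col A j) \<le> c"  "0 \<le> c"
  shows "fnorm A \<le> sqrt m * c"
proof (rule power2_le_imp_le)
  have "(\<Sum>j<m. (vnorm (col A j))\<^sup>2) \<le> (\<Sum>j<m. c\<^sup>2)"
    using assms by (intro sum_mono power_mono) auto
  then show "(fnorm A)\<^sup>2 \<le> (sqrt m * c)\<^sup>2"
    unfolding fnorm_sq_cols power_mult_distrib using assms by simp
qed (use assms in simp)

lemma fnorm_one: "fnorm (1\<^sub>m n) = sqrt n"
proof -
  have "(fnorm (1\<^sub>m n))\<^sup>2 = (\<Sum>i<n. \<Sum>j<n. if j = i then 1 else 0)" unfolding fnorm_sq
    by (intro sum.cong) auto
  then have "(fnorm (1\<^sub>m n))\<^sup>2 = real n" by simp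
  then show ?thesis by (metis fnorm_nonneg real_sqrt_unique)
qed

lemma mnorm_blk_le:
  assumes A: "A \<in> sq_mat (2 * m)" "m > 0" and "p \<le> 1" "q \<le> 1"
  shows "mnorm (blk m p q A) \<le> mnorm A"
proof (rule mnorm_le[of _ m m])
  fix x :: "complex vec" assume x: "x \<in> carrier_vec m" "vnorm x = 1"
  have split: "A *\<^sub>v (y @\<^sub>v z) = (blk m 0 0 A *\<^sub>v y + blk m 0 1 A *\<^sub>v z) @\<^sub>v (blk m 1 0 A *\<^sub>v y + blk m 1 1 A *\<^sub>v z)"
    if "y \<in> carrier_vec m" "z \<in> carrier_vec m" for y z
    unfolding four_block_mat_mult_vec[OF blk_carrier blk_carrier blk_carrier blk_carrier that, symmetric]
      four_block_blk[OF A(1), symmetric] ..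
  have zero_mat_laws: "blk m p q A *\<^sub>v 0\<^sub>v m = 0\<^sub>v m" for p q by (intro eq_vecI) auto
  have c: "blk m p q A *\<^sub>v x \<in> carrier_vec m" for p q using x by (intro mult_mat_vec_carrier[OF blk_carrier])
  have "vnorm (A *\<^sub>v (x @\<^sub>v 0\<^sub>v m)) \<le> mnorm A" "vnorm (A *\<^sub>v (0\<^sub>v m @\<^sub>v x)) \<le> mnorm A"
    using vnorm_mult_le[OF A(1), of "x @\<^sub>v 0\<^sub>v m"] vnorm_mult_le[OF A(1), of "0\<^sub>v m @\<^sub>v x"] x
    by (auto simp: mult_2)
  moreover have "A *\<^sub>v (x @\<^sub>v 0\<^sub>v m) = (blk m 0 0 A *\<^sub>v x) @\<^sub>v (blk m 1 0 A *\<^sub>v x)"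
    "A *\<^sub>v (0\<^sub>v m @\<^sub>v x) = (blk m 0 1 A *\<^sub>v x) @\<^sub>v (blk m 1 1 A *\<^sub>v x)"
    using split[of x "0\<^sub>v m"] split[of "0\<^sub>v m" x] x c by (simp_all add: zero_mat_laws right_zero_vec[OF c] left_zero_vec[OF c])
  moreover have "p = 0 \<or> p = 1" "q = 0 \<or> q = 1" using assms by auto
  ultimately show "vnorm (blk m p q A *\<^sub>v x) \<le> mnorm A"
    by (elim disjE) (simp_all, (meson vnorm_append_le order_trans)+)
qed (use assms in auto)

section \<open>The separation of two matrices\<close>

lemma sep_bound:
  assumes A: "A \<in> sq_mat n" and B: "B \<in> sq_mat m" and Z: "Z \<in> carrier_mat n m"
    and s: "s \<le> sep A B"
  shows "s * fnorm Z \<le> fnorm (A * Z - Z * B)"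
proof (cases "fnorm Z = 0")
  case False
  define c where "c = complex_of_real (1 / fnorm Z)"
  have "fnorm (c \<cdot>\<^sub>m Z) = 1" using False by (simp add: c_def norm_divide)
  then have "sep A B \<le> fnorm (A * (c \<cdot>\<^sub>m Z) - (c \<cdot>\<^sub>m Z) * B)"
    unfolding sep_def by (intro cInf_lower bdd_belowI[of _ 0]) (use A B Z in auto)
  also have "A * (c \<cdot>\<^sub>m Z) - (c \<cdot>\<^sub>m Z) * B = c \<cdot>\<^sub>m (A * Z - Z * B)"
    using A B Z by (intro eq_matI) (auto simp: algebra_simps)
  also have "fnorm \<dots> = fnorm (A * Z - Z * B) / fnorm Z" by (simp add: c_def norm_divide)
  finally have "s \<le> fnorm (A * Z - Z * B) / fnorm Z" using s by simp
  then show ?thesis using False by (simp add: pos_le_divide_eq less_le)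
qed simp

text \<open>The identity matrix is the test matrix.\<close>

lemma sep_le_mnorm:
  assumes A: "A \<in> sq_mat n" "n > 0" and B: "B \<in> sq_mat n"
  shows "sep A B \<le> mnorm A + mnorm B"
proof -
  have "sep A B * fnorm (1\<^sub>m n) \<le> fnorm (A * 1\<^sub>m n - 1\<^sub>m n * B)"
    using sep_bound[OF A(1) B, of "1\<^sub>m n" "sep A B"] by simp
  also have "\<dots> = fnorm (A * 1\<^sub>m n + - (1\<^sub>m n * B))"
    using A B by (intro arg_cong[of _ _ fnorm]) auto
  also have "\<dots> \<le> fnorm (A * 1\<^sub>m n) + fnorm (1\<^sub>m n * B)"
    using fnorm_triangle[of "A * 1\<^sub>m n" n n "- (1\<^sub>m n * B)"] A B by simp
  also have "\<dots> \<le> mnorm A * fnorm (1\<^sub>m n) + fnorm (1\<^sub>m n) * mnorm B"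
    using A B by (intro add_mono fnorm_mult_le fnorm_mult_le_right) auto
  finally have "sep A B * sqrt n \<le> (mnorm A + mnorm B) * sqrt n"
    by (simp add: fnorm_one algebra_simps)
  then show ?thesis using A(2) by simp
qed

text \<open>If \<open>a\<close> is an eigenvalue of both matrices, with \<open>A x = a x\<close> and \<open>B\<^sup>T y = a y\<close>, then the rank-one matrix
\<open>R = x y\<^sup>T\<close> satisfies \<open>A R = R B\<close>, and the separation vanishes.  Hence, in exact arithmetic, all divisions in
the Sylvester recursion are by nonzero numbers.\<close>

lemma sep_pos_imp_diag_distinct:
  assumes A: "A \<in> sq_mat n" "upper_triangular A" and B: "B \<in> sq_mat m" "upper_triangular B"
    and pos: "0 < sep A B" and i: "i < n" and j: "j < m"
  shows "A $$ (i, i) \<noteq> B $$ (j, j)"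
proof
  assume eq: "A $$ (i, i) = B $$ (j, j)"
  define a where "a = A $$ (i, i)"
  have "poly (char_poly A) a = 0" "poly (char_poly (transpose_mat B)) a = 0"
    unfolding char_poly_transpose_mat[OF B(1)] char_poly_upper_triangular[OF A] char_poly_upper_triangular[OF B]
    using A B i j eq eq[symmetric] by (auto simp: poly_prod_list prod_list_zero_iff diag_mat_def a_def intro: rev_image_eqI[of i] rev_image_eqI[of j])
  then have "eigenvalue A a" "eigenvalue (transpose_mat B) a"
    using eigenvalue_root_char_poly[OF A(1)] eigenvalue_root_char_poly[of "transpose_mat B" m] B by auto
  then obtain x y where x: "x \<in> carrier_vec n" "x \<noteq> 0\<^sub>v n" "A *\<^sub>v x = a \<cdot>\<^sub>v x"
    and y: "y \<in> carrier_vec m" "y \<noteq> 0\<^sub>v m" "transpose_mat B *\<^sub>v y = a \<cdot>\<^sub>v y"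
    using A B by (auto simp: eigenvalue_def eigenvector_def)
  define R where "R = mat n m (\<lambda>(i, j). x $ i * y $ j)"
  have R: "R \<in> carrier_mat n m" by (simp add: R_def)
  have "A * R - R * B = 0\<^sub>m n m"
  proof (rule eq_matI)
    fix p q assume "p < dim_row (0\<^sub>m n m)" "q < dim_col (0\<^sub>m n m)"
    then have pq: "p < n" "q < m" by auto
    have "(A * R) $$ (p, q) = (A *\<^sub>v x) $ p * y $ q"
      using A R x(1) pq by (auto simp: R_def scalar_prod_def sum_distrib_right mult.assoc)
    moreover have "(R * B) $$ (p, q) = x $ p * (transpose_mat B *\<^sub>v y) $ q"
      using B R y(1) pq by (auto simp: R_def scalar_prod_def sum_distrib_left mult_ac intro!: sum.cong)
    ultimately show "(A * R - R * B) $$ (p, q) = 0\<^sub>m n m $$ (p, q)"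
      using A B R x y pq by (simp del: index_mult_mat(1) index_mult_mat_vec)
  qed (use A B R in auto)
  then have "sep A B * fnorm R \<le> 0"
    using sep_bound[OF A(1) B(1) R order.refl] fnorm_eq_0_iff[of "0\<^sub>m n m" n m] by simp
  then have "fnorm R = 0" using pos fnorm_nonneg[of R] by (simp add: mult_le_0_iff)
  then have R0: "R = 0\<^sub>m n m" using fnorm_eq_0_iff[OF R] by simp
  obtain p q where "p < n" "x $ p \<noteq> 0" "q < m" "y $ q \<noteq> 0"
    using x y by (metis carrier_vecD eq_vecI index_zero_vec)
  then have "R $$ (p, q) \<noteq> 0" by (simp add: R_def)
  then show False using R0 \<open>p < n\<close> \<open>q < m\<close> by simp
qed

section \<open>Block arithmetic and the Sylvester residual\<close>

lemma blk_mult: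
  assumes A: "A \<in> sq_mat (2 * m)" and B: "B \<in> sq_mat (2 * m)" and "p \<le> 1" "q \<le> 1"
  shows "blk m p q (A * B) = blk m p 0 A * blk m 0 q B + blk m p 1 A * blk m 1 q B"
proof -
  have *: "A * B = four_block_mat (blk m 0 0 A) (blk m 0 1 A) (blk m 1 0 A) (blk m 1 1 A)
     * four_block_mat (blk m 0 0 B) (blk m 0 1 B) (blk m 1 0 B) (blk m 1 1 B)"
    unfolding four_block_blk[OF A, symmetric] four_block_blk[OF B, symmetric] ..
  have c: "blk m p 0 A * blk m 0 q B + blk m p 1 A * blk m 1 q B \<in> sq_mat m" for p q
    by (intro add_carrier_mat mult_carrier_mat[of _ m m] blk_carrier)
  have "p = 0 \<or> p = 1" "q = 0 \<or> q = 1" using assms by auto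
  then show ?thesis
    unfolding * mult_four_block_mat[OF blk_carrier blk_carrier blk_carrier blk_carrier
      blk_carrier blk_carrier blk_carrier blk_carrier] One_nat_def
    by (elim disjE) (simp_all only: blk_four_block[OF c c c c, simplified One_nat_def] One_nat_def)
qed

lemma blk_bound: "p \<le> 1 \<Longrightarrow> i < m \<Longrightarrow> i + p * m < 2 * (m::nat)"
  by (cases p) auto

lemma blk_add:
  assumes "A \<in> sq_mat (2 * m)" "B \<in> sq_mat (2 * m)" "p \<le> 1" "q \<le> 1"
  shows "blk m p q (A + B) = blk m p q A + blk m p q B"
  using assms by (intro eq_matI) (auto simp: blk_index blk_bound)

lemma blk_minus:
  assumes "A \<in> sq_mat (2 * m)" "B \<in> sq_mat (2 * m)" "p \<le> 1" "q \<le> 1"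
  shows "blk m p q (A - B) = blk m p q A - blk m p q B"
  using assms by (intro eq_matI) (auto simp: blk_index blk_bound)

lemma blk_upper_triangular:
  assumes A: "A \<in> sq_mat (2 * m)" and u: "upper_triangular A"
  shows "upper_triangular (blk m 0 0 A)" "upper_triangular (blk m 1 1 A)" "blk m 1 0 A = 0\<^sub>m m m"
  using assms by (auto simp: upper_triangular_def blk_index intro!: eq_matI)

text \<open>The defect of \<open>R\<close> as a solution of \<open>A R - R B = - C\<close>.\<close>

definition residual :: "complex mat \<Rightarrow> complex mat \<Rightarrow> complex mat \<Rightarrow> complex mat \<Rightarrow> complex mat" where
  "residual A B C R = A * R - R * B + C"

lemma residual_carrier:
  assumes "A \<in> sq_mat n" "B \<in> sq_mat n" "C \<in> sq_mat n" "R \<in> sq_mat n"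
  shows "residual A B C R \<in> sq_mat n"
  using assms by (auto simp: residual_def)

lemma residual_zeroD:
  fixes P Q C :: "complex mat"
  assumes "P \<in> sq_mat n" "Q \<in> sq_mat n" "C \<in> sq_mat n" and z: "P - Q + C = 0\<^sub>m n n"
  shows "P + C = Q" "C = Q - P" "P - Q = - C"
proof -
  have "P $$ (i, j) - Q $$ (i, j) + C $$ (i, j) = 0" if "i < n" "j < n" for i j
    using arg_cong[OF z, of "\<lambda>X. X $$ (i, j)"] assms(1-3) that by auto
  then have "Q $$ (i, j) = P $$ (i, j) + C $$ (i, j)" if "i < n" "j < n" for i j
    using that unfolding diff_add_eq by simp
  then show "P + C = Q" "C = Q - P" "P - Q = - C"
    using assms(1-3) by (auto intro!: eq_matI)
qed

lemma zero_mat_laws: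
  fixes X :: "complex mat"
  assumes "X \<in> sq_mat m"
  shows "X * 0\<^sub>m m m = 0\<^sub>m m m" "0\<^sub>m m m * X = 0\<^sub>m m m" "0\<^sub>m m m + X = X" "X + 0\<^sub>m m m = X"
  using assms by auto

text \<open>The matrix \<open>D\<close> stands for a computed right-hand side of one of the four smaller equations.  The
defect of the large equation then consists of the defects of the small ones, taken with their
computed right-hand sides, and of the errors in those right-hand sides.\<close>

lemma residual_blk:
  assumes A: "A \<in> sq_mat (2 * m)" "upper_triangular A"
    and B: "B \<in> sq_mat (2 * m)" "upper_triangular B"
    and C: "C \<in> sq_mat (2 * m)" and R: "R \<in> sq_mat (2 * m)"
    and D: "D \<in> sq_mat m"
  shows "blk m 1 0 (residual A B C R) = residual (blk m 1 1 A) (blk m 0 0 B) (blk m 1 0 C) (blk m 1 0 R)"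
    and "blk m 0 0 (residual A B C R) = residual (blk m 0 0 A) (blk m 0 0 B) D (blk m 0 0 R)
        - (D - (blk m 0 0 C + blk m 0 1 A * blk m 1 0 R))"
    and "blk m 1 1 (residual A B C R) = residual (blk m 1 1 A) (blk m 1 1 B) D (blk m 1 1 R)
        - (D - (blk m 1 1 C - blk m 1 0 R * blk m 0 1 B))"
    and "blk m 0 1 (residual A B C R) = residual (blk m 0 0 A) (blk m 1 1 B) D (blk m 0 1 R)
        - (D - (blk m 0 1 C - blk m 0 0 R * blk m 0 1 B + blk m 0 1 A * blk m 1 1 R))"
proof -
  have b: "blk m p q (residual A B C R) =
      (blk m p 0 A * blk m 0 q R + blk m p 1 A * blk m 1 q R)
      - (blk m p 0 R * blk m 0 q B + blk m p 1 R * blk m 1 q B) + blk m p q C" if "p \<le> 1" "q \<le> 1" for p q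
  proof -
    have AR: "A * R \<in> sq_mat (2 * m)" and RB: "R * B \<in> sq_mat (2 * m)"
      using A B R by auto
    from minus_carrier_mat[OF RB] have "A * R - R * B \<in> sq_mat (2 * m)" .
    then show ?thesis
      unfolding residual_def using blk_add[OF _ C that] blk_minus[OF AR RB that]
        blk_mult[OF A(1) R that] blk_mult[OF R B(1) that] by simp
  qed
  have z: "blk m 1 0 A = 0\<^sub>m m m" "blk m 1 0 B = 0\<^sub>m m m"
    using blk_upper_triangular A B by auto
  have c: "X * Y \<in> sq_mat m" if "X \<in> sq_mat m" "Y \<in> sq_mat m" for X Y :: "complex mat"
    using that by auto
  have rearr: "P + Q - U + W = P - U + E - (E - (W + Q))"
    "P - (Q + U) + W = P - U + E - (E - (W - Q))"
    if "P \<in> sq_mat m" "Q \<in> sq_mat m" "U \<in> sq_mat m" "W \<in> sq_mat m"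
      "E \<in> sq_mat m"
    for P Q U W E :: "complex mat"
    using that by (auto intro!: eq_matI)
  have rearr': "P + Q - (U + V) + W = P - V + E - (E - (W - U + Q))"
    if "P \<in> sq_mat m" "Q \<in> sq_mat m" "U \<in> sq_mat m" "V \<in> sq_mat m"
      "W \<in> sq_mat m" "E \<in> sq_mat m"
    for P Q U V W E :: "complex mat"
    using that by (auto intro!: eq_matI)
  note s = zero_mat_laws c blk_carrier
  show "blk m 1 0 (residual A B C R) = residual (blk m 1 1 A) (blk m 0 0 B) (blk m 1 0 C) (blk m 1 0 R)"
    unfolding b[OF order.refl le0] unfolding z residual_def by (simp only: s)
  show "blk m 0 0 (residual A B C R) = residual (blk m 0 0 A) (blk m 0 0 B) D (blk m 0 0 R)
        - (D - (blk m 0 0 C + blk m 0 1 A * blk m 1 0 R))"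
    unfolding b[OF le0 le0] unfolding z residual_def
    by (simp only: s) (rule rearr; (intro s D))
  show "blk m 1 1 (residual A B C R) = residual (blk m 1 1 A) (blk m 1 1 B) D (blk m 1 1 R)
        - (D - (blk m 1 1 C - blk m 1 0 R * blk m 0 1 B))"
    unfolding b[OF order.refl order.refl] unfolding z residual_def
    by (simp only: s) (rule rearr; (intro s D))
  show "blk m 0 1 (residual A B C R) = residual (blk m 0 0 A) (blk m 1 1 B) D (blk m 0 1 R)
        - (D - (blk m 0 1 C - blk m 0 0 R * blk m 0 1 B + blk m 0 1 A * blk m 1 1 R))"
    unfolding b[OF le0 order.refl] unfolding z residual_def
    by (rule rearr'; (intro s D))
qed

section \<open>The Sylvester recursion in exact arithmetic\<close>

text \<open>The intermediate results of one recursion step, as functions of the arithmetic: with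
\<open>ar = fl \<epsilon>\<close> they become functions of \<open>\<epsilon>\<close> that can be followed as \<open>\<epsilon>\<close> tends to zero.\<close>

definition syl21 where
  "syl21 ar k A B C = fst (SylR ar k (blk (2 ^ k) 1 1 A) (blk (2 ^ k) 0 0 B) (blk (2 ^ k) 1 0 C))"
definition rhs11 where
  "rhs11 ar k A B C = fst (mat_add ar (blk (2 ^ k) 0 0 C) (fst (matmul ar (blk (2 ^ k) 0 1 A) (syl21 ar k A B C))))"
definition syl11 where
  "syl11 ar k A B C = fst (SylR ar k (blk (2 ^ k) 0 0 A) (blk (2 ^ k) 0 0 B) (rhs11 ar k A B C))"
definition rhs22 where
  "rhs22 ar k A B C = fst (mat_sub ar (blk (2 ^ k) 1 1 C) (fst (matmul ar (syl21 ar k A B C) (blk (2 ^ k) 0 1 B))))"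
definition syl22 where
  "syl22 ar k A B C = fst (SylR ar k (blk (2 ^ k) 1 1 A) (blk (2 ^ k) 1 1 B) (rhs22 ar k A B C))"
definition rhs12_part where
  "rhs12_part ar k A B C = fst (mat_sub ar (blk (2 ^ k) 0 1 C) (fst (matmul ar (syl11 ar k A B C) (blk (2 ^ k) 0 1 B))))"
definition rhs12 where
  "rhs12 ar k A B C = fst (mat_add ar (rhs12_part ar k A B C) (fst (matmul ar (blk (2 ^ k) 0 1 A) (syl22 ar k A B C))))"
definition syl12 where
  "syl12 ar k A B C = fst (SylR ar k (blk (2 ^ k) 0 0 A) (blk (2 ^ k) 1 1 B) (rhs12 ar k A B C))"

lemmas syl_defs = syl21_def rhs11_def syl11_def rhs22_def syl22_def rhs12_part_def rhs12_def syl12_def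

lemma SylR_Suc_fst:
  assumes "A \<in> sq_mat (2 * 2 ^ k)" "B \<in> sq_mat (2 * 2 ^ k)"
      "C \<in> sq_mat (2 * 2 ^ k)"
  shows "fst (SylR ar (Suc k) A B C)
    = four_block_mat (syl11 ar k A B C) (syl12 ar k A B C) (syl21 ar k A B C) (syl22 ar k A B C)"
  unfolding syl_defs using assms by (simp add: split_block_blk Let_def split_beta)

lemma SylR_Suc_snd:
  assumes "A \<in> sq_mat (2 * 2 ^ k)" "B \<in> sq_mat (2 * 2 ^ k)"
      "C \<in> sq_mat (2 * 2 ^ k)"
  shows "snd (SylR ar (Suc k) A B C)
    = snd (SylR ar k (blk (2 ^ k) 1 1 A) (blk (2 ^ k) 0 0 B) (blk (2 ^ k) 1 0 C))
      + snd (SylR ar k (blk (2 ^ k) 0 0 A) (blk (2 ^ k) 0 0 B) (rhs11 ar k A B C))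
      + snd (SylR ar k (blk (2 ^ k) 1 1 A) (blk (2 ^ k) 1 1 B) (rhs22 ar k A B C))
      + snd (SylR ar k (blk (2 ^ k) 0 0 A) (blk (2 ^ k) 1 1 B) (rhs12 ar k A B C))
      + snd (matmul ar (blk (2 ^ k) 0 1 A) (syl21 ar k A B C))
      + snd (matmul ar (syl21 ar k A B C) (blk (2 ^ k) 0 1 B))
      + snd (matmul ar (syl11 ar k A B C) (blk (2 ^ k) 0 1 B))
      + snd (matmul ar (blk (2 ^ k) 0 1 A) (syl22 ar k A B C)) + 4 * (2 ^ k * 2 ^ k)"
  unfolding syl_defs using assms by (simp add: split_block_blk Let_def split_beta mat_add_def mat_sub_def)

lemma mat_add_carrier: "X \<in> carrier_mat n m \<Longrightarrow> fst (mat_add ar X Y) \<in> carrier_mat n m"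
  and mat_sub_carrier: "X \<in> carrier_mat n m \<Longrightarrow> fst (mat_sub ar X Y) \<in> carrier_mat n m"
  by (auto simp: mat_add_def mat_sub_def)

lemma matmul_carrier:
  "square_matmul ar \<Longrightarrow> A \<in> sq_mat n \<Longrightarrow> B \<in> sq_mat n \<Longrightarrow> fst (matmul ar A B) \<in> sq_mat n"
  by (auto simp: square_matmul_def)

lemma square_matmul_exact: "square_matmul exact"
  by (auto simp: square_matmul_def exact_def)

lemma exact_simps [simp]: "matmul exact A B = (A * B, 0)" "add exact = (+)" "sub exact = (-)"
  "mul exact = (*)" "quot exact = (/)" "root2 exact = csqrt"
  by (simp_all add: exact_def)

lemma mat_add_exact: "X \<in> carrier_mat n m \<Longrightarrow> Y \<in> carrier_mat n m \<Longrightarrow> fst (mat_add exact X Y) = X + Y"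
  and mat_sub_exact: "X \<in> carrier_mat n m \<Longrightarrow> Y \<in> carrier_mat n m \<Longrightarrow> fst (mat_sub exact X Y) = X - Y"
  by (auto simp: mat_add_def mat_sub_def intro!: eq_matI)

lemma rhs_carrier:
  "rhs11 ar k A B C \<in> sq_mat (2 ^ k)" "rhs22 ar k A B C \<in> sq_mat (2 ^ k)"
  "rhs12_part ar k A B C \<in> sq_mat (2 ^ k)" "rhs12 ar k A B C \<in> sq_mat (2 ^ k)"
  unfolding syl_defs by (intro mat_add_carrier mat_sub_carrier blk_carrier)+

lemma SylR_carrier:
  assumes "square_matmul ar"
  shows "A \<in> sq_mat (2 ^ k) \<Longrightarrow> B \<in> sq_mat (2 ^ k) \<Longrightarrow> C \<in> sq_mat (2 ^ k) \<Longrightarrow>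
    fst (SylR ar k A B C) \<in> sq_mat (2 ^ k)"
proof (induction k arbitrary: A B C)
  case (Suc k)
  then have c: "A \<in> sq_mat (2 * 2 ^ k)" "B \<in> sq_mat (2 * 2 ^ k)"
      "C \<in> sq_mat (2 * 2 ^ k)" by simp_all
  have "syl11 ar k A B C \<in> sq_mat (2 ^ k)" "syl22 ar k A B C \<in> sq_mat (2 ^ k)"
    unfolding syl11_def syl22_def by (intro Suc.IH blk_carrier rhs_carrier)+
  from four_block_carrier_double[OF this] show ?case
    unfolding SylR_Suc_fst[OF c] by simp
qed simp

lemma syl_carrier:
  assumes "square_matmul ar"
  shows "syl21 ar k A B C \<in> sq_mat (2 ^ k)" "syl11 ar k A B C \<in> sq_mat (2 ^ k)"
  "syl22 ar k A B C \<in> sq_mat (2 ^ k)" "syl12 ar k A B C \<in> sq_mat (2 ^ k)"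
  unfolding syl21_def syl11_def syl22_def syl12_def by (intro SylR_carrier[OF assms] blk_carrier rhs_carrier)+

lemma SylR_Suc_blk:
  assumes "square_matmul ar" and "A \<in> sq_mat (2 * 2 ^ k)" "B \<in> sq_mat (2 * 2 ^ k)"
      "C \<in> sq_mat (2 * 2 ^ k)"
  shows "blk (2 ^ k) 0 0 (fst (SylR ar (Suc k) A B C)) = syl11 ar k A B C"
    "blk (2 ^ k) 0 1 (fst (SylR ar (Suc k) A B C)) = syl12 ar k A B C"
    "blk (2 ^ k) 1 0 (fst (SylR ar (Suc k) A B C)) = syl21 ar k A B C"
    "blk (2 ^ k) 1 1 (fst (SylR ar (Suc k) A B C)) = syl22 ar k A B C"
  unfolding SylR_Suc_fst[OF assms(2-4)]
  using blk_four_block[OF syl_carrier(2,4,1,3)[OF assms(1)]] by simp_all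

definition solvable :: "nat \<Rightarrow> complex mat \<Rightarrow> complex mat \<Rightarrow> bool" where
  "solvable n A B \<longleftrightarrow> A \<in> sq_mat n \<and> B \<in> sq_mat n \<and> upper_triangular A \<and> upper_triangular B
     \<and> (\<forall>i<n. \<forall>j<n. A $$ (i, i) \<noteq> B $$ (j, j))"

lemma solvable_carrier:
  assumes "solvable n A B" shows "A \<in> sq_mat n" "B \<in> sq_mat n"
  using assms by (auto simp: solvable_def)

lemma solvable_blk:
  assumes "solvable (2 * m) A B" "p \<le> 1" "q \<le> 1"
  shows "solvable m (blk m p p A) (blk m q q B)"
proof -
  have "p = 0 \<or> p = 1" "q = 0 \<or> q = 1" using assms by auto
  then show ?thesis using assms unfolding solvable_def
    by (elim disjE) (simp_all add: blk_upper_triangular blk_upper_triangular[simplified] blk_index)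
qed

lemma eq_blkI:
  assumes "A \<in> sq_mat (2 * m)" "B \<in> sq_mat (2 * m)"
    "blk m 0 0 A = blk m 0 0 B" "blk m 0 1 A = blk m 0 1 B" "blk m 1 0 A = blk m 1 0 B" "blk m 1 1 A = blk m 1 1 B"
  shows "A = B"
  using four_block_blk[OF assms(1)] four_block_blk[OF assms(2)] assms(3-) by metis

lemma rhs_exact:
  assumes C: "C \<in> sq_mat (2 * 2 ^ k)"
  shows "rhs11 exact k A B C = blk (2 ^ k) 0 0 C + blk (2 ^ k) 0 1 A * syl21 exact k A B C" (is ?a)
    "rhs22 exact k A B C = blk (2 ^ k) 1 1 C - syl21 exact k A B C * blk (2 ^ k) 0 1 B" (is ?b)
    "rhs12_part exact k A B C = blk (2 ^ k) 0 1 C - syl11 exact k A B C * blk (2 ^ k) 0 1 B" (is ?c)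
    "rhs12 exact k A B C = rhs12_part exact k A B C + blk (2 ^ k) 0 1 A * syl22 exact k A B C" (is ?d)
proof -
  let ?m = "2 ^ k :: nat"
  note m = mult_carrier_mat[of _ ?m ?m] and sc = syl_carrier[OF square_matmul_exact, of k A B C]
  show ?a ?b ?c ?d
    unfolding rhs11_def rhs22_def rhs12_def rhs12_part_def[of _ _ _ B] exact_simps fst_conv
    using mat_add_exact[OF blk_carrier m[OF blk_carrier sc(1)]]
      mat_sub_exact[OF blk_carrier m[OF sc(1) blk_carrier]] mat_sub_exact[OF blk_carrier m[OF sc(2) blk_carrier]]
      mat_add_exact[OF minus_carrier_mat[OF m[OF sc(2) blk_carrier]] m[OF blk_carrier sc(3)]]
    by simp_all
qed

lemma scalar_Sylvester:
  fixes a b c :: complex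
  assumes "a \<noteq> b" shows "a * (- c / (a - b)) - - c / (a - b) * b + c = 0"
proof -
  have "a * (- c / (a - b)) - - c / (a - b) * b = (a - b) * (- c / (a - b))"
    by (simp only: algebra_simps)
  then show ?thesis using assms by simp
qed

text \<open>The recursion only ever divides by differences of diagonal entries, so solvability of the scalar
equations carries over to the matrix equation.\<close>

lemma SylR_exact:
  "solvable (2 ^ k) A B \<Longrightarrow> C \<in> sq_mat (2 ^ k) \<Longrightarrow>
    residual A B C (fst (SylR exact k A B C)) = 0\<^sub>m (2 ^ k) (2 ^ k)"
proof (induction k arbitrary: A B C)
  case 0
  then have "A $$ (0, 0) \<noteq> B $$ (0, 0)" by (simp add: solvable_def)
  from scalar_Sylvester[OF this, of "C $$ (0, 0)"] show ?case using 0
    by (intro eq_matI) (auto simp: solvable_def residual_def scalar_prod_def)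
next
  case (Suc k)
  let ?m = "2 ^ k :: nat"
  have sv: "solvable (2 * ?m) A B" and C: "C \<in> sq_mat (2 * ?m)" using Suc.prems by auto
  note AB = solvable_carrier[OF sv]
  have u: "upper_triangular A" "upper_triangular B" using sv by (auto simp: solvable_def)
  define R where "R = fst (SylR exact (Suc k) A B C)"
  have Rc: "R \<in> sq_mat (2 * ?m)"
    unfolding R_def using SylR_carrier[OF square_matmul_exact, of A "Suc k" B C] AB C by simp
  note Rb = SylR_Suc_blk[OF square_matmul_exact AB C, folded R_def]
  have z: "residual (blk ?m 1 1 A) (blk ?m 0 0 B) (blk ?m 1 0 C) (syl21 exact k A B C) = 0\<^sub>m ?m ?m"
    "residual (blk ?m 0 0 A) (blk ?m 0 0 B) (rhs11 exact k A B C) (syl11 exact k A B C) = 0\<^sub>m ?m ?m"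
    "residual (blk ?m 1 1 A) (blk ?m 1 1 B) (rhs22 exact k A B C) (syl22 exact k A B C) = 0\<^sub>m ?m ?m"
    "residual (blk ?m 0 0 A) (blk ?m 1 1 B) (rhs12 exact k A B C) (syl12 exact k A B C) = 0\<^sub>m ?m ?m"
    unfolding syl21_def syl11_def syl22_def syl12_def
    by (intro Suc.IH solvable_blk[OF sv] rhs_carrier blk_carrier; simp)+
  note d = rhs_exact(1,2)[OF C, of A B] rhs_exact(4)[OF C, of A B, unfolded rhs_exact(3)[OF C]]
  have mm: "0\<^sub>m ?m ?m - (X - X) = (0\<^sub>m ?m ?m :: complex mat)" if "X \<in> sq_mat ?m" for X
    using that by auto
  have z0: "blk ?m p q (0\<^sub>m (2 * ?m) (2 * ?m)) = 0\<^sub>m ?m ?m" if "p \<le> 1" "q \<le> 1" for p q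
    using that by (intro eq_matI) (auto simp: blk_index blk_bound)
  note rb = residual_blk[OF AB(1) u(1) AB(2) u(2) C Rc, unfolded Rb]
  have "residual A B C R = 0\<^sub>m (2 * ?m) (2 * ?m)"
  proof (rule eq_blkI[of _ ?m])
    show "residual A B C R \<in> sq_mat (2 * ?m)"
      by (intro residual_carrier AB C Rc)
    show "blk ?m 0 0 (residual A B C R) = blk ?m 0 0 (0\<^sub>m (2 * ?m) (2 * ?m))"
      unfolding rb(2)[OF rhs_carrier(1)[of exact k A B C]] z z0[OF le0 le0] d(1)[symmetric] by (rule mm[OF rhs_carrier(1)])
    show "blk ?m 0 1 (residual A B C R) = blk ?m 0 1 (0\<^sub>m (2 * ?m) (2 * ?m))"
      unfolding rb(4)[OF rhs_carrier(4)[of exact k A B C]] z z0[OF le0 order.refl] d(3)[symmetric] by (rule mm[OF rhs_carrier(4)])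
    show "blk ?m 1 0 (residual A B C R) = blk ?m 1 0 (0\<^sub>m (2 * ?m) (2 * ?m))"
      unfolding rb(1)[OF rhs_carrier(1)] z z0[OF order.refl le0] ..
    show "blk ?m 1 1 (residual A B C R) = blk ?m 1 1 (0\<^sub>m (2 * ?m) (2 * ?m))"
      unfolding rb(3)[OF rhs_carrier(2)[of exact k A B C]] z z0[OF order.refl order.refl] d(2)[symmetric] by (rule mm[OF rhs_carrier(2)])
  qed simp
  then show ?case unfolding R_def by simp
qed

section \<open>Convergence as the machine epsilon tends to zero\<close>

definition mat_tendsto :: "nat \<Rightarrow> (real \<Rightarrow> complex mat) \<Rightarrow> complex mat \<Rightarrow> bool" where
  "mat_tendsto n X X0 \<longleftrightarrow> X0 \<in> sq_mat n \<and> (\<forall>\<^sub>F e in at_right 0. X e \<in> sq_mat n) \<and>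
     (\<forall>i<n. \<forall>j<n. ((\<lambda>e. X e $$ (i, j)) \<longlongrightarrow> X0 $$ (i, j)) (at_right 0))"

lemma mat_tendstoD:
  assumes "mat_tendsto n X X0"
  shows "X0 \<in> sq_mat n" "\<forall>\<^sub>F e in at_right 0. X e \<in> sq_mat n"
    "i < n \<Longrightarrow> j < n \<Longrightarrow> ((\<lambda>e. X e $$ (i, j)) \<longlongrightarrow> X0 $$ (i, j)) (at_right 0)"
  using assms by (auto simp: mat_tendsto_def)

lemma mat_tendsto_const: "X \<in> sq_mat n \<Longrightarrow> mat_tendsto n (\<lambda>e. X) X"
  by (auto simp: mat_tendsto_def)

lemma mat_tendstoI:
  assumes "X0 \<in> sq_mat n" "\<forall>\<^sub>F e in at_right 0. X e \<in> sq_mat n"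
    and "\<And>i j. i < n \<Longrightarrow> j < n \<Longrightarrow> \<forall>\<^sub>F e in at_right 0. X e $$ (i, j) = f i j e"
    and "\<And>i j. i < n \<Longrightarrow> j < n \<Longrightarrow> (f i j \<longlongrightarrow> X0 $$ (i, j)) (at_right 0)"
  shows "mat_tendsto n X X0"
  unfolding mat_tendsto_def using assms(1,2) tendsto_cong[OF assms(3)] assms(4) by blast

lemma mat_tendsto_cong:
  assumes "mat_tendsto n X X0" "\<forall>\<^sub>F e in at_right 0. X e = Y e"
  shows "mat_tendsto n Y X0"
proof (rule mat_tendstoI)
  show "\<forall>\<^sub>F e in at_right 0. Y e \<in> sq_mat n"
    using assms(2) mat_tendstoD(2)[OF assms(1)] by eventually_elim auto
  show "\<forall>\<^sub>F e in at_right 0. Y e $$ (i, j) = X e $$ (i, j)" for i j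
    using assms(2) by eventually_elim auto
qed (use assms(1) in \<open>auto simp: mat_tendsto_def\<close>)

lemma mat_tendsto_blk:
  assumes "mat_tendsto (2 * m) X X0" "p \<le> 1" "q \<le> 1"
  shows "mat_tendsto m (\<lambda>e. blk m p q (X e)) (blk m p q X0)"
  unfolding mat_tendsto_def using assms mat_tendstoD(3)[OF assms(1)] by (auto simp: blk_index blk_bound)

lemma mat_tendsto_four_block:
  assumes "mat_tendsto m A A0" "mat_tendsto m B B0" "mat_tendsto m C C0" "mat_tendsto m D D0"
  shows "mat_tendsto (2 * m) (\<lambda>e. four_block_mat (A e) (B e) (C e) (D e)) (four_block_mat A0 B0 C0 D0)"
proof (rule mat_tendstoI)
  note ev = assms[THEN mat_tendstoD(2)]
  show "\<forall>\<^sub>F e in at_right 0. four_block_mat (A e) (B e) (C e) (D e) \<in> sq_mat (2 * m)"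
    using ev(1,4) by eventually_elim (rule four_block_carrier_double)
  fix i j assume ij: "i < 2 * m" "j < 2 * m"
  let ?f = "\<lambda>i j A B C D. if i < m then if j < m then A $$ (i,j) else B $$ (i,j - m)
      else if j < m then C $$ (i - m, j) else (D $$ (i - m, j - m) :: complex)"
  show "\<forall>\<^sub>F e in at_right 0. four_block_mat (A e) (B e) (C e) (D e) $$ (i, j) = ?f i j (A e) (B e) (C e) (D e)"
    using ev(1,4) by eventually_elim (use ij in auto)
  have "four_block_mat A0 B0 C0 D0 $$ (i, j) = ?f i j A0 B0 C0 D0"
    using assms[THEN mat_tendstoD(1)] ij by auto
  then show "((\<lambda>e. ?f i j (A e) (B e) (C e) (D e)) \<longlongrightarrow> four_block_mat A0 B0 C0 D0 $$ (i, j)) (at_right 0)"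
    using ij assms[THEN mat_tendstoD(3)] by auto
qed (intro four_block_carrier_double assms[THEN mat_tendstoD(1)])

lemma mat_tendsto_add:
  assumes "mat_tendsto n X X0" "mat_tendsto n Y Y0"
  shows "mat_tendsto n (\<lambda>e. X e + Y e) (X0 + Y0)"
proof (rule mat_tendstoI[where f = "\<lambda>i j e. X e $$ (i, j) + Y e $$ (i, j)"])
  note ev = assms[THEN mat_tendstoD(2)]
  show "\<forall>\<^sub>F e in at_right 0. X e + Y e \<in> sq_mat n"
    using ev by eventually_elim auto
  fix i j assume ij: "i < n" "j < n"
  show "\<forall>\<^sub>F e in at_right 0. (X e + Y e) $$ (i, j) = X e $$ (i, j) + Y e $$ (i, j)"
    using ev by eventually_elim (use ij in auto)
  show "((\<lambda>e. X e $$ (i, j) + Y e $$ (i, j)) \<longlongrightarrow> (X0 + Y0) $$ (i, j)) (at_right 0)"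
    using tendsto_add[OF mat_tendstoD(3)[OF assms(1) ij] mat_tendstoD(3)[OF assms(2) ij]]
      assms[THEN mat_tendstoD(1)] ij by auto
qed (use assms[THEN mat_tendstoD(1)] in auto)

lemma mat_tendsto_minus:
  assumes "mat_tendsto n X X0" "mat_tendsto n Y Y0"
  shows "mat_tendsto n (\<lambda>e. X e - Y e) (X0 - Y0)"
proof (rule mat_tendstoI[where f = "\<lambda>i j e. X e $$ (i, j) - Y e $$ (i, j)"])
  note ev = assms[THEN mat_tendstoD(2)]
  show "\<forall>\<^sub>F e in at_right 0. X e - Y e \<in> sq_mat n"
    using ev by eventually_elim auto
  fix i j assume ij: "i < n" "j < n"
  show "\<forall>\<^sub>F e in at_right 0. (X e - Y e) $$ (i, j) = X e $$ (i, j) - Y e $$ (i, j)"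
    using ev by eventually_elim (use ij in auto)
  show "((\<lambda>e. X e $$ (i, j) - Y e $$ (i, j)) \<longlongrightarrow> (X0 - Y0) $$ (i, j)) (at_right 0)"
    using tendsto_diff[OF mat_tendstoD(3)[OF assms(1) ij] mat_tendstoD(3)[OF assms(2) ij]]
      assms[THEN mat_tendstoD(1)] ij by auto
qed (use assms[THEN mat_tendstoD(1)] in auto)

lemma mat_tendsto_mult:
  assumes "mat_tendsto n X X0" "mat_tendsto n Y Y0"
  shows "mat_tendsto n (\<lambda>e. X e * Y e) (X0 * Y0)"
proof (rule mat_tendstoI[where f = "\<lambda>i j e. \<Sum>l<n. X e $$ (i, l) * Y e $$ (l, j)"])
  note ev = assms[THEN mat_tendstoD(2)]
  show "\<forall>\<^sub>F e in at_right 0. X e * Y e \<in> sq_mat n"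
    using ev by eventually_elim auto
  fix i j assume ij: "i < n" "j < n"
  have ix: "(X * Y) $$ (i, j) = (\<Sum>l<n. X $$ (i, l) * Y $$ (l, j))"
    if "X \<in> sq_mat n" "Y \<in> sq_mat n" for X Y :: "complex mat"
    using that ij by (auto simp: scalar_prod_def lessThan_atLeast0)
  show "\<forall>\<^sub>F e in at_right 0. (X e * Y e) $$ (i, j) = (\<Sum>l<n. X e $$ (i, l) * Y e $$ (l, j))"
    using ev by eventually_elim (rule ix)
  show "((\<lambda>e. \<Sum>l<n. X e $$ (i, l) * Y e $$ (l, j)) \<longlongrightarrow> (X0 * Y0) $$ (i, j)) (at_right 0)"
    unfolding ix[OF assms[THEN mat_tendstoD(1)]]
    by (intro tendsto_sum tendsto_mult mat_tendstoD(3)[OF assms(1)] mat_tendstoD(3)[OF assms(2)] ij) auto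
qed (use assms[THEN mat_tendstoD(1)] in auto)

lemma mat_tendsto_fnorm:
  assumes "mat_tendsto n X X0"
  shows "((\<lambda>e. fnorm (X e)) \<longlongrightarrow> fnorm X0) (at_right 0)"
proof -
  have *: "fnorm Y = sqrt (\<Sum>i<n. \<Sum>j<n. (cmod (Y $$ (i, j)))\<^sup>2)" if "Y \<in> sq_mat n" for Y
    using that by (simp add: fnorm_def)
  have "((\<lambda>e. sqrt (\<Sum>i<n. \<Sum>j<n. (cmod (X e $$ (i, j)))\<^sup>2)) \<longlongrightarrow> fnorm X0) (at_right 0)"
    unfolding *[OF mat_tendstoD(1)[OF assms]]
    by (intro tendsto_intros mat_tendstoD(3)[OF assms]) auto
  moreover have "\<forall>\<^sub>F e in at_right 0. fnorm (X e) = sqrt (\<Sum>i<n. \<Sum>j<n. (cmod (X e $$ (i, j)))\<^sup>2)"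
    using mat_tendstoD(2)[OF assms] by eventually_elim (rule *)
  ultimately show ?thesis by (simp cong: tendsto_cong)
qed

lemma mat_tendsto_fnorm_less:
  assumes "mat_tendsto n X X0" "fnorm X0 < c"
  shows "\<forall>\<^sub>F e in at_right 0. fnorm (X e) < c"
  using order_tendstoD(2)[OF mat_tendsto_fnorm[OF assms(1)] assms(2)] .

lemma tendsto_0_comparison:
  fixes f :: "'a \<Rightarrow> complex"
  assumes "\<forall>\<^sub>F x in F. cmod (f x) \<le> g x" "(g \<longlongrightarrow> 0) F"
  shows "(f \<longlongrightarrow> 0) F"
  by (rule tendsto_norm_zero_cancel, rule tendsto_sandwich[OF _ assms(1) tendsto_const assms(2)]) auto

lemma mat_tendsto_perturb:
  assumes X: "mat_tendsto n X X0" and Y: "\<forall>\<^sub>F e in at_right 0. Y e \<in> sq_mat n"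
    and d: "\<forall>\<^sub>F e in at_right 0. fnorm (Y e - X e) \<le> e * c"
  shows "mat_tendsto n Y X0"
proof (rule mat_tendstoI[where f = "\<lambda>i j e. Y e $$ (i, j)"])
  fix i j assume ij: "i < n" "j < n"
  have "((\<lambda>e. Y e $$ (i, j) - X e $$ (i, j)) \<longlongrightarrow> 0) (at_right 0)"
  proof (rule tendsto_0_comparison)
    show "\<forall>\<^sub>F e in at_right 0. cmod (Y e $$ (i, j) - X e $$ (i, j)) \<le> e * c"
      using Y d mat_tendstoD(2)[OF X]
    proof eventually_elim
      case (elim e)
      then have "cmod ((Y e - X e) $$ (i, j)) \<le> fnorm (Y e - X e)"
        using ij by (intro cmod_le_fnorm) auto
      then show ?case using elim ij by simp
    qed
    show "((\<lambda>e::real. e * c) \<longlongrightarrow> 0) (at_right 0)" by (auto intro!: tendsto_eq_intros)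
  qed
  from tendsto_add[OF this mat_tendstoD(3)[OF X ij]]
  show "((\<lambda>e. Y e $$ (i, j)) \<longlongrightarrow> X0 $$ (i, j)) (at_right 0)" by simp
qed (use X Y in \<open>auto simp: mat_tendsto_def\<close>)

lemma eventually_eps_less: "0 < (c::real) \<Longrightarrow> \<forall>\<^sub>F e in at_right 0. 0 < e \<and> e < c"
  unfolding eventually_at_right_field by auto

lemma sqrt_le_self: "1 \<le> x \<Longrightarrow> sqrt x \<le> x"
  by (intro real_le_lsqrt) (auto intro: self_le_power)

section \<open>Rounding errors of the Sylvester recursion\<close>

text \<open>Stability of the multiplication in the form used below.  The second-order remainder is replaced by
\<open>e * \<tau>\<close> with an arbitrarily small \<open>\<tau> > 0\<close>, which is legitimate once \<open>e\<close> is small; the Frobenius norm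
costs a factor \<open>sqrt n\<close> here, but only once and not per level of the recursion.  A single constant
\<open>L\<close> dominates \<open>\<kappa>\<close>, the number 1 and the leading constant of the multiplication.\<close>

locale stable_fl =
  fixes fl :: "real \<Rightarrow> arith" and \<kappa> L :: real and d :: nat
  assumes fp: "\<And>e. 0 < e \<Longrightarrow> e < 1 \<Longrightarrow> fp_arith \<kappa> e (fl e)"
    and sq: "\<And>e. 0 < e \<Longrightarrow> e < 1 \<Longrightarrow> square_matmul (fl e)"
    and kappa: "0 \<le> \<kappa>" "\<kappa> \<le> L" and L1: "1 \<le> L"
    and mm: "\<And>n \<rho> \<tau>. 1 \<le> n \<Longrightarrow> 0 < \<tau> \<Longrightarrow> \<forall>\<^sub>F e in at_right 0. \<forall>A \<in> carrier_mat n n. \<forall>B \<in> carrier_mat n n.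
      fnorm A \<le> \<rho> \<longrightarrow> fnorm B \<le> \<rho> \<longrightarrow>
      fnorm (fst (matmul (fl e) A B) - A * B) \<le> e * (L * real n ^ d * fnorm A * fnorm B + \<tau>)"
begin

lemma ev_fp: "\<forall>\<^sub>F e in at_right 0. fp_arith \<kappa> e (fl e)"
  and ev_sq: "\<forall>\<^sub>F e in at_right 0. square_matmul (fl e)"
  using eventually_eps_less[of 1, simplified] by (auto elim!: eventually_mono intro: fp sq)

lemma matmul_first_order:
  assumes X: "mat_tendsto n X X0" and Y: "mat_tendsto n Y Y0" and n: "1 \<le> n"
    and x: "fnorm X0 < x" and y: "fnorm Y0 < y" and t: "0 < \<tau>"
  shows "\<forall>\<^sub>F e in at_right 0. fnorm (fst (matmul (fl e) (X e) (Y e)) - X e * Y e) \<le> e * (L * real n ^ d * x * y + \<tau>)"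
  using mm[OF n t, of "max x y"] mat_tendstoD(2)[OF X] mat_tendstoD(2)[OF Y]
    mat_tendsto_fnorm_less[OF X x] mat_tendsto_fnorm_less[OF Y y] eventually_eps_less[of 1, simplified]
proof eventually_elim
  case (elim e)
  then have "fnorm (fst (matmul (fl e) (X e) (Y e)) - X e * Y e)
    \<le> e * (L * real n ^ d * fnorm (X e) * fnorm (Y e) + \<tau>)" by auto
  also have "\<dots> \<le> e * (L * real n ^ d * x * y + \<tau>)"
    using elim L1 order_trans[OF fnorm_nonneg less_imp_le, of "X e" x] by (intro mult_left_mono add_right_mono mult_mono) auto
  finally show ?case .
qed

lemma matmul_tendsto:
  assumes X: "mat_tendsto n X X0" and Y: "mat_tendsto n Y Y0" and n: "1 \<le> n"
  shows "mat_tendsto n (\<lambda>e. fst (matmul (fl e) (X e) (Y e))) (X0 * Y0)"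
proof (rule mat_tendsto_perturb[OF mat_tendsto_mult[OF X Y]])
  show "\<forall>\<^sub>F e in at_right 0. fst (matmul (fl e) (X e) (Y e)) \<in> sq_mat n"
    using ev_sq mat_tendstoD(2)[OF X] mat_tendstoD(2)[OF Y] by eventually_elim (rule matmul_carrier)
qed (rule matmul_first_order[OF X Y n]; (rule less_add_one zero_less_one))

lemma mat_add_first_order:
  assumes X: "mat_tendsto n X X0" and Y: "mat_tendsto n Y Y0" and z: "fnorm (X0 + Y0) < z"
  shows "\<forall>\<^sub>F e in at_right 0. fnorm (fst (mat_add (fl e) (X e) (Y e)) - (X e + Y e)) \<le> e * (\<kappa> * z)"
  using ev_fp mat_tendstoD(2)[OF X] mat_tendstoD(2)[OF Y] eventually_eps_less[of 1, simplified]
    mat_tendsto_fnorm_less[OF mat_tendsto_add[OF X Y] z]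
proof eventually_elim
  case (elim e)
  then have "fnorm (fst (mat_add (fl e) (X e) (Y e)) - (X e + Y e)) \<le> (\<kappa> * e) * fnorm (X e + Y e)"
    using kappa by (intro fnorm_le_entrywise[of _ n n]) (auto simp: mat_add_def fp_arith_def)
  also have "\<dots> \<le> (\<kappa> * e) * z" using elim kappa by (intro mult_left_mono) auto
  finally show ?case by (simp add: mult_ac)
qed

lemma mat_sub_first_order:
  assumes X: "mat_tendsto n X X0" and Y: "mat_tendsto n Y Y0" and z: "fnorm (X0 - Y0) < z"
  shows "\<forall>\<^sub>F e in at_right 0. fnorm (fst (mat_sub (fl e) (X e) (Y e)) - (X e - Y e)) \<le> e * (\<kappa> * z)"
  using ev_fp mat_tendstoD(2)[OF X] mat_tendstoD(2)[OF Y] eventually_eps_less[of 1, simplified]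
    mat_tendsto_fnorm_less[OF mat_tendsto_minus[OF X Y] z]
proof eventually_elim
  case (elim e)
  then have "fnorm (fst (mat_sub (fl e) (X e) (Y e)) - (X e - Y e)) \<le> (\<kappa> * e) * fnorm (X e - Y e)"
    using kappa by (intro fnorm_le_entrywise[of _ n n]) (auto simp: mat_sub_def fp_arith_def)
  also have "\<dots> \<le> (\<kappa> * e) * z" using elim kappa by (intro mult_left_mono) auto
  finally show ?case by (simp add: mult_ac)
qed

lemma mat_add_tendsto:
  assumes X: "mat_tendsto n X X0" and Y: "mat_tendsto n Y Y0"
  shows "mat_tendsto n (\<lambda>e. fst (mat_add (fl e) (X e) (Y e))) (X0 + Y0)"
proof (rule mat_tendsto_perturb[OF mat_tendsto_add[OF X Y]])
  show "\<forall>\<^sub>F e in at_right 0. fst (mat_add (fl e) (X e) (Y e)) \<in> sq_mat n"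
    using mat_tendstoD(2)[OF X] by eventually_elim (rule mat_add_carrier)
qed (rule mat_add_first_order[OF X Y less_add_one])

lemma mat_sub_tendsto:
  assumes X: "mat_tendsto n X X0" and Y: "mat_tendsto n Y Y0"
  shows "mat_tendsto n (\<lambda>e. fst (mat_sub (fl e) (X e) (Y e))) (X0 - Y0)"
proof (rule mat_tendsto_perturb[OF mat_tendsto_minus[OF X Y]])
  show "\<forall>\<^sub>F e in at_right 0. fst (mat_sub (fl e) (X e) (Y e)) \<in> sq_mat n"
    using mat_tendstoD(2)[OF X] by eventually_elim (rule mat_sub_carrier)
qed (rule mat_sub_first_order[OF X Y less_add_one])

text \<open>The rounded difference \<open>s\<close> satisfies \<open>\<bar>s\<bar> \<ge> \<bar>a - b\<bar> / 2\<close>, so replacing \<open>a - b\<close> by \<open>s\<close> and rounding the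
quotient each cost a relative error of at most \<open>2 * \<kappa> * e\<close>.\<close>

lemma scalar_first_order:
  assumes fpa: "fp_arith \<kappa> e ar" and e: "0 < e" "\<kappa> * e \<le> 1 / 2" and ab: "a \<noteq> b"
  shows "cmod (quot ar (- c) (sub ar a b) - - c / (a - b)) \<le> 4 * (\<kappa> * e) * cmod (c / (a - b))"
proof -
  let ?u = "\<kappa> * e"
  define s where "s = sub ar a b"
  have u: "0 \<le> ?u" using kappa e by simp
  have s: "cmod (s - (a - b)) \<le> ?u * cmod (a - b)" using fpa by (auto simp: fp_arith_def s_def)
  have n: "cmod (a - b) \<le> cmod s + cmod (s - (a - b))"
    using norm_triangle_ineq4[of s "s - (a - b)"] by simp
  have "?u * cmod (a - b) \<le> 1 / 2 * cmod (a - b)" using e by (intro mult_right_mono) auto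
  then have half: "cmod (a - b) \<le> 2 * cmod s" using s n by simp
  then have s0: "s \<noteq> 0" using ab by auto
  have "cmod (quot ar (- c) s - - c / s) \<le> ?u * cmod (- c / s)"
    using fpa s0 unfolding fp_arith_def by blast
  also have "\<dots> = ?u * (cmod c / cmod s)" by (simp add: norm_divide)
  also have "\<dots> \<le> ?u * (2 * (cmod c / cmod (a - b)))"
    using half s0 ab u by (intro mult_left_mono) (auto simp: field_simps intro: mult_left_mono)
  finally have 1: "cmod (quot ar (- c) s - - c / s) \<le> 2 * ?u * cmod (c / (a - b))"
    by (simp add: norm_divide mult_ac)
  have "- c / s - - c / (a - b) = (c / (a - b)) * ((s - (a - b)) / s)"
    using s0 ab by (simp add: field_simps)
  then have split: "cmod (- c / s - - c / (a - b)) = cmod (c / (a - b)) * (cmod (s - (a - b)) / cmod s)"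
    by (simp only: norm_mult norm_divide)
  have "cmod (s - (a - b)) / cmod s \<le> ?u * (2 * cmod s) / cmod s"
    using s half u by (intro divide_right_mono order_trans[OF s] mult_left_mono) auto
  also have "\<dots> = 2 * ?u" using s0 by simp
  finally have "cmod (c / (a - b)) * (cmod (s - (a - b)) / cmod s) \<le> cmod (c / (a - b)) * (2 * ?u)"
    by (intro mult_left_mono) auto
  then have 2: "cmod (- c / s - - c / (a - b)) \<le> 2 * ?u * cmod (c / (a - b))"
    unfolding split by (simp add: mult_ac)
  have "cmod (quot ar (- c) s - - c / (a - b)) \<le> cmod (quot ar (- c) s - - c / s) + cmod (- c / s - - c / (a - b))"
    by (rule norm_diff_triangle_le[OF order.refl order.refl])
  then show ?thesis using 1 2 unfolding s_def[symmetric] by simp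
qed

lemma ev_kappa_half: "\<forall>\<^sub>F e in at_right 0. 0 < e \<and> e < 1 \<and> \<kappa> * e \<le> 1 / 2"
proof -
  have "0 < 1 / (2 * L)" using L1 by simp
  from eventually_eps_less[OF this] eventually_eps_less[of 1, simplified] show ?thesis
  proof eventually_elim
    case (elim e)
    have "\<kappa> * e \<le> L * e" using elim kappa by (intro mult_right_mono) auto
    also have "\<dots> \<le> 1 / 2" using elim L1 by (simp add: field_simps)
    finally show ?case using elim by simp
  qed
qed

text \<open>The induction step of the next lemma, kept separate because the convergence of the intermediate
results is needed again for the residual bound.\<close>

lemma SylR_stages_tendsto:
  assumes IH0: "\<And>A B C C0. solvable (2 ^ k) A B \<Longrightarrow> mat_tendsto (2 ^ k) C C0 \<Longrightarrow>
      mat_tendsto (2 ^ k) (\<lambda>e. fst (SylR (fl e) k A B (C e))) (fst (SylR exact k A B C0))"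
    and sv: "solvable (2 * 2 ^ k) A B" and C: "mat_tendsto (2 * 2 ^ k) C C0"
  shows "mat_tendsto (2 ^ k) (\<lambda>e. syl21 (fl e) k A B (C e)) (syl21 exact k A B C0)" (is ?t21)
    "mat_tendsto (2 ^ k) (\<lambda>e. rhs11 (fl e) k A B (C e)) (rhs11 exact k A B C0)" (is ?d11)
    "mat_tendsto (2 ^ k) (\<lambda>e. syl11 (fl e) k A B (C e)) (syl11 exact k A B C0)" (is ?t11)
    "mat_tendsto (2 ^ k) (\<lambda>e. rhs22 (fl e) k A B (C e)) (rhs22 exact k A B C0)" (is ?d22)
    "mat_tendsto (2 ^ k) (\<lambda>e. syl22 (fl e) k A B (C e)) (syl22 exact k A B C0)" (is ?t22)
    "mat_tendsto (2 ^ k) (\<lambda>e. rhs12_part (fl e) k A B (C e)) (rhs12_part exact k A B C0)" (is ?e12)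
    "mat_tendsto (2 ^ k) (\<lambda>e. rhs12 (fl e) k A B (C e)) (rhs12 exact k A B C0)" (is ?d12)
    "mat_tendsto (2 ^ k) (\<lambda>e. syl12 (fl e) k A B (C e)) (syl12 exact k A B C0)" (is ?t12)
proof -
  let ?m = "2 ^ k :: nat"
  note sc = syl_carrier[OF square_matmul_exact, of k A B C0]
  note IH = IH0[OF solvable_blk[OF sv]]
  note bt = mat_tendsto_blk[OF C] mat_tendsto_const[OF blk_carrier]
  have m1: "1 \<le> ?m" by simp
  note mt = matmul_tendsto[OF _ _ m1]
  note ms = mult_carrier_mat[of _ ?m ?m]
  have t21: "mat_tendsto ?m (\<lambda>e. syl21 (fl e) k A B (C e)) (syl21 exact k A B C0)"
    unfolding syl21_def by (intro IH bt; simp)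
  have "mat_tendsto ?m (\<lambda>e. rhs11 (fl e) k A B (C e)) (blk ?m 0 0 C0 + blk ?m 0 1 A * syl21 exact k A B C0)"
    unfolding rhs11_def by (intro mat_add_tendsto mt bt t21; simp)
  then have d11: "mat_tendsto ?m (\<lambda>e. rhs11 (fl e) k A B (C e)) (rhs11 exact k A B C0)"
    unfolding rhs11_def[of exact] by (simp add: mat_add_exact[OF blk_carrier ms[OF blk_carrier sc(1)]])
  have t11: "mat_tendsto ?m (\<lambda>e. syl11 (fl e) k A B (C e)) (syl11 exact k A B C0)"
    unfolding syl11_def by (intro IH d11; simp)
  have "mat_tendsto ?m (\<lambda>e. rhs22 (fl e) k A B (C e)) (blk ?m 1 1 C0 - syl21 exact k A B C0 * blk ?m 0 1 B)"
    unfolding rhs22_def by (intro mat_sub_tendsto mt bt t21; simp)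
  then have d22: "mat_tendsto ?m (\<lambda>e. rhs22 (fl e) k A B (C e)) (rhs22 exact k A B C0)"
    unfolding rhs22_def[of exact] by (simp add: mat_sub_exact[OF blk_carrier ms[OF sc(1) blk_carrier]])
  have t22: "mat_tendsto ?m (\<lambda>e. syl22 (fl e) k A B (C e)) (syl22 exact k A B C0)"
    unfolding syl22_def by (intro IH d22; simp)
  have "mat_tendsto ?m (\<lambda>e. rhs12_part (fl e) k A B (C e)) (blk ?m 0 1 C0 - syl11 exact k A B C0 * blk ?m 0 1 B)"
    unfolding rhs12_part_def by (intro mat_sub_tendsto mt bt t11; simp)
  then have e12: "mat_tendsto ?m (\<lambda>e. rhs12_part (fl e) k A B (C e)) (rhs12_part exact k A B C0)"
    unfolding rhs12_part_def[of exact] by (simp add: mat_sub_exact[OF blk_carrier ms[OF sc(2) blk_carrier]])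
  have "mat_tendsto ?m (\<lambda>e. rhs12 (fl e) k A B (C e)) (rhs12_part exact k A B C0 + blk ?m 0 1 A * syl22 exact k A B C0)"
    unfolding rhs12_def by (intro mat_add_tendsto mt bt t22 e12; simp)
  then have d12: "mat_tendsto ?m (\<lambda>e. rhs12 (fl e) k A B (C e)) (rhs12 exact k A B C0)"
    unfolding rhs12_def[of exact] by (simp add: mat_add_exact[OF rhs_carrier(3) ms[OF blk_carrier sc(3)]])
  have t12: "mat_tendsto ?m (\<lambda>e. syl12 (fl e) k A B (C e)) (syl12 exact k A B C0)"
    unfolding syl12_def by (intro IH d12; simp)
  show ?t21 ?d11 ?t11 ?d22 ?t22 ?e12 ?d12 ?t12
    by (fact t21 d11 t11 d22 t22 e12 d12 t12)+
qed

text \<open>This is purely qualitative: it says nothing about rates, but it turns bounds on the exact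
intermediate results into bounds on the computed ones, valid for small \<open>\<epsilon>\<close>.\<close>

lemma SylR_tendsto:
  "solvable (2 ^ k) A B \<Longrightarrow> mat_tendsto (2 ^ k) C C0 \<Longrightarrow>
    mat_tendsto (2 ^ k) (\<lambda>e. fst (SylR (fl e) k A B (C e))) (fst (SylR exact k A B C0))"
proof (induction k arbitrary: A B C C0)
  case 0
  let ?a = "A $$ (0, 0)" and ?b = "B $$ (0, 0)"
  let ?q = "\<lambda>e. quot (fl e) (- (C e $$ (0, 0))) (sub (fl e) ?a ?b)"
  have ab: "?a \<noteq> ?b" using 0 by (simp add: solvable_def)
  have C: "((\<lambda>e. C e $$ (0, 0)) \<longlongrightarrow> C0 $$ (0, 0)) (at_right 0)"
    using 0 by (intro mat_tendstoD(3)[where n = 1]) auto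
  have "((\<lambda>e. ?q e - - (C e $$ (0, 0)) / (?a - ?b)) \<longlongrightarrow> 0) (at_right 0)"
  proof (rule tendsto_0_comparison)
    show "\<forall>\<^sub>F e in at_right 0. cmod (?q e - - (C e $$ (0, 0)) / (?a - ?b)) \<le> 4 * (\<kappa> * e) * cmod (C e $$ (0, 0) / (?a - ?b))"
      using ev_kappa_half ev_fp by eventually_elim (rule scalar_first_order; use ab in simp)
    show "((\<lambda>e. 4 * (\<kappa> * e) * cmod (C e $$ (0, 0) / (?a - ?b))) \<longlongrightarrow> 0) (at_right 0)"
      using ab by (auto intro!: tendsto_eq_intros C)
  qed
  from tendsto_add[OF this tendsto_divide[OF tendsto_minus[OF C] tendsto_const[of "?a - ?b"]]] ab
  have "(?q \<longlongrightarrow> - (C0 $$ (0, 0)) / (?a - ?b)) (at_right 0)" by simp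
  then show ?case by (simp add: mat_tendsto_def)
next
  case (Suc k)
  let ?m = "2 ^ k :: nat"
  have sv: "solvable (2 * ?m) A B" and C: "mat_tendsto (2 * ?m) C C0" using Suc.prems by auto
  note AB = solvable_carrier[OF sv]
  note t = SylR_stages_tendsto[OF Suc.IH sv C]
  have "mat_tendsto (2 * ?m) (\<lambda>e. fst (SylR (fl e) (Suc k) A B (C e))) (fst (SylR exact (Suc k) A B C0))"
  proof (rule mat_tendsto_cong)
    show "mat_tendsto (2 * ?m) (\<lambda>e. four_block_mat (syl11 (fl e) k A B (C e)) (syl12 (fl e) k A B (C e))
       (syl21 (fl e) k A B (C e)) (syl22 (fl e) k A B (C e))) (fst (SylR exact (Suc k) A B C0))"
      unfolding SylR_Suc_fst[OF AB mat_tendstoD(1)[OF C]] by (intro mat_tendsto_four_block t)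
    show "\<forall>\<^sub>F e in at_right 0. four_block_mat (syl11 (fl e) k A B (C e)) (syl12 (fl e) k A B (C e))
       (syl21 (fl e) k A B (C e)) (syl22 (fl e) k A B (C e)) = fst (SylR (fl e) (Suc k) A B (C e))"
      using mat_tendstoD(2)[OF C] by eventually_elim (simp only: SylR_Suc_fst[OF AB])
  qed
  then show ?case by simp
qed

lemma mat_diff_split:
  fixes S Z P Q :: "complex mat"
  assumes "S \<in> sq_mat n" "Q \<in> sq_mat n" "Z \<in> sq_mat n" "P \<in> sq_mat n"
  shows "S - (Z + Q) = (S - (Z + P)) + (P - Q)" "S - (Z - Q) = (S - (Z - P)) + - (P - Q)"
  using assms by (auto intro!: eq_matI)

lemma matmul_add_first_order:
  assumes Z: "mat_tendsto n Z Z0" and X: "mat_tendsto n X X0" and Y: "mat_tendsto n Y Y0" and n: "1 \<le> n"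
    and b: "fnorm X0 < x" "fnorm Y0 < y" "fnorm (Z0 + X0 * Y0) < z" "0 < \<tau>"
  shows "\<forall>\<^sub>F e in at_right 0. fnorm (fst (mat_add (fl e) (Z e) (fst (matmul (fl e) (X e) (Y e)))) - (Z e + X e * Y e))
    \<le> e * (\<kappa> * z + (L * real n ^ d * x * y + \<tau>))"
  using mat_add_first_order[OF Z matmul_tendsto[OF X Y n] b(3)] matmul_first_order[OF X Y n b(1,2,4)]
    mat_tendstoD(2)[OF Z] mat_tendstoD(2)[OF X] mat_tendstoD(2)[OF Y] mat_tendstoD(2)[OF matmul_tendsto[OF X Y n]]
proof eventually_elim
  case (elim e)
  let ?P = "fst (matmul (fl e) (X e) (Y e))" and ?S = "fst (mat_add (fl e) (Z e) (fst (matmul (fl e) (X e) (Y e))))"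
  have c: "?S \<in> sq_mat n" "X e * Y e \<in> sq_mat n" using elim by (auto intro: mat_add_carrier)
  have eq: "?S - (Z e + X e * Y e) = (?S - (Z e + ?P)) + (?P - X e * Y e)"
    using c elim(3,6) by (intro mat_diff_split)
  have "fnorm (?S - (Z e + X e * Y e)) \<le> fnorm (?S - (Z e + ?P)) + fnorm (?P - X e * Y e)"
    unfolding eq
    using c elim by (intro fnorm_triangle[of _ n n]) auto
  then show ?case unfolding distrib_left[of e "\<kappa> * z"] fnorm_uminus
    by (rule order_trans[OF _ add_mono[OF elim(1,2)]])
qed

lemma matmul_sub_first_order:
  assumes Z: "mat_tendsto n Z Z0" and X: "mat_tendsto n X X0" and Y: "mat_tendsto n Y Y0" and n: "1 \<le> n"
    and b: "fnorm X0 < x" "fnorm Y0 < y" "fnorm (Z0 - X0 * Y0) < z" "0 < \<tau>"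
  shows "\<forall>\<^sub>F e in at_right 0. fnorm (fst (mat_sub (fl e) (Z e) (fst (matmul (fl e) (X e) (Y e)))) - (Z e - X e * Y e))
    \<le> e * (\<kappa> * z + (L * real n ^ d * x * y + \<tau>))"
  using mat_sub_first_order[OF Z matmul_tendsto[OF X Y n] b(3)] matmul_first_order[OF X Y n b(1,2,4)]
    mat_tendstoD(2)[OF Z] mat_tendstoD(2)[OF X] mat_tendstoD(2)[OF Y] mat_tendstoD(2)[OF matmul_tendsto[OF X Y n]]
proof eventually_elim
  case (elim e)
  let ?P = "fst (matmul (fl e) (X e) (Y e))" and ?S = "fst (mat_sub (fl e) (Z e) (fst (matmul (fl e) (X e) (Y e))))"
  have c: "?S \<in> sq_mat n" "X e * Y e \<in> sq_mat n" using elim by (auto intro: mat_sub_carrier)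
  have eq: "?S - (Z e - X e * Y e) = (?S - (Z e - ?P)) + - (?P - X e * Y e)"
    using c elim(3,6) by (intro mat_diff_split)
  have "fnorm (?S - (Z e - X e * Y e)) \<le> fnorm (?S - (Z e - ?P)) + fnorm (- (?P - X e * Y e))"
    unfolding eq
    using c elim by (intro fnorm_triangle[of _ n n]) auto
  then show ?case unfolding distrib_left[of e "\<kappa> * z"] fnorm_uminus
    by (rule order_trans[OF _ add_mono[OF elim(1,2)]])
qed

end

lemma fnorm_minus_leI:
  assumes "A \<in> sq_mat n" "B \<in> sq_mat n" "fnorm A \<le> a" "fnorm B \<le> b"
  shows "fnorm (A - B) \<le> a + b"
  using fnorm_minus_le[OF assms(1,2)] assms(3,4) by simp

text \<open>Since \<open>D = R B - A R\<close>, a right-hand side is never larger than its solution permits.  Applied to the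
exact intermediate results this controls them by the norm of the final solution alone.\<close>

lemma fnorm_rhs_le:
  assumes c: "A \<in> sq_mat n" "B \<in> sq_mat n" "D \<in> sq_mat n" "R \<in> sq_mat n" and n: "0 < n"
    and z: "residual A B D R = 0\<^sub>m n n" and M: "mnorm A \<le> M" "mnorm B \<le> M"
  shows "fnorm D \<le> 2 * M * fnorm R"
proof -
  have p: "A * R \<in> sq_mat n" "R * B \<in> sq_mat n" using c by auto
  have "D = R * B - A * R" by (rule residual_zeroD(2)[OF p c(3) z[unfolded residual_def]])
  also have "fnorm \<dots> \<le> fnorm (R * B) + fnorm (A * R)" by (rule fnorm_minus_le[OF p(2,1)])
  also have "\<dots> \<le> fnorm R * mnorm B + mnorm A * fnorm R"
    by (intro add_mono fnorm_mult_le_right[OF c(4,2) n] fnorm_mult_le[OF c(1) n c(4)])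
  also have "\<dots> \<le> fnorm R * M + M * fnorm R"
    using M by (intro add_mono mult_left_mono mult_right_mono) auto
  finally show ?thesis by simp
qed

lemma minus_add_split:
  fixes D P X Y :: "complex mat"
  assumes "X \<in> sq_mat n" "Y \<in> sq_mat n" "P \<in> sq_mat n" "D \<in> sq_mat n"
  shows "D - (X + Y) = (D - (P + Y)) + (P - X)"
  using assms by (auto intro!: eq_matI)

context stable_fl begin

text \<open>The recursion is backward stable in the sense of residuals.  By the block decomposition of the
residual, one level contributes four residuals of half the size and the rounding errors of four
products and four additions or subtractions.  Each of the latter is bounded by a polynomial
times \<open>e * M * r\<close>, because the norms of all intermediate matrices are controlled by the bounds \<open>M\<close> on the
coefficients and \<open>r\<close> on the solution.  The recurrence for the constant, four times the previous
one plus a polynomial in the dimension, has a polynomially bounded solution; the separation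
enters only afterwards, when the residual is converted into an error.\<close>

lemma SylR_residual:
  assumes M: "0 < M"
  shows "solvable (2 ^ k) A B \<Longrightarrow> mat_tendsto (2 ^ k) C C0 \<Longrightarrow> mnorm A \<le> M \<Longrightarrow> mnorm B \<le> M \<Longrightarrow>
    fnorm (fst (SylR exact k A B C0)) < r \<Longrightarrow>
    \<forall>\<^sub>F e in at_right 0. fnorm (residual A B (C e) (fst (SylR (fl e) k A B (C e))))
      \<le> e * (8 * L * (2 ^ (d + 3)) ^ k * M * r)"
proof (induction k arbitrary: A B C C0)
  case 0
  let ?a = "A $$ (0, 0)" and ?b = "B $$ (0, 0)" and ?R0 = "fst (SylR exact 0 A B C0)"
  note sv = 0(1) and C = 0(2)
  have ab: "?a \<noteq> ?b" using sv by (simp add: solvable_def)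
  have "fnorm C0 \<le> 2 * M * fnorm ?R0"
    using solvable_carrier[OF sv] mat_tendstoD(1)[OF C] SylR_exact[OF sv mat_tendstoD(1)[OF C]] 0(3,4)
    by (intro fnorm_rhs_le[of A 1 B]) auto
  also have "\<dots> < 2 * M * r" using 0(5) M by simp
  finally have "fnorm C0 < 2 * M * r" .
  from mat_tendsto_fnorm_less[OF C this] mat_tendstoD(2)[OF C] ev_kappa_half ev_fp
  show ?case
  proof eventually_elim
    case (elim e)
    let ?c = "C e $$ (0, 0)"
    let ?q = "quot (fl e) (- ?c) (sub (fl e) ?a ?b)"
    have c: "cmod ?c \<le> 2 * M * r"
      using elim(1,2) cmod_le_fnorm[of 0 "C e" 0] by auto
    have "fnorm (residual A B (C e) (fst (SylR (fl e) 0 A B (C e)))) = cmod (?a * ?q - ?q * ?b + ?c)"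
      using solvable_carrier[OF sv] elim by (auto simp: residual_def fnorm_def scalar_prod_def)
    also have "?a * ?q - ?q * ?b + ?c = (?a - ?b) * (?q - - ?c / (?a - ?b))"
    proof -
      have "(?a - ?b) * (?c / (?a - ?b)) = ?c" using ab by simp
      moreover have "(?a - ?b) * (?q - - ?c / (?a - ?b)) = (?a - ?b) * ?q + (?a - ?b) * (?c / (?a - ?b))"
        by (simp add: algebra_simps)
      ultimately have "(?a - ?b) * (?q - - ?c / (?a - ?b)) = (?a - ?b) * ?q + ?c" by simp
      then show ?thesis by (simp only: left_diff_distrib mult.commute[of ?b])
    qed
    also have "cmod \<dots> \<le> cmod (?a - ?b) * (4 * (\<kappa> * e) * cmod (?c / (?a - ?b)))"
      unfolding norm_mult using elim by (intro mult_left_mono scalar_first_order ab) auto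
    also have "\<dots> = 4 * (\<kappa> * e) * cmod ?c" using ab by (simp add: norm_divide)
    also have "\<dots> \<le> 4 * (L * e) * (2 * M * r)"
      using c elim kappa L1 by (intro mult_mono mult_left_mono mult_right_mono mult_nonneg_nonneg) auto
    finally show ?case by (simp add: mult_ac)
  qed
next
  case (Suc k)
  let ?m = "2 ^ k :: nat" and ?G = "(2 ^ (d + 3)) ^ k :: real"
  have sv: "solvable (2 * ?m) A B" and C: "mat_tendsto (2 * ?m) C C0" using Suc.prems by auto
  note AB = solvable_carrier[OF sv]
  have u: "upper_triangular A" "upper_triangular B" using sv by (auto simp: solvable_def)
  note sc = syl_carrier[OF square_matmul_exact, of k A B C0]
  note svb = solvable_blk[OF sv]
  note blkt = mat_tendsto_blk[OF C] mat_tendsto_const[OF blk_carrier]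
  have m1: "1 \<le> ?m" and m0: "0 < ?m" by simp_all
  define R where "R = (\<lambda>e. fst (SylR (fl e) (Suc k) A B (C e)))"
  define R0 where "R0 = fst (SylR exact (Suc k) A B C0)"
  have Rt: "mat_tendsto (2 * ?m) R R0"
    using SylR_tendsto[OF Suc.prems(1,2)] by (simp add: R_def R0_def)
  have Rr: "fnorm R0 < r" using Suc.prems(5) by (simp add: R0_def)
  have r: "0 < r" using Rr le_less_trans[OF fnorm_nonneg] by blast
  note R0b = SylR_Suc_blk[OF square_matmul_exact AB mat_tendstoD(1)[OF C], folded R0_def]
  have sr: "fnorm (syl21 exact k A B C0) \<le> fnorm R0" "fnorm (syl11 exact k A B C0) \<le> fnorm R0"
     "fnorm (syl22 exact k A B C0) \<le> fnorm R0" "fnorm (syl12 exact k A B C0) \<le> fnorm R0"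
    unfolding R0b[symmetric] by (rule fnorm_blk_le[OF mat_tendstoD(1)[OF Rt]]; simp)+
  note srl = sr[THEN le_less_trans, OF Rr]
  have Mb: "mnorm (blk ?m p q A) \<le> M" "mnorm (blk ?m p q B) \<le> M" if "p \<le> 1" "q \<le> 1" for p q
    using mnorm_blk_le[OF AB(1) m0 that] mnorm_blk_le[OF AB(2) m0 that] Suc.prems(3,4) by auto
  have Fb: "fnorm X < 2 * real ?m * M" if "X \<in> sq_mat ?m" "mnorm X \<le> M" for X
  proof -
    have "fnorm X \<le> sqrt ?m * mnorm X" using fnorm_le_sqrt_mnorm[OF that(1) m0] by simp
    also have "\<dots> \<le> real ?m * M"
      using that(2) mnorm_nonneg[OF that(1) m0] sqrt_le_self[of "real ?m"] M by (intro mult_mono) simp_all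
    also have "\<dots> < 2 * real ?m * M" using M by simp
    finally show ?thesis .
  qed
  note A12 = Fb[OF blk_carrier Mb(1)[of 0 1]] and B12 = Fb[OF blk_carrier Mb(2)[of 0 1]]
  note t = SylR_stages_tendsto[OF SylR_tendsto sv C]
  note z = SylR_exact[OF svb]
  note rd = rhs_exact[OF mat_tendstoD(1)[OF C], of A B]
  let ?b = "2 * M * r"
  have strict: "2 * M * fnorm R0 < ?b" "3 * M * fnorm R0 < 3 * M * r" using Rr M by auto
  have zb: "fnorm D \<le> 2 * M * fnorm R0"
    if "D \<in> sq_mat ?m" "p \<le> 1" "q \<le> 1" "fnorm (fst (SylR exact k (blk ?m p p A) (blk ?m q q B) D)) \<le> fnorm R0"
    for p q D
  proof -
    have "fnorm D \<le> 2 * M * fnorm (fst (SylR exact k (blk ?m p p A) (blk ?m q q B) D))"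
      by (rule fnorm_rhs_le[OF blk_carrier blk_carrier that(1) SylR_carrier[OF square_matmul_exact blk_carrier blk_carrier that(1)]
        m0 z[OF that(2,3,1)] Mb(1)[OF that(2,2)] Mb(2)[OF that(3,3)]])
    also have "\<dots> \<le> 2 * M * fnorm R0" using that(4) M by simp
    finally show ?thesis .
  qed
  have z11: "fnorm (rhs11 exact k A B C0) < ?b" and z22: "fnorm (rhs22 exact k A B C0) < ?b"
    using zb[OF rhs_carrier(1) le0 le0 sr(2)[unfolded syl11_def]]
      zb[OF rhs_carrier(2) order.refl order.refl sr(3)[unfolded syl22_def]] strict by simp_all
  have z12: "fnorm (rhs12 exact k A B C0) \<le> 2 * M * fnorm R0"
    by (rule zb[OF rhs_carrier(4) le0 order.refl sr(4)[unfolded syl12_def]])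
  have z12': "fnorm (rhs12_part exact k A B C0) < 3 * M * r"
  proof -
    let ?P = "blk ?m 0 1 A * syl22 exact k A B C0"
    have P: "?P \<in> sq_mat ?m" by (intro mult_carrier_mat[of _ ?m ?m] blk_carrier sc)
    have eq: "rhs12_part exact k A B C0 = rhs12 exact k A B C0 - ?P"
      unfolding rd(4) using rhs_carrier(3)[of exact k A B C0] P by (intro eq_matI) auto
    have "fnorm (rhs12_part exact k A B C0) \<le> fnorm (rhs12 exact k A B C0) + fnorm ?P"
      unfolding eq by (rule fnorm_minus_le[OF rhs_carrier(4) P])
    also have "fnorm ?P \<le> mnorm (blk ?m 0 1 A) * fnorm (syl22 exact k A B C0)"
      by (rule fnorm_mult_le[OF blk_carrier m0 sc(3)])
    also have "\<dots> \<le> M * fnorm R0" using Mb(1)[of 0 1] sr M by (intro mult_mono) auto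
    finally show ?thesis using z12 strict by simp
  qed
  have M2: "0 < L * M * r" using L1 M r by simp
  let ?F = "L * real ?m ^ d * (2 * real ?m * M) * r + L * M * r"
  have F11: "\<forall>\<^sub>F e in at_right 0. fnorm (rhs11 (fl e) k A B (C e) - (blk ?m 0 0 (C e) + blk ?m 0 1 A * syl21 (fl e) k A B (C e)))
      \<le> e * (\<kappa> * ?b + ?F)"
    unfolding rhs11_def by (rule matmul_add_first_order[OF blkt(1,2) t(1) m1 A12 srl(1) z11[unfolded rd] M2]; simp)
  have F22: "\<forall>\<^sub>F e in at_right 0. fnorm (rhs22 (fl e) k A B (C e) - (blk ?m 1 1 (C e) - syl21 (fl e) k A B (C e) * blk ?m 0 1 B))
      \<le> e * (\<kappa> * ?b + (L * real ?m ^ d * r * (2 * real ?m * M) + L * M * r))"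
    unfolding rhs22_def by (rule matmul_sub_first_order[OF blkt(1) t(1) blkt(2) m1 srl(1) B12 z22[unfolded rd] M2]; simp)
  have F12': "\<forall>\<^sub>F e in at_right 0. fnorm (rhs12_part (fl e) k A B (C e) - (blk ?m 0 1 (C e) - syl11 (fl e) k A B (C e) * blk ?m 0 1 B))
      \<le> e * (\<kappa> * (3 * M * r) + (L * real ?m ^ d * r * (2 * real ?m * M) + L * M * r))"
    unfolding rhs12_part_def by (rule matmul_sub_first_order[OF blkt(1) t(3) blkt(2) m1 srl(2) B12 z12'[unfolded rd(3)] M2]; simp)
  have z12s: "fnorm (rhs12 exact k A B C0) < ?b" using z12 strict by simp
  have F12: "\<forall>\<^sub>F e in at_right 0. fnorm (rhs12 (fl e) k A B (C e) - (rhs12_part (fl e) k A B (C e) + blk ?m 0 1 A * syl22 (fl e) k A B (C e)))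
      \<le> e * (\<kappa> * ?b + ?F)"
    unfolding rhs12_def by (rule matmul_add_first_order[OF t(6) blkt(2) t(5) m1 A12 srl(3) z12s[unfolded rd(4)] M2]; simp)
  have I21: "\<forall>\<^sub>F e in at_right 0. fnorm (residual (blk ?m 1 1 A) (blk ?m 0 0 B) (blk ?m 1 0 (C e)) (syl21 (fl e) k A B (C e)))
      \<le> e * (8 * L * ?G * M * r)"
    unfolding syl21_def by (intro Suc.IH[OF svb blkt(1)] Mb srl(1)[unfolded syl21_def]; simp)
  have I11: "\<forall>\<^sub>F e in at_right 0. fnorm (residual (blk ?m 0 0 A) (blk ?m 0 0 B) (rhs11 (fl e) k A B (C e)) (syl11 (fl e) k A B (C e)))
      \<le> e * (8 * L * ?G * M * r)"
    unfolding syl11_def by (intro Suc.IH[OF svb t(2)] Mb srl(2)[unfolded syl11_def]; simp)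
  have I22: "\<forall>\<^sub>F e in at_right 0. fnorm (residual (blk ?m 1 1 A) (blk ?m 1 1 B) (rhs22 (fl e) k A B (C e)) (syl22 (fl e) k A B (C e)))
      \<le> e * (8 * L * ?G * M * r)"
    unfolding syl22_def by (intro Suc.IH[OF svb t(4)] Mb srl(3)[unfolded syl22_def]; simp)
  have I12: "\<forall>\<^sub>F e in at_right 0. fnorm (residual (blk ?m 0 0 A) (blk ?m 1 1 B) (rhs12 (fl e) k A B (C e)) (syl12 (fl e) k A B (C e)))
      \<le> e * (8 * L * ?G * M * r)"
    unfolding syl12_def by (intro Suc.IH[OF svb t(7)] Mb srl(4)[unfolded syl12_def]; simp)
  let ?u = "L * M * r"
  \<comment> \<open>One product followed by one addition whose result is at most \<open>c * M * r\<close>.\<close>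
  have Fu: "\<kappa> * (c * M * r) + (L * real ?m ^ d * (2 * real ?m * M) * r + L * M * r) \<le> (c + 3) * (?u * ?G)" if "1 \<le> c" for c
  proof -
    have G: "1 \<le> ?G" by (simp add: one_le_power)
    have "real ?m ^ d * real ?m = (2 ^ (d + 1)) ^ k" by (simp add: power_mult_distrib flip: power_mult)
    also have "\<dots> \<le> ?G" by (intro power_mono power_increasing) auto
    finally have "2 * ?u * (real ?m ^ d * real ?m) \<le> 2 * ?u * ?G" using M2 by (intro mult_left_mono) auto
    moreover have "\<kappa> * (c * M * r) \<le> L * (c * M * r)" using kappa that M r by (intro mult_right_mono) auto
    moreover have "(c + 1) * ?u * 1 \<le> (c + 1) * ?u * ?G" using that M2 G by (intro mult_left_mono) auto
    ultimately show ?thesis by (simp add: algebra_simps)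
  qed
  from F11 F22 F12 F12' I21 I11 I22 I12 mat_tendstoD(2)[OF C] ev_sq eventually_eps_less[of 1, simplified]
  show ?case
  proof eventually_elim
    case (elim e)
    note Ce = elim(9) and sqe = elim(10)
    have e: "0 \<le> e" using elim by simp
    note Rb = SylR_Suc_blk[OF sqe AB Ce] and sce = syl_carrier[OF sqe, of k A B "C e"]
    define Q where "Q = fst (SylR (fl e) (Suc k) A B (C e))"
    have Qc: "Q \<in> sq_mat (2 * ?m)"
      unfolding Q_def using SylR_carrier[OF sqe, of A "Suc k" B "C e"] AB Ce by simp
    note rb = residual_blk[OF AB(1) u(1) AB(2) u(2) Ce Qc, unfolded Rb[folded Q_def]]
    let ?I = "e * (8 * (?u * ?G))"
    note rc = residual_carrier[OF blk_carrier blk_carrier]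
    note ms = mult_carrier_mat[of _ ?m ?m] and mc = minus_carrier_mat
    have 1: "fnorm (blk ?m 1 0 (residual A B (C e) Q)) \<le> ?I"
      unfolding rb(1)[OF rhs_carrier(1)] using elim by (simp add: mult_ac)
    have "fnorm (blk ?m 0 0 (residual A B (C e) Q)) \<le> e * (8 * L * ?G * M * r) + e * (\<kappa> * ?b + ?F)"
      unfolding rb(2)[OF rhs_carrier(1)[of "fl e" k A B "C e"]]
      by (rule fnorm_minus_leI[of _ ?m, OF _ _ elim(6) elim(1)]) (intro rc mc add_carrier_mat ms rhs_carrier sce blk_carrier)+
    also have "\<dots> \<le> ?I + e * (5 * (?u * ?G))"
      using mult_left_mono[OF Fu[of 2] e] by (simp add: mult_ac)
    finally have 2: "fnorm (blk ?m 0 0 (residual A B (C e) Q)) \<le> ?I + e * (5 * (?u * ?G))" .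
    have "fnorm (blk ?m 1 1 (residual A B (C e) Q)) \<le> e * (8 * L * ?G * M * r)
      + e * (\<kappa> * ?b + (L * real ?m ^ d * r * (2 * real ?m * M) + L * M * r))"
      unfolding rb(3)[OF rhs_carrier(2)[of "fl e" k A B "C e"]]
      by (rule fnorm_minus_leI[of _ ?m, OF _ _ elim(7) elim(2)]) (intro rc mc add_carrier_mat ms rhs_carrier sce blk_carrier)+
    also have "\<dots> \<le> ?I + e * (5 * (?u * ?G))"
      using mult_left_mono[OF Fu[of 2] e] by (simp add: mult_ac)
    finally have 3: "fnorm (blk ?m 1 1 (residual A B (C e) Q)) \<le> ?I + e * (5 * (?u * ?G))" .
    let ?P = "rhs12_part (fl e) k A B (C e)" and ?X = "blk ?m 0 1 (C e) - syl11 (fl e) k A B (C e) * blk ?m 0 1 B"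
      and ?Y = "blk ?m 0 1 A * syl22 (fl e) k A B (C e)" and ?D = "rhs12 (fl e) k A B (C e)"
    have Xc: "?X \<in> sq_mat ?m" by (intro mc ms sce blk_carrier)
    have Yc: "?Y \<in> sq_mat ?m" by (intro ms sce blk_carrier)
    have D: "fnorm (?D - (?X + ?Y)) \<le> fnorm (?D - (?P + ?Y)) + fnorm (?P - ?X)"
    proof -
      have eq: "?D - (?X + ?Y) = (?D - (?P + ?Y)) + (?P - ?X)"
        using Xc Yc rhs_carrier(3,4)[of "fl e" k A B "C e"] by (rule minus_add_split)
      show ?thesis unfolding eq
        by (rule fnorm_triangle[of _ ?m ?m]) (intro mc add_carrier_mat rhs_carrier Xc Yc)+
    qed
    have "fnorm (blk ?m 0 1 (residual A B (C e) Q)) \<le> e * (8 * L * ?G * M * r)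
      + (e * (\<kappa> * ?b + ?F) + e * (\<kappa> * (3 * M * r) + (L * real ?m ^ d * r * (2 * real ?m * M) + L * M * r)))"
      unfolding rb(4)[OF rhs_carrier(4)[of "fl e" k A B "C e"]]
      by (rule fnorm_minus_leI[of _ ?m, OF _ _ elim(8) order_trans[OF D add_mono[OF elim(3,4)]]])
        (intro rc mc add_carrier_mat ms rhs_carrier sce blk_carrier)+
    also have "\<dots> \<le> ?I + e * (11 * (?u * ?G))"
      using mult_left_mono[OF Fu[of 2] e] mult_left_mono[OF Fu[of 3] e] by (simp add: mult_ac)
    finally have 4: "fnorm (blk ?m 0 1 (residual A B (C e) Q)) \<le> ?I + e * (11 * (?u * ?G))" .
    \<comment> \<open>Four recursive calls contribute \<open>4 * 8\<close>, the right-hand sides \<open>5 + 5 + 11\<close>.\<close>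
    have "fnorm (residual A B (C e) Q) \<le> e * (53 * (?u * ?G))"
      using fnorm_le_sum_blk[OF residual_carrier[OF AB Ce Qc]] 1 2 3 4 by (simp add: mult_ac)
    also have "\<dots> \<le> e * (8 * 2 ^ (d + 3) * (?u * ?G))"
    proof -
      have "(64::real) \<le> 8 * 2 ^ (d + 3)" using one_le_power[of "2::real" d] by (simp add: power_add)
      then show ?thesis using M2 e by (intro mult_left_mono mult_right_mono) auto
    qed
    finally show ?case unfolding Q_def by (simp add: mult_ac)
  qed
qed

end

lemma minus_minus_swap:
  fixes P P0 Q Q0 :: "complex mat"
  assumes "P \<in> sq_mat n" "P0 \<in> sq_mat n" "Q \<in> sq_mat n" "Q0 \<in> sq_mat n"
  shows "P - P0 - (Q - Q0) = P - Q + (Q0 - P0)"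
  using assms by (auto intro!: eq_matI)

lemma mat_cancel:
  fixes X Y Z :: "complex mat"
  assumes "X \<in> sq_mat n" "Y \<in> sq_mat n"
  shows "X - (X + Y) = - Y" "X - Y = - (Y - X)" "- X = (Y - X) + - Y" "Y = (X + Y) - X"
  using assms by (auto intro!: eq_matI)

lemma zero_mult_zero_vec: "0\<^sub>m n m *\<^sub>v 0\<^sub>v m = (0\<^sub>v n :: complex vec)"
  by (intro eq_vecI) auto

section \<open>Measuring error vectors through the commutant\<close>

text \<open>The size \<open>\<beta>\<close> of an error vector is measured by representing the vector as a sum of terms \<open>Y u\<close> with
\<open>Y\<close> commuting with \<open>T\<close>; \<open>\<beta>\<close> bounds the sum of the products \<open>\<parallel>Y\<parallel>\<^sub>F \<parallel>u\<parallel>\<close>.  The point of the commutation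
is that \<open>R Y\<close> again solves a Sylvester equation, whose right-hand side is \<open>- C Y\<close> and has Frobenius
norm at most \<open>\<parallel>C\<parallel> \<parallel>Y\<parallel>\<^sub>F\<close>.  Hence multiplying by \<open>R\<close> enlarges \<open>\<beta>\<close> only by \<open>\<parallel>C\<parallel> / s\<close>, whereas the 2-norm
of \<open>R\<close> itself is only known to be at most \<open>sqrt n * \<parallel>C\<parallel> / s\<close>.\<close>

inductive commutant_span :: "complex mat \<Rightarrow> real \<Rightarrow> complex vec \<Rightarrow> bool" for T where
  base: "Y \<in> sq_mat (dim_row T) \<Longrightarrow> u \<in> carrier_vec (dim_row T) \<Longrightarrow> T * Y = Y * T \<Longrightarrow>
    fnorm Y * vnorm u \<le> \<beta> \<Longrightarrow> commutant_span T \<beta> (Y *\<^sub>v u)"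
| add: "commutant_span T \<beta> x \<Longrightarrow> commutant_span T \<gamma> y \<Longrightarrow> commutant_span T (\<beta> + \<gamma>) (x + y)"

lemma commutant_span_carrier: "commutant_span T \<beta> x \<Longrightarrow> x \<in> carrier_vec (dim_row T)"
  by (induction rule: commutant_span.induct) auto

lemma commutant_span_vnorm: "commutant_span T \<beta> x \<Longrightarrow> vnorm x \<le> \<beta>"
proof (induction rule: commutant_span.induct)
  case (base Y u \<beta>)
  then show ?case using vnorm_mult_le_fnorm[OF base(1,2)] by simp
next
  case (add \<beta> x \<gamma> y)
  then show ?case using vnorm_triangle[OF commutant_span_carrier[OF add(1)] commutant_span_carrier[OF add(2)]] by simp
qed

lemma commutant_span_zero:
  assumes T: "T \<in> sq_mat n" and b: "0 \<le> \<beta>"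
  shows "commutant_span T \<beta> (0\<^sub>v n)"
proof -
  have "commutant_span T \<beta> (0\<^sub>m n n *\<^sub>v 0\<^sub>v n)"
    using T b fnorm_eq_0_iff[of "0\<^sub>m n n" n n] by (intro commutant_span.base) auto
  then show ?thesis by (simp only: zero_mult_zero_vec)
qed

lemma commutant_span_mono:
  assumes T: "T \<in> sq_mat n" and x: "commutant_span T \<beta> x" and le: "\<beta> \<le> \<gamma>"
  shows "commutant_span T \<gamma> x"
proof -
  have "commutant_span T (\<beta> + (\<gamma> - \<beta>)) (x + 0\<^sub>v n)"
    using le by (intro commutant_span.add x commutant_span_zero[OF T]) simp
  then show ?thesis using commutant_span_carrier[OF x] T by simp
qed

text \<open>With \<open>Y = 1\<close> an arbitrary vector enters, at the price of one factor \<open>sqrt n\<close>.  Every rounding error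
pays this price once, at the level at which it is committed.\<close>

lemma commutant_span_any:
  assumes T: "T \<in> sq_mat n" and x: "x \<in> carrier_vec n"
  shows "commutant_span T (sqrt n * vnorm x) x"
proof -
  have "commutant_span T (sqrt n * vnorm x) (1\<^sub>m n *\<^sub>v x)"
    using T x by (intro commutant_span.base) (auto simp: fnorm_one)
  then show ?thesis using x by simp
qed

lemma commutant_span_smult:
  "commutant_span T \<beta> x \<Longrightarrow> commutant_span T (cmod c * \<beta>) (c \<cdot>\<^sub>v x)"
proof (induction rule: commutant_span.induct)
  case (base Y u \<beta>)
  have "commutant_span T (cmod c * \<beta>) (Y *\<^sub>v (c \<cdot>\<^sub>v u))"
    using base mult_left_mono[OF base(4), of "cmod c"] by (intro commutant_span.base) (auto simp: mult_ac)
  then show ?case using base(1,2) by (simp add: mult_mat_vec)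
next
  case (add \<beta> x \<gamma> y)
  have "commutant_span T (cmod c * \<beta> + cmod c * \<gamma>) (c \<cdot>\<^sub>v x + c \<cdot>\<^sub>v y)"
    using add.IH by (rule commutant_span.add)
  then show ?case
    using smult_add_distrib_vec[OF commutant_span_carrier[OF add(1)] commutant_span_carrier[OF add(2)]]
    by (simp add: distrib_left)
qed

lemma fnorm_four_block_le:
  assumes "A \<in> sq_mat m" "B \<in> sq_mat m" "C \<in> sq_mat m" "D \<in> sq_mat m"
  shows "fnorm (four_block_mat A B C D) \<le> fnorm A + fnorm B + fnorm C + fnorm D"
  using fnorm_le_sum_blk[OF four_block_carrier_double[OF assms(1,4)], of B C] blk_four_block[OF assms] by simp

lemma fnorm_zero [simp]: "fnorm (0\<^sub>m n m) = 0"
  by (simp add: fnorm_eq_0_iff[of _ n m])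

text \<open>One level of the eigenvector recursion: \<open>R\<close> is the exact solution of the Sylvester equation, so
that the columns of \<open>[R; 1]\<close> span an invariant subspace of \<open>T\<close>.\<close>

locale block_triangular =
  fixes m :: nat and A B C R :: "complex mat" and s M :: real
  assumes A: "A \<in> sq_mat m" and B: "B \<in> sq_mat m" and C: "C \<in> sq_mat m"
    and R: "R \<in> sq_mat m" and m: "0 < m" and s: "0 < s" "s \<le> sep A B" and CM: "mnorm C \<le> M"
    and res: "residual A B C R = 0\<^sub>m m m"
begin

abbreviation "T \<equiv> four_block_mat A C (0\<^sub>m m m) B"

lemma T_carrier: "T \<in> sq_mat (2 * m)"
  by (rule four_block_carrier_double[OF A B])

lemma Sylvester: "A * R + C = R * B" "C = R * B - A * R"
  by (fact residual_zeroD(1,2)[OF mult_carrier_mat[OF A R] mult_carrier_mat[OF R B] C res[unfolded residual_def]])+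

lemma fnorm_le_of_Sylvester:
  assumes Z: "Z \<in> sq_mat m" and "fnorm (A * Z - Z * B) \<le> M * y"
  shows "fnorm Z \<le> M / s * y"
  using sep_bound[OF A B Z s(2)] assms(2) s(1) by (simp add: pos_le_divide_eq mult.commute)

text \<open>If \<open>Y\<close> commutes with \<open>B\<close>, then \<open>A (R Y) - (R Y) B = (A R - R B) Y = - C Y\<close>.\<close>

lemma fnorm_commutant_lower:
  assumes Y: "Y \<in> sq_mat m" and comm: "B * Y = Y * B"
  shows "fnorm (R * Y) \<le> M / s * fnorm Y" "A * (R * Y) + C * Y = (R * Y) * B"
proof -
  have c: "A * R \<in> sq_mat m" "R * B \<in> sq_mat m" "A * (R * Y) \<in> sq_mat m" "C * Y \<in> sq_mat m"
    using A B C R Y by auto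
  have "A * (R * Y) + C * Y = (A * R + C) * Y"
    using add_mult_distrib_mat[OF c(1) C Y] assoc_mult_mat[OF A R Y] by simp
  also have "\<dots> = R * (B * Y)" unfolding Sylvester(1) by (rule assoc_mult_mat[OF R B Y])
  also have "\<dots> = R * Y * B" unfolding comm by (rule assoc_mult_mat[OF R Y B, symmetric])
  finally show eq: "A * (R * Y) + C * Y = (R * Y) * B" .
  have "A * (R * Y) - (R * Y) * B = - (C * Y)"
    unfolding eq[symmetric] by (rule mat_cancel(1)[OF c(3,4)])
  then have "fnorm (A * (R * Y) - (R * Y) * B) = fnorm (C * Y)" by simp
  also have "\<dots> \<le> mnorm C * fnorm Y" by (rule fnorm_mult_le[OF C m Y])
  also have "\<dots> \<le> M * fnorm Y" using CM by (intro mult_right_mono) auto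
  finally show "fnorm (R * Y) \<le> M / s * fnorm Y"
    using R Y by (intro fnorm_le_of_Sylvester) auto
qed

text \<open>If \<open>Y\<close> commutes with \<open>A\<close>, then \<open>A (Y R) - (Y R) B = Y (A R - R B) = - Y C\<close>.\<close>

lemma fnorm_commutant_upper:
  assumes Y: "Y \<in> sq_mat m" and comm: "A * Y = Y * A"
  shows "fnorm (Y * R) \<le> M / s * fnorm Y" "Y * C = (Y * R) * B - A * (Y * R)"
proof -
  have c: "A * R \<in> sq_mat m" "R * B \<in> sq_mat m" "A * (Y * R) \<in> sq_mat m" "Y * R * B \<in> sq_mat m"
    using A B C R Y by auto
  have "Y * C = Y * (R * B) - Y * (A * R)"
    unfolding Sylvester(2) by (rule mult_minus_distrib_mat[OF Y c(2,1)])
  also have "Y * (R * B) = Y * R * B" by (rule assoc_mult_mat[OF Y R B, symmetric])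
  also have "Y * (A * R) = A * (Y * R)"
    using assoc_mult_mat[OF Y A R] assoc_mult_mat[OF A Y R] comm by simp
  finally show eq: "Y * C = (Y * R) * B - A * (Y * R)" .
  have "A * (Y * R) - (Y * R) * B = - (Y * C)"
    unfolding eq by (rule mat_cancel(2)[OF c(3,4)])
  then have "fnorm (A * (Y * R) - (Y * R) * B) = fnorm (Y * C)" by simp
  also have "\<dots> \<le> fnorm Y * mnorm C" by (rule fnorm_mult_le_right[OF Y C m])
  also have "\<dots> \<le> M * fnorm Y" using CM by (subst mult.commute, intro mult_right_mono) auto
  finally show "fnorm (Y * R) \<le> M / s * fnorm Y"
    using R Y by (intro fnorm_le_of_Sylvester) auto
qed

lemma commutant_span_extend:
  assumes "Z \<in> sq_mat (2 * m)" "v \<in> carrier_vec (2 * m)" "T * Z = Z * T"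
    and Z: "fnorm Z \<le> (1 + M / s) * y" and le: "y * vnorm v \<le> \<beta>"
  shows "commutant_span T ((1 + M / s) * \<beta>) (Z *\<^sub>v v)"
proof (rule commutant_span.base)
  have "fnorm Z * vnorm v \<le> (1 + M / s) * (y * vnorm v)"
    unfolding mult.assoc[symmetric] using Z by (intro mult_right_mono) auto
  also have "\<dots> \<le> (1 + M / s) * \<beta>"
    using le s(1) order_trans[OF mnorm_nonneg[OF C m] CM] by (intro mult_left_mono) auto
  finally show "fnorm Z * vnorm v \<le> (1 + M / s) * \<beta>" .
qed (use assms A B in \<open>auto simp: mult_2\<close>)

text \<open>A matrix \<open>Y\<close> commuting with \<open>B\<close> extends to the matrix \<open>[0, R Y; 0, Y]\<close> commuting with \<open>T\<close>.\<close>

lemma commutant_span_lower: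
  "commutant_span B \<beta> x \<Longrightarrow> commutant_span T ((1 + M / s) * \<beta>) ((R *\<^sub>v x) @\<^sub>v x)"
proof (induction rule: commutant_span.induct)
  case (base Y u \<beta>)
  have Y: "Y \<in> sq_mat m" and u: "u \<in> carrier_vec m" using base B by auto
  note low = fnorm_commutant_lower[OF Y base(3)]
  have RY: "R * Y \<in> sq_mat m" using R Y by auto
  note z = zero_carrier_mat[of m m]
  let ?Y = "four_block_mat (0\<^sub>m m m) (R * Y) (0\<^sub>m m m) Y"
  have "T * ?Y = four_block_mat (0\<^sub>m m m) (A * (R * Y) + C * Y) (0\<^sub>m m m) (B * Y)"
    unfolding mult_four_block_mat[OF A C z B z RY z Y]
    using A B C Y RY mult_carrier_mat[OF B Y] by (simp only: zero_mat_laws z)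
  moreover have "?Y * T = four_block_mat (0\<^sub>m m m) ((R * Y) * B) (0\<^sub>m m m) (Y * B)"
    unfolding mult_four_block_mat[OF z RY z Y A C z B]
    using A B C Y RY mult_carrier_mat[OF RY B] mult_carrier_mat[OF Y B] by (simp only: zero_mat_laws z)
  ultimately have comm: "T * ?Y = ?Y * T" using low(2) base(3) by simp
  have "?Y *\<^sub>v (0\<^sub>v m @\<^sub>v u) = ((R * Y) *\<^sub>v u) @\<^sub>v (Y *\<^sub>v u)"
    using four_block_mat_mult_vec[OF z RY z Y zero_carrier_vec u] RY Y u
      left_zero_vec[OF mult_mat_vec_carrier[OF RY u]] left_zero_vec[OF mult_mat_vec_carrier[OF Y u]]
    by (simp only: zero_mult_zero_vec)
  moreover have "commutant_span T ((1 + M / s) * \<beta>) (?Y *\<^sub>v (0\<^sub>v m @\<^sub>v u))"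
  proof (rule commutant_span_extend[OF four_block_carrier_double[OF z Y] _ comm])
    show "fnorm ?Y \<le> (1 + M / s) * fnorm Y"
      using fnorm_four_block_le[OF z RY z Y] low(1) by (simp add: distrib_right)
  qed (use base(4) u in \<open>auto simp: mult_2\<close>)
  ultimately show ?case using R Y u by simp
next
  case (add \<beta> x \<gamma> y)
  have x: "x \<in> carrier_vec m" "y \<in> carrier_vec m"
    using commutant_span_carrier[OF add(1)] commutant_span_carrier[OF add(2)] B by auto
  have "(R *\<^sub>v (x + y)) @\<^sub>v (x + y) = ((R *\<^sub>v x) @\<^sub>v x) + ((R *\<^sub>v y) @\<^sub>v y)"
    using R x by (simp add: mult_add_distrib_mat_vec[OF R x] append_vec_add[of _ m _ _ m])
  then show ?case using commutant_span.add[OF add.IH] by (simp add: distrib_left)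
qed

text \<open>A matrix \<open>Y\<close> commuting with \<open>A\<close> extends to the matrix \<open>[Y, - Y R; 0, 0]\<close> commuting with \<open>T\<close>; padding
\<open>Y\<close> with zeros would not commute.\<close>

lemma commutant_span_upper:
  "commutant_span A \<beta> x \<Longrightarrow> commutant_span T ((1 + M / s) * \<beta>) (x @\<^sub>v 0\<^sub>v m)"
proof (induction rule: commutant_span.induct)
  case (base Y u \<beta>)
  have Y: "Y \<in> sq_mat m" and u: "u \<in> carrier_vec m" using base A by auto
  note up = fnorm_commutant_upper[OF Y base(3)]
  have YR: "Y * R \<in> sq_mat m" and YR': "- (Y * R) \<in> sq_mat m" using R Y by auto
  note z = zero_carrier_mat[of m m]
  let ?Y = "four_block_mat Y (- (Y * R)) (0\<^sub>m m m) (0\<^sub>m m m)"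
  have "T * ?Y = four_block_mat (A * Y) (A * (- (Y * R))) (0\<^sub>m m m) (0\<^sub>m m m)"
    unfolding mult_four_block_mat[OF A C z B Y YR' z z]
    using A B C Y YR' mult_carrier_mat[OF A Y] mult_carrier_mat[OF A YR'] by (simp only: zero_mat_laws z)
  moreover have "?Y * T = four_block_mat (Y * A) (Y * C + - (Y * R) * B) (0\<^sub>m m m) (0\<^sub>m m m)"
    unfolding mult_four_block_mat[OF Y YR' z z A C z B]
    using A B C Y YR' mult_carrier_mat[OF Y A] by (simp only: zero_mat_laws z)
  moreover have "A * (- (Y * R)) = Y * C + - (Y * R) * B"
  proof -
    have c: "A * (Y * R) \<in> sq_mat m" "Y * R * B \<in> sq_mat m" using A B YR by auto
    have "A * (- (Y * R)) = - (A * (Y * R))" "- (Y * R) * B = - (Y * R * B)"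
      using A B YR by (auto intro!: uminus_mult_right_mat uminus_mult_left_mat simp del: assoc_mult_mat)
    then show ?thesis unfolding up(2) using mat_cancel(3)[OF c] by simp
  qed
  ultimately have comm: "T * ?Y = ?Y * T" using base(3) by simp
  have "?Y *\<^sub>v (u @\<^sub>v 0\<^sub>v m) = (Y *\<^sub>v u + - (Y * R) *\<^sub>v 0\<^sub>v m) @\<^sub>v (0\<^sub>m m m *\<^sub>v u + 0\<^sub>m m m *\<^sub>v 0\<^sub>v m)"
    by (rule four_block_mat_mult_vec[OF Y YR' z z u zero_carrier_vec])
  also have "\<dots> = (Y *\<^sub>v u) @\<^sub>v 0\<^sub>v m"
    using Y YR' u by (intro arg_cong2[of _ _ _ _ "(@\<^sub>v)"] eq_vecI) (auto simp: scalar_prod_def)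
  finally have "?Y *\<^sub>v (u @\<^sub>v 0\<^sub>v m) = (Y *\<^sub>v u) @\<^sub>v 0\<^sub>v m" .
  moreover have "commutant_span T ((1 + M / s) * \<beta>) (?Y *\<^sub>v (u @\<^sub>v 0\<^sub>v m))"
  proof (rule commutant_span_extend[OF four_block_carrier_double[OF Y z] _ comm])
    show "fnorm ?Y \<le> (1 + M / s) * fnorm Y"
      using fnorm_four_block_le[OF Y YR' z z] up(1) by (simp add: distrib_right)
  qed (use base(4) u in \<open>auto simp: mult_2\<close>)
  ultimately show ?case by simp
next
  case (add \<beta> x \<gamma> y)
  have x: "x \<in> carrier_vec m" "y \<in> carrier_vec m"
    using commutant_span_carrier[OF add(1)] commutant_span_carrier[OF add(2)] A by auto
  have "(x + y) @\<^sub>v 0\<^sub>v m = (x @\<^sub>v 0\<^sub>v m) + (y @\<^sub>v 0\<^sub>v m)"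
    using x append_vec_add[of x m y "0\<^sub>v m" m "0\<^sub>v m"] by simp
  then show ?case using commutant_span.add[OF add.IH] by (simp add: distrib_left)
qed

end

section \<open>Column normalization\<close>

lemma sum_squares_error:
  assumes fp: "fp_arith \<kappa> e ar" and u: "0 \<le> \<kappa> * e"
  shows "cmod (fst (sum_squares ar f n) - complex_of_real (\<Sum>i<n. (cmod (f i))\<^sup>2))
    \<le> ((1 + \<kappa> * e) ^ (n + 1) - 1) * (\<Sum>i<n. (cmod (f i))\<^sup>2)"
proof (induction n)
  case (Suc n)
  let ?u = "\<kappa> * e" and ?S = "\<Sum>i<n. (cmod (f i))\<^sup>2" and ?a = "(cmod (f n))\<^sup>2"
  let ?E = "(1 + ?u) ^ (n + 1) - 1"
  define x where "x = fst (sum_squares ar f n)"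
  define y where "y = mul ar (cnj (f n)) (f n)"
  have eq: "fst (sum_squares ar f (Suc n)) = add ar x y" by (simp add: x_def y_def split_beta)
  have S: "0 \<le> ?S" by (intro sum_nonneg) auto
  have "(1 + ?u) ^ 1 \<le> (1 + ?u) ^ (n + 1)" using u by (intro power_increasing) auto
  then have E: "?u \<le> ?E" by simp
  have "cnj (f n) * f n = complex_of_real ?a" using complex_norm_square[of "f n"] by (simp add: mult.commute)
  moreover have "cmod (y - cnj (f n) * f n) \<le> ?u * cmod (cnj (f n) * f n)"
    unfolding y_def using fp unfolding fp_arith_def by blast
  ultimately have y: "cmod (y - complex_of_real ?a) \<le> ?u * ?a" by (simp add: norm_mult power2_eq_square)
  have x: "cmod (x - complex_of_real ?S) \<le> ?E * ?S" unfolding x_def by (rule Suc.IH)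
  have "cmod ((x + y) - complex_of_real (?S + ?a)) \<le> cmod (x - complex_of_real ?S) + cmod (y - complex_of_real ?a)"
    using norm_triangle_ineq[of "x - complex_of_real ?S" "y - complex_of_real ?a"] by (simp add: algebra_simps)
  also have "\<dots> \<le> ?E * ?S + ?E * ?a" using x y mult_right_mono[OF E, of ?a] by simp
  finally have xy: "cmod ((x + y) - complex_of_real (?S + ?a)) \<le> ?E * (?S + ?a)" by (simp add: distrib_left)
  have "cmod (x + y) \<le> cmod (complex_of_real (?S + ?a)) + cmod ((x + y) - complex_of_real (?S + ?a))"
    by (rule norm_triangle_sub)
  also have "\<dots> \<le> (?S + ?a) + ?E * (?S + ?a)"
    using xy S by (intro add_mono) (simp_all only: norm_of_real abs_of_nonneg add_nonneg_nonneg zero_le_power2 order.refl)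
  finally have nxy: "cmod (x + y) \<le> (1 + ?E) * (?S + ?a)" by (simp only: distrib_right[of 1] mult_1)
  have "cmod (add ar x y - (x + y)) \<le> ?u * cmod (x + y)" using fp unfolding fp_arith_def by blast
  also have "\<dots> \<le> ?u * ((1 + ?E) * (?S + ?a))" by (rule mult_left_mono[OF nxy u])
  finally have r: "cmod (add ar x y - (x + y)) \<le> ?u * ((1 + ?E) * (?S + ?a))" .
  have "cmod (add ar x y - complex_of_real (?S + ?a)) \<le> ?u * ((1 + ?E) * (?S + ?a)) + ?E * (?S + ?a)"
    by (rule norm_diff_triangle_le[OF r xy])
  also have "\<dots> = ((1 + ?u) ^ (Suc n + 1) - 1) * (?S + ?a)" by (simp add: algebra_simps)
  finally show ?case unfolding eq by (simp only: sum.lessThan_Suc)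
qed simp

text \<open>The principal root has nonnegative real part, so \<open>\<bar>csqrt x + N\<bar> \<ge> N\<close>, and dividing
\<open>(csqrt x - N) * (csqrt x + N) = x - N\<^sup>2\<close> by this factor does not lose anything.\<close>

lemma csqrt_error:
  assumes N: "0 \<le> N" and x: "cmod (x - complex_of_real (N\<^sup>2)) \<le> c * N\<^sup>2"
  shows "cmod (csqrt x - complex_of_real N) \<le> c * N"
proof (cases "N = 0")
  case True
  then show ?thesis using x by simp
next
  case False
  then have N0: "0 < N" using N by simp
  have "N \<le> Re (csqrt x + complex_of_real N)" using Re_csqrt[of x] by simp
  also have "\<dots> \<le> cmod (csqrt x + complex_of_real N)" by (rule complex_Re_le_cmod)
  finally have "cmod (csqrt x - complex_of_real N) * N \<le> cmod (csqrt x - complex_of_real N) * cmod (csqrt x + complex_of_real N)"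
    by (intro mult_left_mono) auto
  also have "\<dots> = cmod ((csqrt x)\<^sup>2 - (complex_of_real N)\<^sup>2)"
    unfolding norm_mult[symmetric] by (simp add: power2_eq_square algebra_simps)
  also have "\<dots> \<le> c * N\<^sup>2" using x by simp
  finally show ?thesis using N0 by (simp add: power2_eq_square)
qed

lemma col_norm_error:
  assumes fp: "fp_arith \<kappa> e ar" and u: "0 \<le> \<kappa> * e" and j: "j < dim_col V"
  shows "cmod (fst (col_norm ar V j) - complex_of_real (vnorm (col V j)))
    \<le> ((1 + \<kappa> * e) ^ (dim_row V + 2) - 1) * vnorm (col V j)"
proof -
  let ?u = "\<kappa> * e" and ?n = "dim_row V" and ?N = "vnorm (col V j)"
  let ?E = "(1 + ?u) ^ (?n + 1) - 1"
  define x where "x = fst (sum_squares ar (\<lambda>i. V $$ (i, j)) ?n)"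
  have N2: "(\<Sum>i<?n. (cmod (V $$ (i, j)))\<^sup>2) = ?N\<^sup>2"
    unfolding vnorm_sq using j by (auto intro!: sum.cong)
  have "cmod (x - complex_of_real (?N\<^sup>2)) \<le> ?E * ?N\<^sup>2"
    unfolding x_def using sum_squares_error[OF fp u, of "\<lambda>i. V $$ (i, j)" ?n] unfolding N2 .
  from csqrt_error[OF vnorm_nonneg this] have c: "cmod (csqrt x - complex_of_real ?N) \<le> ?E * ?N" .
  have "cmod (csqrt x) \<le> ?N + ?E * ?N"
    by (rule order_trans[OF norm_triangle_sub add_mono[OF _ c]]) simp
  then have cx: "cmod (csqrt x) \<le> (1 + ?E) * ?N" by (simp only: distrib_right mult_1)
  have "cmod (root2 ar x - csqrt x) \<le> ?u * cmod (csqrt x)" using fp unfolding fp_arith_def by blast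
  also have "\<dots> \<le> ?u * ((1 + ?E) * ?N)" by (rule mult_left_mono[OF cx u])
  finally have "cmod (root2 ar x - complex_of_real ?N) \<le> ?u * ((1 + ?E) * ?N) + ?E * ?N"
    using c by (rule norm_diff_triangle_le)
  also have "\<dots> = ((1 + ?u) ^ (?n + 2) - 1) * ?N" by (simp add: algebra_simps)
  finally show ?thesis by (simp add: col_norm_def x_def split_beta)
qed

lemma quot_error:
  assumes fp: "fp_arith \<kappa> e ar" and u: "0 \<le> \<kappa> * e" and N: "0 < N"
    and nu: "cmod (\<nu> - complex_of_real N) \<le> c * N" "0 \<le> c" "c \<le> 1 / 2"
  shows "cmod (quot ar x \<nu> - complex_of_real (1 / N) * x) \<le> (2 * (\<kappa> * e) + 2 * c) * (cmod x / N)"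
proof -
  have "N \<le> cmod \<nu> + cmod (\<nu> - complex_of_real N)"
    using norm_triangle_ineq4[of \<nu> "\<nu> - complex_of_real N"] N by simp
  moreover have "c * N \<le> 1 / 2 * N" using nu N by (intro mult_right_mono) auto
  ultimately have half: "N \<le> 2 * cmod \<nu>" using nu by simp
  then have nu0: "\<nu> \<noteq> 0" using N by auto
  have inv: "1 / cmod \<nu> \<le> 2 / N" using half N nu0 by (simp add: field_simps)
  have "cmod (quot ar x \<nu> - x / \<nu>) \<le> (\<kappa> * e) * cmod (x / \<nu>)"
    using fp nu0 unfolding fp_arith_def by blast
  also have "\<dots> = (\<kappa> * e) * (cmod x * (1 / cmod \<nu>))" by (simp add: norm_divide)
  also have "\<dots> \<le> (\<kappa> * e) * (cmod x * (2 / N))"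
    by (intro mult_left_mono inv u) auto
  finally have 1: "cmod (quot ar x \<nu> - x / \<nu>) \<le> 2 * (\<kappa> * e) * (cmod x / N)" by (simp add: mult_ac)
  have "x / \<nu> - complex_of_real (1 / N) * x = - (x / complex_of_real N) * ((\<nu> - complex_of_real N) / \<nu>)"
    using nu0 N by (simp add: field_simps)
  then have "cmod (x / \<nu> - complex_of_real (1 / N) * x) = cmod x / N * (cmod (\<nu> - complex_of_real N) * (1 / cmod \<nu>))"
    using N by (simp add: norm_mult norm_divide)
  also have "\<dots> \<le> cmod x / N * (c * N * (2 / N))"
    using nu N by (intro mult_left_mono mult_mono inv) auto
  finally have 2: "cmod (x / \<nu> - complex_of_real (1 / N) * x) \<le> 2 * c * (cmod x / N)" using N by (simp add: mult_ac)
  show ?thesis using norm_diff_triangle_le[OF 1 2] by (simp only: distrib_right)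
qed

lemma normalize_cols_from_carrier: "V \<in> carrier_mat n l \<Longrightarrow> fst (normalize_cols_from ar m V) \<in> carrier_mat n l"
  by (auto simp: normalize_cols_from_def)

lemma power_error:
  assumes "0 \<le> u" "real N * u \<le> 1 / 2"
  shows "(1 + u) ^ N - 1 \<le> 2 * (real N * u)"
proof -
  have "(1 + u) ^ N \<le> exp u ^ N" using assms by (intro power_mono) auto
  also have "\<dots> = exp (real N * u)" by (simp add: exp_of_nat_mult)
  also have "\<dots> \<le> 1 + 2 * (real N * u)"
    using exp_bound_lemma[of "real N * u"] assms by simp
  finally show ?thesis by simp
qed

text \<open>The computed column norm has relative error about \<open>(n + 2) * \<kappa> * e\<close>; the smallness assumption turns the
power \<open>(1 + \<kappa> * e) ^ (n + 2)\<close> into a linear bound.  Exact arithmetic is the case \<open>\<kappa> = 0\<close>.\<close>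

lemma normalize_error:
  assumes fp: "fp_arith \<kappa> e ar" and u: "0 \<le> \<kappa> * e" "4 * (real n + 2) * (\<kappa> * e) \<le> 1"
    and V: "V \<in> carrier_mat n l" and j: "m \<le> j" "j < l" and N: "0 < vnorm (col V j)"
  shows "vnorm (col (fst (normalize_cols_from ar m V)) j - complex_of_real (1 / vnorm (col V j)) \<cdot>\<^sub>v col V j)
    \<le> (4 * real n + 10) * (\<kappa> * e)"
proof -
  let ?u = "\<kappa> * e" and ?N = "vnorm (col V j)" and ?\<nu> = "fst (col_norm ar V j)"
  let ?c = "2 * (real (n + 2) * ?u)"
  have "0 \<le> ?c" using u by simp
  moreover have "?c \<le> 1 / 2" using u by (simp add: algebra_simps)
  ultimately have c: "0 \<le> ?c" "?c \<le> 1 / 2" .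
  have "cmod (?\<nu> - complex_of_real ?N) \<le> ((1 + ?u) ^ (n + 2) - 1) * ?N"
    using col_norm_error[OF fp u(1), of j V] V j by auto
  also have "\<dots> \<le> ?c * ?N" using u c by (intro mult_right_mono power_error) auto
  finally have nu: "cmod (?\<nu> - complex_of_real ?N) \<le> ?c * ?N" .
  have "vnorm (col (fst (normalize_cols_from ar m V)) j - complex_of_real (1 / ?N) \<cdot>\<^sub>v col V j)
    \<le> ((2 * ?u + 2 * ?c) / ?N) * vnorm (col V j)"
  proof (rule vnorm_le_entrywise)
    fix i assume "i < dim_vec (col V j)"
    then have "i < n" using V by auto
    then show "cmod ((col (fst (normalize_cols_from ar m V)) j - complex_of_real (1 / ?N) \<cdot>\<^sub>v col V j) $ i)
        \<le> (2 * ?u + 2 * ?c) / ?N * cmod (col V j $ i)"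
      using quot_error[OF fp u(1) N nu c, of "V $$ (i, j)"] V j
      by (simp add: normalize_cols_from_def)
  qed (use V j c u in \<open>auto simp: normalize_cols_from_def\<close>)
  also have "\<dots> = 2 * ?u + 2 * ?c" using N by simp
  also have "\<dots> = (4 * real n + 10) * ?u" by (simp add: algebra_simps)
  finally show ?thesis .
qed

section \<open>Columns of the eigenvector recursion\<close>

definition evec_blocks where
  "evec_blocks ar k T = four_block_mat (fst (EVecR ar k (blk (2 ^ k) 0 0 T)))
     (fst (matmul ar (fst (SylR ar k (blk (2 ^ k) 0 0 T) (blk (2 ^ k) 1 1 T) (blk (2 ^ k) 0 1 T)))
        (fst (EVecR ar k (blk (2 ^ k) 1 1 T)))))
     (0\<^sub>m (2 ^ k) (2 ^ k)) (fst (EVecR ar k (blk (2 ^ k) 1 1 T)))"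

lemma EVecR_Suc_fst:
  assumes "T \<in> sq_mat (2 * 2 ^ k)"
  shows "fst (EVecR ar (Suc k) T) = fst (normalize_cols_from ar (2 ^ k) (evec_blocks ar k T))"
  using assms by (simp add: evec_blocks_def split_block_blk Let_def split_beta)

lemma EVecR_carrier:
  assumes "square_matmul ar"
  shows "T \<in> sq_mat (2 ^ k) \<Longrightarrow> fst (EVecR ar k T) \<in> sq_mat (2 ^ k)"
proof (induction k arbitrary: T)
  case (Suc k)
  have "evec_blocks ar k T \<in> sq_mat (2 * 2 ^ k)"
    unfolding evec_blocks_def by (intro four_block_carrier_double Suc.IH blk_carrier)
  then show ?case using EVecR_Suc_fst[of T k ar] Suc.prems normalize_cols_from_carrier by simp
qed simp

lemma evec_blocks_carrier:
  assumes "square_matmul ar"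
  shows "evec_blocks ar k T \<in> sq_mat (2 * 2 ^ k)"
    unfolding evec_blocks_def by (intro four_block_carrier_double EVecR_carrier[OF assms] blk_carrier)

lemma evec_blocks_cols:
  assumes sq: "square_matmul ar" and j: "j < 2 ^ k"
  shows "col (evec_blocks ar k T) j = col (fst (EVecR ar k (blk (2 ^ k) 0 0 T))) j @\<^sub>v 0\<^sub>v (2 ^ k)" (is ?upper)
    "col (evec_blocks ar k T) (2 ^ k + j) =
       col (fst (matmul ar (fst (SylR ar k (blk (2 ^ k) 0 0 T) (blk (2 ^ k) 1 1 T) (blk (2 ^ k) 0 1 T)))
        (fst (EVecR ar k (blk (2 ^ k) 1 1 T))))) j @\<^sub>v col (fst (EVecR ar k (blk (2 ^ k) 1 1 T))) j" (is "?lower = col ?P j @\<^sub>v ?x")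
proof -
  let ?m = "2 ^ k :: nat"
  have VA: "fst (EVecR ar k (blk ?m 0 0 T)) \<in> sq_mat ?m"
    and VB: "fst (EVecR ar k (blk ?m 1 1 T)) \<in> sq_mat ?m"
    by (intro EVecR_carrier[OF sq] blk_carrier)+
  have P: "?P \<in> sq_mat ?m"
    by (intro matmul_carrier[OF sq] SylR_carrier[OF sq] VB blk_carrier)
  note c = col_four_block_mat[OF VA P zero_carrier_mat VB]
  show ?upper
    unfolding evec_blocks_def c(1)[OF j] using j by simp
  show "?lower = col ?P j @\<^sub>v ?x"
    unfolding evec_blocks_def using c(2)[of "?m + j"] j by simp
qed

lemma normalize_cols_from_below:
  assumes "V \<in> carrier_mat n l" "j < m" "j < l"
  shows "col (fst (normalize_cols_from ar m V)) j = col V j"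
  using assms by (intro eq_vecI) (auto simp: normalize_cols_from_def)

lemma EVecR_col_upper:
  assumes sq: "square_matmul ar" and T: "T \<in> sq_mat (2 * 2 ^ k)" and j: "j < 2 ^ k"
  shows "col (fst (EVecR ar (Suc k) T)) j = col (fst (EVecR ar k (blk (2 ^ k) 0 0 T))) j @\<^sub>v 0\<^sub>v (2 ^ k)"
  unfolding EVecR_Suc_fst[OF T] evec_blocks_cols(1)[OF sq j, symmetric]
  by (rule normalize_cols_from_below[OF evec_blocks_carrier[OF sq] j]) (use j in simp)

text \<open>The hypotheses on the input, with an upper bound \<open>M\<close> instead of the norm of \<open>T\<close>: in this form they are
inherited by the diagonal blocks.\<close>

definition separated :: "nat \<Rightarrow> complex mat \<Rightarrow> real \<Rightarrow> real \<Rightarrow> bool" where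
  "separated k T s M \<longleftrightarrow> T \<in> sq_mat (2 ^ k) \<and> upper_triangular T \<and>
     (\<forall>\<sigma> \<in> encountered_seps k T. s \<le> \<sigma>) \<and> mnorm T \<le> M"

lemma separated_carrier: "separated k T s M \<Longrightarrow> T \<in> sq_mat (2 ^ k)"
  by (simp add: separated_def)

lemma separated_SucD:
  assumes sep: "separated (Suc k) T s M" and s: "0 < s"
  shows "T \<in> sq_mat (2 * 2 ^ k)"
    "separated k (blk (2 ^ k) 0 0 T) s M" "separated k (blk (2 ^ k) 1 1 T) s M"
    "s \<le> sep (blk (2 ^ k) 0 0 T) (blk (2 ^ k) 1 1 T)"
    "solvable (2 ^ k) (blk (2 ^ k) 0 0 T) (blk (2 ^ k) 1 1 T)"
    "p \<le> 1 \<Longrightarrow> q \<le> 1 \<Longrightarrow> mnorm (blk (2 ^ k) p q T) \<le> M"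
    "T = four_block_mat (blk (2 ^ k) 0 0 T) (blk (2 ^ k) 0 1 T) (0\<^sub>m (2 ^ k) (2 ^ k)) (blk (2 ^ k) 1 1 T)"
proof -
  let ?m = "2 ^ k :: nat"
  show T: "T \<in> sq_mat (2 * ?m)" using sep by (simp add: separated_def)
  have u: "upper_triangular T" using sep by (simp add: separated_def)
  note bu = blk_upper_triangular[OF T u]
  have es: "encountered_seps (Suc k) T = {sep (blk ?m 0 0 T) (blk ?m 1 1 T)}
      \<union> encountered_seps k (blk ?m 0 0 T) \<union> encountered_seps k (blk ?m 1 1 T)"
    using T by (simp add: split_block_blk)
  have b: "mnorm (blk ?m p q T) \<le> M" if "p \<le> 1" "q \<le> 1" for p q
    using mnorm_blk_le[OF T _ that] sep by (simp add: separated_def)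
  then show "p \<le> 1 \<Longrightarrow> q \<le> 1 \<Longrightarrow> mnorm (blk ?m p q T) \<le> M" .
  have all: "\<forall>\<sigma> \<in> encountered_seps (Suc k) T. s \<le> \<sigma>" using sep by (simp add: separated_def)
  show "separated k (blk ?m 0 0 T) s M" "separated k (blk ?m 1 1 T) s M"
    using all bu b[of 0 0] b[of 1 1] unfolding separated_def es by auto
  show s': "s \<le> sep (blk ?m 0 0 T) (blk ?m 1 1 T)" using all unfolding es by auto
  show "solvable ?m (blk ?m 0 0 T) (blk ?m 1 1 T)"
    unfolding solvable_def
    using sep_pos_imp_diag_distinct[OF blk_carrier bu(1) blk_carrier bu(2) less_le_trans[OF s s']] bu by auto
  show "T = four_block_mat (blk ?m 0 0 T) (blk ?m 0 1 T) (0\<^sub>m ?m ?m) (blk ?m 1 1 T)"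
    using four_block_blk[OF T] unfolding bu(3) .
qed

text \<open>The ratio \<open>M / s\<close> is therefore at least \<open>1 / 2\<close>, so that \<open>1 + M / s\<close> may be replaced by \<open>3 * (M / s)\<close> in the end.\<close>

lemma separated_le:
  assumes "separated (Suc k) T s M" "0 < s"
  shows "s \<le> 2 * M"
proof -
  have "s \<le> mnorm (blk (2 ^ k) 0 0 T) + mnorm (blk (2 ^ k) 1 1 T)"
    using order_trans[OF separated_SucD(4)[OF assms] sep_le_mnorm[OF blk_carrier _ blk_carrier]] by simp
  also have "\<dots> \<le> M + M" by (intro add_mono separated_SucD(6)[OF assms]) auto
  finally show ?thesis by simp
qed

lemma fp_arith_exact: "fp_arith 0 e exact"
  by (simp add: fp_arith_def)

lemma vec_eq_of_vnorm_diff: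
  assumes "x \<in> carrier_vec n" "y \<in> carrier_vec n" "vnorm (x - y) \<le> 0"
  shows "x = y"
proof -
  have "x - y = 0\<^sub>v n" using assms vnorm_eq_0_iff[of "x - y" n] vnorm_nonneg[of "x - y"] by auto
  then have "(x - y) $ i = 0" if "i < n" for i using that by simp
  then show ?thesis using assms by (intro eq_vecI) auto
qed

text \<open>Exact arithmetic satisfies the rounding model with constant 0, so this follows from the error bound
for the normalization.\<close>

lemma EVecR_exact_col_lower:
  assumes T: "T \<in> sq_mat (2 * 2 ^ k)" and j: "j < 2 ^ k"
    and x: "x = col (fst (EVecR exact k (blk (2 ^ k) 1 1 T))) j" "0 < vnorm x"
    and R: "R = fst (SylR exact k (blk (2 ^ k) 0 0 T) (blk (2 ^ k) 1 1 T) (blk (2 ^ k) 0 1 T))"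
  shows "col (fst (EVecR exact (Suc k) T)) (2 ^ k + j)
    = complex_of_real (1 / vnorm ((R *\<^sub>v x) @\<^sub>v x)) \<cdot>\<^sub>v ((R *\<^sub>v x) @\<^sub>v x)"
proof -
  let ?m = "2 ^ k :: nat" and ?V = "evec_blocks exact k T"
  note sq = square_matmul_exact
  have V: "?V \<in> sq_mat (2 * ?m)" by (rule evec_blocks_carrier[OF sq])
  have Rc: "R \<in> sq_mat ?m" unfolding R by (intro SylR_carrier[OF sq] blk_carrier)
  have c: "col ?V (?m + j) = (R *\<^sub>v x) @\<^sub>v x"
    unfolding evec_blocks_cols(2)[OF sq j] exact_simps fst_conv R[symmetric] x(1)
    using col_mult2[OF Rc EVecR_carrier[OF sq blk_carrier] j] by simp
  have N: "0 < vnorm (col ?V (?m + j))"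
    unfolding c using vnorm_append_le(2)[of x "R *\<^sub>v x"] x(2) by simp
  have "vnorm (col (fst (normalize_cols_from exact ?m ?V)) (?m + j)
      - complex_of_real (1 / vnorm (col ?V (?m + j))) \<cdot>\<^sub>v col ?V (?m + j)) \<le> 0"
    using normalize_error[OF fp_arith_exact _ _ V _ _ N, of 0 ?m] j by simp
  then have "col (fst (normalize_cols_from exact ?m ?V)) (?m + j)
      = complex_of_real (1 / vnorm (col ?V (?m + j))) \<cdot>\<^sub>v col ?V (?m + j)"
    using V normalize_cols_from_carrier[OF V, of exact ?m] j
    by (intro vec_eq_of_vnorm_diff[where n = "2 * ?m"] smult_carrier_vec[THEN iffD2] col_carrier_vec) auto
  then show ?thesis unfolding EVecR_Suc_fst[OF T] c .
qed

lemma EVecR_exact_col_vnorm: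
  "T \<in> sq_mat (2 ^ k) \<Longrightarrow> j < 2 ^ k \<Longrightarrow> vnorm (col (fst (EVecR exact k T)) j) = 1"
proof (induction k arbitrary: T j)
  case 0
  then show ?case using unit_vec_vnorm[of 0 1] by simp
next
  case (Suc k)
  let ?m = "2 ^ k :: nat"
  have T: "T \<in> sq_mat (2 * ?m)" using Suc.prems by simp
  show ?case
  proof (cases "j < ?m")
    case True
    then show ?thesis using EVecR_col_upper[OF square_matmul_exact T True] Suc.IH[OF blk_carrier True] by simp
  next
    case False
    define i where "i = j - ?m"
    have i: "j = ?m + i" "i < ?m" using False Suc.prems by (auto simp: i_def)
    define x where "x = col (fst (EVecR exact k (blk ?m 1 1 T))) i"
    have x: "vnorm x = 1" unfolding x_def by (rule Suc.IH[OF blk_carrier i(2)])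
    then have "0 < vnorm x" by simp
    note lo = EVecR_exact_col_lower[OF T i(2) x_def this refl]
    have "0 < vnorm (y @\<^sub>v x)" for y using vnorm_append_le(2)[of x y] x by simp
    moreover have "\<bar>1 / a\<bar> * a = 1" if "0 < a" for a :: real using that by simp
    ultimately show ?thesis unfolding i(1) lo vnorm_smult norm_of_real by blast
  qed
qed

text \<open>A computed column is written as a nonnegative multiple of the exact one plus an error vector.  The
multiple absorbs the rescaling by the norm, so no projection of the error along the column is
needed; the projected part would have to be measured anew, at the price of a factor \<open>sqrt n\<close> per
level.  The old error \<open>\<delta>\<close> becomes
\<open>[R \<delta>; \<delta>]\<close> divided by the column norm, while all errors committed at this level
enter as one arbitrary vector.\<close>

lemma (in block_triangular) column_step:
  assumes x: "x \<in> carrier_vec m" "vnorm x = 1" and \<alpha>: "0 \<le> \<alpha>" and \<delta>: "commutant_span B \<beta> \<delta>"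
    and y: "y = complex_of_real \<alpha> \<cdot>\<^sub>v x + \<delta>" and p: "p \<in> carrier_vec m" "vnorm (p - R *\<^sub>v y) \<le> \<eta>"
    and N: "N = vnorm (p @\<^sub>v y)" "1 / 2 \<le> N"
    and v: "v \<in> carrier_vec (2 * m)" "vnorm (v - complex_of_real (1 / N) \<cdot>\<^sub>v (p @\<^sub>v y)) \<le> \<tau>"
    and v0: "v0 = complex_of_real (1 / vnorm ((R *\<^sub>v x) @\<^sub>v x)) \<cdot>\<^sub>v ((R *\<^sub>v x) @\<^sub>v x)"
  shows "\<exists>\<alpha>' \<delta>'. 0 \<le> \<alpha>' \<and> v = complex_of_real \<alpha>' \<cdot>\<^sub>v v0 + \<delta>' \<and>
    commutant_span T ((1 / N) * ((1 + M / s) * \<beta>) + sqrt (2 * m) * (2 * \<eta> + \<tau>)) \<delta>'"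
proof -
  have d: "\<delta> \<in> carrier_vec m" using commutant_span_carrier[OF \<delta>] B by simp
  have yc: "y \<in> carrier_vec m" using x d y by simp
  define a where "a = R *\<^sub>v x"
  define b where "b = R *\<^sub>v \<delta>"
  have ab: "a \<in> carrier_vec m" "b \<in> carrier_vec m" using R x d by (auto simp: a_def b_def)
  have Ry: "R *\<^sub>v y = complex_of_real \<alpha> \<cdot>\<^sub>v a + b"
    unfolding y a_def b_def using mult_add_distrib_mat_vec[OF R _ d] mult_mat_vec[OF R x(1)] x by simp
  define n where "n = vnorm (a @\<^sub>v x)"
  have n: "0 < n" using vnorm_append_le(2)[of x a] x by (simp add: n_def)
  have N0: "0 < N" using N by simp
  define g where "g = (p - R *\<^sub>v y) @\<^sub>v 0\<^sub>v m"
  define t where "t = v - complex_of_real (1 / N) \<cdot>\<^sub>v (p @\<^sub>v y)"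
  define \<delta>' where "\<delta>' = complex_of_real (1 / N) \<cdot>\<^sub>v (b @\<^sub>v \<delta>) + (complex_of_real (1 / N) \<cdot>\<^sub>v g + t)"
  have gc: "g \<in> carrier_vec (2 * m)" using p Ry ab by (auto simp: g_def mult_2)
  have pyc: "p @\<^sub>v y \<in> carrier_vec (2 * m)" using p yc by (auto simp: mult_2)
  have tc: "t \<in> carrier_vec (2 * m)" using v pyc by (auto simp: t_def)
  have "v = complex_of_real (\<alpha> * n / N) \<cdot>\<^sub>v v0 + \<delta>'"
  proof (rule eq_vecI)
    fix i assume "i < dim_vec (complex_of_real (\<alpha> * n / N) \<cdot>\<^sub>v v0 + \<delta>')"
    then have i: "i < m + m" using ab d gc tc by (auto simp: \<delta>'_def)
    have py: "(p @\<^sub>v y) $ i = complex_of_real \<alpha> * (a @\<^sub>v x) $ i + (b @\<^sub>v \<delta>) $ i + g $ i"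
      using i p yc ab d x unfolding g_def Ry unfolding y by auto
    have "v $ i = complex_of_real (1 / N) * (p @\<^sub>v y) $ i + t $ i"
      using i v p(1) yc unfolding t_def by (simp add: mult_2)
    also have "\<dots> = complex_of_real (\<alpha> * n / N) * (complex_of_real (1 / n) * (a @\<^sub>v x) $ i) + \<delta>' $ i"
    proof -
      have "\<delta>' $ i = complex_of_real (1 / N) * (b @\<^sub>v \<delta>) $ i + (complex_of_real (1 / N) * g $ i + t $ i)"
        unfolding \<delta>'_def using i ab d gc tc by (simp add: mult_2)
      then show ?thesis unfolding py using n N0 by (simp add: add_divide_distrib)
    qed
    finally show "v $ i = (complex_of_real (\<alpha> * n / N) \<cdot>\<^sub>v v0 + \<delta>') $ i"
      unfolding v0 a_def[symmetric] n_def[symmetric] using i ab x d gc tc by (simp add: \<delta>'_def)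
  qed (use v ab d gc tc in \<open>auto simp: \<delta>'_def\<close>)
  moreover have "commutant_span T ((1 / N) * ((1 + M / s) * \<beta>) + sqrt (2 * m) * (2 * \<eta> + \<tau>)) \<delta>'"
  proof -
    have 1: "commutant_span T ((1 / N) * ((1 + M / s) * \<beta>)) (complex_of_real (1 / N) \<cdot>\<^sub>v (b @\<^sub>v \<delta>))"
      using commutant_span_smult[OF commutant_span_lower[OF \<delta>], of "complex_of_real (1 / N)"] N0
      unfolding b_def norm_of_real by simp
    have "1 / N \<le> 2" using N N0 by (simp add: field_simps)
    have "vnorm (complex_of_real (1 / N) \<cdot>\<^sub>v g + t) \<le> (1 / N) * vnorm g + vnorm t"
      using vnorm_triangle[of "complex_of_real (1 / N) \<cdot>\<^sub>v g" "2 * m" t] gc tc N0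
      by (simp add: norm_divide)
    also have "\<dots> \<le> 2 * \<eta> + \<tau>"
      using p(2) v(2) \<open>1 / N \<le> 2\<close> N0 unfolding g_def t_def vnorm_append_zero
      by (intro add_mono mult_mono) auto
    finally have "sqrt (2 * m) * vnorm (complex_of_real (1 / N) \<cdot>\<^sub>v g + t) \<le> sqrt (2 * m) * (2 * \<eta> + \<tau>)"
      by (intro mult_left_mono) auto
    moreover have "complex_of_real (1 / N) \<cdot>\<^sub>v g + t \<in> carrier_vec (2 * m)" using gc tc by simp
    ultimately have "commutant_span T (sqrt (2 * m) * (2 * \<eta> + \<tau>)) (complex_of_real (1 / N) \<cdot>\<^sub>v g + t)"
      by (intro commutant_span_mono[OF T_carrier commutant_span_any[OF T_carrier]])
    from commutant_span.add[OF 1 this] show ?thesis unfolding \<delta>'_def .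
  qed
  moreover have "0 \<le> \<alpha> * n / N" using \<alpha> n N0 by simp
  ultimately show ?thesis by blast
qed

text \<open>The multiple \<open>\<alpha>\<close> is recovered at the end: both columns have norm close to 1, and \<open>\<alpha>\<close> is nonnegative.\<close>

lemma col_error_of_decomposition:
  assumes v0: "v0 \<in> carrier_vec n" "vnorm v0 = 1" and v: "v = complex_of_real \<alpha> \<cdot>\<^sub>v v0 + \<delta>" and \<alpha>: "0 \<le> \<alpha>"
    and \<delta>: "\<delta> \<in> carrier_vec n" "vnorm \<delta> \<le> b" and c: "\<bar>vnorm v - 1\<bar> \<le> c"
  shows "vnorm (v - v0) \<le> 2 * b + c"
proof -
  have "v - v0 = complex_of_real (\<alpha> - 1) \<cdot>\<^sub>v v0 + \<delta>"
    unfolding v using v0 \<delta> by (intro eq_vecI) (auto simp: algebra_simps)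
  moreover have "vnorm (complex_of_real (\<alpha> - 1) \<cdot>\<^sub>v v0 + \<delta>) \<le> vnorm (complex_of_real (\<alpha> - 1) \<cdot>\<^sub>v v0) + vnorm \<delta>"
    using v0 \<delta> by (intro vnorm_triangle[of _ n]) auto
  ultimately have 1: "vnorm (v - v0) \<le> \<bar>\<alpha> - 1\<bar> + b" using v0 \<delta> by (simp add: norm_of_real[of "\<alpha> - 1", simplified])
  have "vnorm v \<le> vnorm (complex_of_real \<alpha> \<cdot>\<^sub>v v0) + vnorm \<delta>"
    unfolding v using v0 \<delta> by (intro vnorm_triangle[of _ n]) auto
  then have 2: "vnorm v \<le> \<alpha> + b" using v0 \<delta> \<alpha> by simp
  have "complex_of_real \<alpha> \<cdot>\<^sub>v v0 = v + (- 1) \<cdot>\<^sub>v \<delta>"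
    unfolding v using v0 \<delta> by (intro eq_vecI) auto
  then have "vnorm (complex_of_real \<alpha> \<cdot>\<^sub>v v0) \<le> vnorm v + vnorm ((- 1) \<cdot>\<^sub>v \<delta>)"
    using vnorm_triangle[of v n "(- 1) \<cdot>\<^sub>v \<delta>"] v0 \<delta> v by simp
  then have 3: "\<alpha> \<le> vnorm v + b" using v0 \<delta> \<alpha> by simp
  show ?thesis using 1 2 3 c by linarith
qed

section \<open>Error propagation through the eigenvector recursion\<close>

text \<open>The difference to the exact solution solves the Sylvester equation with the residual as right-hand
side.  This is the only place where the accuracy of the Sylvester solver involves the separation.\<close>

lemma SylR_exact_error:
  assumes sv: "solvable (2 ^ k) A B" and C: "C \<in> sq_mat (2 ^ k)" and R: "R \<in> sq_mat (2 ^ k)"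
    and s: "0 < s" "s \<le> sep A B"
  shows "fnorm (R - fst (SylR exact k A B C)) \<le> fnorm (residual A B C R) / s"
    and "fnorm (fst (SylR exact k A B C)) \<le> fnorm C / s"
proof -
  let ?n = "2 ^ k :: nat" and ?R0 = "fst (SylR exact k A B C)"
  note AB = solvable_carrier[OF sv]
  have R0: "?R0 \<in> sq_mat ?n" by (intro SylR_carrier[OF square_matmul_exact] AB C)
  note z = SylR_exact[OF sv C]
  have c: "A * R \<in> sq_mat ?n" "A * ?R0 \<in> sq_mat ?n" "R * B \<in> sq_mat ?n" "?R0 * B \<in> sq_mat ?n"
    using AB R R0 by auto
  note id = residual_zeroD(3,2)[OF c(2,4) C z[unfolded residual_def]]
  have "A * (R - ?R0) - (R - ?R0) * B = residual A B C R"
    unfolding mult_minus_distrib_mat[OF AB(1) R R0] minus_mult_distrib_mat[OF R R0 AB(2)] residual_def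
    by (rule trans[OF minus_minus_swap[OF c] arg_cong[OF id(2)[symmetric], of "(+) (A * R - R * B)"]])
  then have "s * fnorm (R - ?R0) \<le> fnorm (residual A B C R)"
    using sep_bound[OF AB minus_carrier_mat[OF R0, of R] s(2)] by simp
  then show "fnorm (R - ?R0) \<le> fnorm (residual A B C R) / s"
    using s by (simp add: pos_le_divide_eq mult.commute)
  have "A * ?R0 - ?R0 * B = - C" by (rule id(1))
  then have "s * fnorm ?R0 \<le> fnorm C"
    using sep_bound[OF AB R0 s(2)] by simp
  then show "fnorm ?R0 \<le> fnorm C / s"
    using s by (simp add: pos_le_divide_eq mult.commute)
qed

lemma vec_diff_split: "x \<in> carrier_vec m \<Longrightarrow> y \<in> carrier_vec m \<Longrightarrow> z \<in> carrier_vec m \<Longrightarrow>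
    x - z = (x - y) + (y - z)" for x y z :: "complex vec"
  by (intro eq_vecI) auto

lemma col_minus: "A \<in> carrier_mat n m \<Longrightarrow> B \<in> carrier_mat n m \<Longrightarrow> i < m \<Longrightarrow> col (A - B) i = col A i - col B i"
  for A B :: "complex mat"
  by (intro eq_vecI) auto

lemma perturbed_product_col:
  assumes P: "P \<in> sq_mat m" and S: "S \<in> sq_mat m" and V: "V \<in> sq_mat m"
    and R: "R \<in> sq_mat m" and i: "i < m"
  shows "col P i - R *\<^sub>v col V i = col (P - S * V) i + (S - R) *\<^sub>v (col V i :: complex vec)"
proof -
  have v: "col V i \<in> carrier_vec m" by (rule col_carrier_vec[OF i V])
  show ?thesis
    unfolding col_minus[OF P mult_carrier_mat[OF S V] i] minus_mult_distrib_mat_vec[OF S R v] col_mult2[OF S V i]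
    by (rule vec_diff_split[OF col_carrier_vec[OF i P] mult_mat_vec_carrier[OF S v] mult_mat_vec_carrier[OF R v]])
qed

lemma vnorm_diff_abs:
  assumes v: "v \<in> carrier_vec n" and w: "w \<in> carrier_vec n"
  shows "\<bar>vnorm v - vnorm w\<bar> \<le> vnorm (v - w)"
proof -
  have "v = w + (v - w)" "w = v + (- 1) \<cdot>\<^sub>v (v - w)" using v w by (auto intro!: eq_vecI)
  then have "vnorm v \<le> vnorm w + vnorm (v - w)" "vnorm w \<le> vnorm v + vnorm ((- 1) \<cdot>\<^sub>v (v - w))"
    using vnorm_triangle[OF w, of "v - w"] vnorm_triangle[OF v, of "(- 1) \<cdot>\<^sub>v (v - w)"] v w by auto
  then show ?thesis by simp
qed

lemma append_zero_linear:
  fixes x y :: "complex vec"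
  assumes "x \<in> carrier_vec m" "y \<in> carrier_vec m"
  shows "(c \<cdot>\<^sub>v x + y) @\<^sub>v 0\<^sub>v m = c \<cdot>\<^sub>v (x @\<^sub>v 0\<^sub>v m) + (y @\<^sub>v 0\<^sub>v m)"
  using assms by (intro eq_vecI) auto

context stable_fl begin

text \<open>The solution of the recurrence for the error bound, with \<open>q = M / s\<close>: one factor \<open>1 + q\<close> for each
level and two more for the error of the Sylvester solver, times a power of the dimension.\<close>

definition growth :: "nat \<Rightarrow> real \<Rightarrow> real" where
  "growth k q = 133 * L * (4 * 2 ^ (d + 3)) ^ k * (1 + q) ^ (k + 2)"

lemma growth_nonneg: "0 \<le> q \<Longrightarrow> 0 \<le> growth k q"
  using L1 by (simp add: growth_def)

text \<open>Here \<open>H\<close> collects the errors of the product \<open>R \<cdot> V\<^sub>B\<close> and of the Sylvester solver, \<open>14 * L * (2 * m)\<close> is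
the error of the normalization, \<open>sqrt (2 * m)\<close> is the price for turning arbitrary vectors into
commutant form, and the summand 1 leaves room for replacing a lower bound close to 1 for the column norm by 1.\<close>

lemma growth_Suc:
  fixes q :: real and k :: nat
  assumes q: "0 \<le> q"
  defines "m \<equiv> (2::real) ^ k"
  defines "H \<equiv> (L * m ^ d * (m * (1 + q)) * (2 * m) + 1) + (8 * L * (2 ^ (d + 3)) ^ k * (q * (m * (1 + q)))) * 2"
  shows "(1 + q) * growth k q + 1 + sqrt (2 * m) * (2 * H + 14 * L * (2 * m)) \<le> growth (Suc k) q"
proof -
  define g where "g = ((2::real) ^ (d + 3)) ^ k"
  define Q where "Q = 1 + q"
  have m1: "1 \<le> m" and g1: "1 \<le> g" and Q1: "1 \<le> Q" using q by (auto simp: m_def g_def Q_def one_le_power)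
  have mg: "m ^ d * m * m \<le> g"
  proof -
    have "m ^ d * m * m = m ^ (d + 2)" by (simp add: power_add power2_eq_square mult.assoc)
    also have "\<dots> = (2 ^ (d + 2)) ^ k" unfolding m_def by (simp only: power_mult[symmetric] mult.commute)
    also have "\<dots> \<le> g" unfolding g_def by (intro power_mono power_increasing) auto
    finally show ?thesis .
  qed
  have QQ: "1 \<le> Q * Q" "Q \<le> Q * Q" using Q1 mult_mono[of 1 Q 1 Q] mult_left_mono[of 1 Q Q] by auto
  have gm: "1 \<le> g * m" using g1 m1 mult_mono[of 1 g 1 m] by simp
  have LQ: "1 \<le> L * (Q * Q)" using L1 QQ mult_mono[of 1 L 1 "Q * Q"] by simp
  have a1: "L * m ^ d * (m * Q) * (2 * m) \<le> 2 * (L * (Q * Q)) * (g * m)"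
  proof -
    have "L * m ^ d * (m * Q) * (2 * m) = 2 * L * (Q * (m ^ d * m * m))" by (simp add: mult_ac)
    also have "\<dots> \<le> 2 * L * ((Q * Q) * (g * m))"
    proof (rule mult_left_mono[OF mult_mono])
      show "m ^ d * m * m \<le> g * m"
        using order_trans[OF mg, of "g * m"] m1 g1 by simp
    qed (use QQ Q1 m1 L1 in auto)
    finally show ?thesis by (simp add: mult_ac)
  qed
  have a2: "1 \<le> L * (Q * Q) * (g * m)" using LQ gm mult_mono[of 1 "L * (Q * Q)" 1 "g * m"] by simp
  have a3: "(8 * L * g * (q * (m * Q))) * 2 \<le> 16 * (L * (Q * Q)) * (g * m)"
  proof -
    have "(8 * L * g * (q * (m * Q))) * 2 = 16 * (L * (g * (m * (q * Q))))" by (simp add: mult_ac)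
    also have "\<dots> \<le> 16 * (L * (g * (m * (Q * Q))))"
      using L1 g1 m1 Q1 q by (intro mult_left_mono mult_right_mono) (auto simp: Q_def)
    finally show ?thesis by (simp add: mult_ac)
  qed
  have H: "H \<le> 19 * (L * (Q * Q) * (g * m))"
    using a1 a2 a3 unfolding H_def Q_def[symmetric] g_def[symmetric] by linarith
  \<comment> \<open>All sources are at most multiples of \<open>Z\<close>: \<open>4 * 19\<close> from \<open>H\<close>, 56 from the normalization, 1 from the slack.\<close>
  define Z where "Z = L * (Q * Q) * (g * m * m)"
  have Hm: "m * H \<le> 19 * Z" using mult_left_mono[OF H, of m] m1 by (simp add: Z_def mult_ac)
  have Lm: "m * (L * m) \<le> Z"
  proof -
    have "L * (m * m) * 1 \<le> L * (m * m) * (Q * Q * g)"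
      using L1 m1 QQ g1 mult_mono[of 1 "Q * Q" 1 g] by (intro mult_left_mono) auto
    then show ?thesis by (simp add: Z_def mult_ac)
  qed
  have "1 * 1 \<le> (L * (Q * Q) * (g * m)) * m" using a2 m1 by (intro mult_mono) auto
  then have Z1: "1 \<le> Z" by (simp add: Z_def mult_ac)
  have H0: "0 \<le> H" using L1 m1 q by (simp add: H_def)
  have "sqrt (2 * m) * (2 * H + 14 * L * (2 * m)) \<le> (2 * m) * (2 * H + 14 * L * (2 * m))"
    using m1 H0 L1 by (intro mult_right_mono sqrt_le_self) auto
  also have "\<dots> = 4 * (m * H) + 56 * (m * (L * m))" by (simp add: algebra_simps)
  also have "\<dots> \<le> 132 * Z" using Hm Lm by simp
  finally have src: "1 + sqrt (2 * m) * (2 * H + 14 * L * (2 * m)) \<le> 133 * Z" using Z1 by simp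
  define h where "h = (4 * 2 ^ (d + 3) :: real)"
  have h2: "2 \<le> h" unfolding h_def using one_le_power[of "2::real" "d + 3"] by linarith
  have hk: "h ^ k = g * m * m"
  proof -
    have "h ^ k = 4 ^ k * g" unfolding h_def g_def by (simp add: power_mult_distrib)
    also have "(4::real) ^ k = (2 * 2) ^ k" by simp
    also have "\<dots> = m * m" unfolding m_def by (simp only: power_mult_distrib)
    finally show ?thesis by simp
  qed
  have gk: "growth j q = 133 * L * h ^ j * Q ^ (j + 2)" for j by (simp add: growth_def h_def Q_def)
  let ?X = "133 * L * h ^ k"
  have X0: "0 \<le> ?X" using L1 h2 by simp
  have "133 * Z = ?X * Q ^ 2" unfolding hk Z_def by (simp add: power2_eq_square)
  also have "\<dots> \<le> ?X * Q ^ (k + 3)" using X0 Q1 by (intro mult_left_mono power_increasing) auto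
  finally have "(1 + q) * growth k q + 133 * Z \<le> 2 * (?X * Q ^ (k + 3))"
    unfolding gk Q_def[symmetric] by (simp add: power_add mult_ac numeral_3_eq_3 numeral_2_eq_2)
  also have "\<dots> \<le> h * (?X * Q ^ (k + 3))" using X0 Q1 h2 by (intro mult_right_mono) auto
  also have "\<dots> = growth (Suc k) q" unfolding gk by (simp add: power_add mult_ac numeral_3_eq_3 numeral_2_eq_2)
  finally show ?thesis using src by simp
qed

definition columns_accurate :: "nat \<Rightarrow> complex mat \<Rightarrow> real \<Rightarrow> real \<Rightarrow> bool" where
  "columns_accurate k T q e \<longleftrightarrow> (\<forall>j<2 ^ k.
     (\<exists>\<alpha> \<delta>. 0 \<le> \<alpha> \<and> col (fst (EVecR (fl e) k T)) j = complex_of_real \<alpha> \<cdot>\<^sub>v col (fst (EVecR exact k T)) j + \<delta> \<and>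
       commutant_span T (e * growth k q) \<delta>) \<and>
     \<bar>vnorm (col (fst (EVecR (fl e) k T)) j) - 1\<bar> \<le> e * (14 * L * 2 ^ k))"

lemma columns_accurate_error:
  assumes acc: "columns_accurate k T q e" and sq: "square_matmul (fl e)" and T: "T \<in> sq_mat (2 ^ k)"
    and e: "0 \<le> e" and q: "0 \<le> q"
  shows "fnorm (fst (EVecR (fl e) k T) - fst (EVecR exact k T)) \<le> e * (2 ^ k * (2 * growth k q + 14 * L * 2 ^ k))"
proof -
  let ?n = "2 ^ k :: nat" and ?V = "fst (EVecR (fl e) k T)" and ?U = "fst (EVecR exact k T)"
  let ?c = "2 * (e * growth k q) + e * (14 * L * 2 ^ k)"
  have V: "?V \<in> sq_mat ?n" by (rule EVecR_carrier[OF sq T])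
  have V0: "?U \<in> sq_mat ?n" by (rule EVecR_carrier[OF square_matmul_exact T])
  have c0: "0 \<le> ?c" using e growth_nonneg[OF q] L1 by simp
  have col: "vnorm (col (?V - ?U) j) \<le> ?c" if j: "j < ?n" for j
  proof -
    obtain \<alpha> \<delta> where a: "0 \<le> \<alpha>" "col ?V j = complex_of_real \<alpha> \<cdot>\<^sub>v col ?U j + \<delta>"
      "commutant_span T (e * growth k q) \<delta>" "\<bar>vnorm (col ?V j) - 1\<bar> \<le> e * (14 * L * 2 ^ k)"
      using acc j unfolding columns_accurate_def by blast
    have "vnorm (col ?V j - col ?U j) \<le> ?c"
      by (rule col_error_of_decomposition[OF col_carrier_vec[OF j V0] EVecR_exact_col_vnorm[OF T j] a(2,1) _
        commutant_span_vnorm[OF a(3)] a(4)]) (use commutant_span_carrier[OF a(3)] T in auto)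
    also have "col ?V j - col ?U j = col (?V - ?U) j"
      using V V0 j by (intro eq_vecI) auto
    finally show ?thesis .
  qed
  have "fnorm (?V - ?U) \<le> sqrt ?n * ?c"
    using V V0 c0 col by (intro fnorm_le_cols[of _ ?n]) auto
  also have "\<dots> \<le> 2 ^ k * ?c" using sqrt_le_self[of "real ?n"] c0 by (intro mult_right_mono) auto
  finally show ?thesis by (simp add: algebra_simps)
qed

lemma columns_accurate_tendsto:
  assumes acc: "\<forall>\<^sub>F e in at_right 0. columns_accurate k T q e" and T: "T \<in> sq_mat (2 ^ k)" and q: "0 \<le> q"
  shows "mat_tendsto (2 ^ k) (\<lambda>e. fst (EVecR (fl e) k T)) (fst (EVecR exact k T))"
proof (rule mat_tendsto_perturb[OF mat_tendsto_const[OF EVecR_carrier[OF square_matmul_exact T]]])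
  show "\<forall>\<^sub>F e in at_right 0. fst (EVecR (fl e) k T) \<in> sq_mat (2 ^ k)"
    using ev_sq by eventually_elim (rule EVecR_carrier[OF _ T])
  show "\<forall>\<^sub>F e in at_right 0. fnorm (fst (EVecR (fl e) k T) - fst (EVecR exact k T))
      \<le> e * (2 ^ k * (2 * growth k q + 14 * L * 2 ^ k))"
    using acc ev_sq eventually_eps_less[of 1, simplified]
    by eventually_elim (rule columns_accurate_error[OF _ _ T _ q]; simp)
qed

text \<open>Columns in the first half are copied and only change their ambient matrix.  For a column in the
second half, the recursive error is transported by \<open>[R; 1]\<close>, and the errors of the Sylvester
solver, of the product and of the normalization are added.\<close>

lemma EVecR_columns_accurate:
  assumes s: "0 < s" and M: "0 < M"
  shows "separated k T s M \<Longrightarrow> \<forall>\<^sub>F e in at_right 0. columns_accurate k T (M / s) e"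
proof (induction k arbitrary: T)
  case 0
  then have T: "T \<in> sq_mat 1" by (simp add: separated_def)
  have "columns_accurate 0 T (M / s) e" if "0 < e" for e
  proof -
    have "commutant_span T (e * growth 0 (M / s)) (0\<^sub>v 1)"
      using that s M by (intro commutant_span_zero[OF T] mult_nonneg_nonneg growth_nonneg) auto
    moreover have "col (1\<^sub>m 1) 0 = complex_of_real 1 \<cdot>\<^sub>v col (1\<^sub>m 1) 0 + 0\<^sub>v 1"
      by (intro eq_vecI) auto
    moreover have "vnorm (col (1\<^sub>m 1) 0) = 1" using unit_vec_vnorm[of 0 1] by simp
    moreover have "0 \<le> e * (14 * L)" using that L1 by simp
    ultimately show ?thesis unfolding columns_accurate_def
      by (auto intro!: exI[of _ "1::real"] exI[of _ "0\<^sub>v 1"] simp del: col_one)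
  qed
  then show ?case using eventually_eps_less[of 1, simplified] by (auto elim: eventually_mono)
next
  case (Suc k)
  let ?m = "2 ^ k :: nat" and ?q = "M / s"
  let ?r = "real ?m * (1 + ?q)"
  note sep = separated_SucD[OF Suc.prems s]
  define A where "A = blk ?m 0 0 T"
  define B where "B = blk ?m 1 1 T"
  define C where "C = blk ?m 0 1 T"
  define R where "R = fst (SylR exact k A B C)"
  have q0: "0 < ?q" using s M by simp
  have Ac: "A \<in> sq_mat ?m" and Bc: "B \<in> sq_mat ?m" and Cc: "C \<in> sq_mat ?m"
    by (simp_all add: A_def B_def C_def)
  have T: "T \<in> sq_mat (2 * ?m)" by (rule sep(1))
  have sv: "solvable ?m A B" unfolding A_def B_def by (rule sep(5))
  have sAB: "s \<le> sep A B" unfolding A_def B_def by (rule sep(4))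
  have Mb: "mnorm A \<le> M" "mnorm B \<le> M" "mnorm C \<le> M" unfolding A_def B_def C_def by (rule sep(6); simp)+
  have Rc: "R \<in> sq_mat ?m" unfolding R_def by (intro SylR_carrier[OF square_matmul_exact] Ac Bc Cc)
  have m0: "0 < ?m" and m1: "1 \<le> ?m" by simp_all
  interpret block_triangular ?m A B C R s M
    using Ac Bc Cc Rc m0 s sAB Mb SylR_exact[OF sv Cc] unfolding R_def[symmetric] by unfold_locales
  have Teq: "four_block_mat A C (0\<^sub>m ?m ?m) B = T" unfolding A_def B_def C_def using sep(7) by simp
  have R: "fnorm R < ?r"
  proof -
    have "fnorm R \<le> fnorm C / s" unfolding R_def by (rule SylR_exact_error(2)[OF sv Cc Rc s])
    also have "fnorm C \<le> sqrt ?m * mnorm C" using fnorm_le_sqrt_mnorm[OF Cc m0] by simp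
    also have "\<dots> \<le> real ?m * M"
      using sqrt_le_self[of "real ?m"] Mb(3) mnorm_nonneg[OF Cc m0] by (intro mult_mono) auto
    finally have "fnorm R \<le> real ?m * ?q" using s by (simp add: divide_right_mono)
    moreover have "0 < real ?m" by simp
    ultimately show ?thesis unfolding distrib_left by linarith
  qed
  define b where "b = growth k ?q"
  define X where "X = (1 + ?q) * b"
  have X0: "0 \<le> X" using growth_nonneg[of ?q k] q0 by (auto simp: b_def X_def)
  let ?H = "(L * real ?m ^ d * ?r * (2 * real ?m) + 1) + (8 * L * (2 ^ (d + 3)) ^ k * (?q * ?r)) * 2"
  let ?c = "14 * L * real ?m"
  have c0: "0 < ?c" using L1 by simp
  define VB0 where "VB0 = fst (EVecR exact k B)"
  have VB0c: "VB0 \<in> sq_mat ?m" unfolding VB0_def by (rule EVecR_carrier[OF square_matmul_exact Bc])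
  have accA: "\<forall>\<^sub>F e in at_right 0. columns_accurate k A ?q e" unfolding A_def by (rule Suc.IH[OF sep(2)])
  have accB: "\<forall>\<^sub>F e in at_right 0. columns_accurate k B ?q e" unfolding B_def by (rule Suc.IH[OF sep(3)])
  have VBt: "mat_tendsto ?m (\<lambda>e. fst (EVecR (fl e) k B)) VB0"
    unfolding VB0_def using q0 by (intro columns_accurate_tendsto[OF accB Bc]) simp
  have Rt: "mat_tendsto ?m (\<lambda>e. fst (SylR (fl e) k A B C)) R"
    unfolding R_def by (rule SylR_tendsto[OF sv mat_tendsto_const[OF Cc]])
  have VB0n: "fnorm VB0 < 2 * real ?m"
  proof -
    have "fnorm VB0 \<le> sqrt ?m * 1"
      using VB0c EVecR_exact_col_vnorm[OF Bc] by (intro fnorm_le_cols[of _ ?m]) (auto simp: VB0_def)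
    also have "\<dots> \<le> real ?m" using sqrt_le_self[of "real ?m"] by simp
    also have "\<dots> < 2 * real ?m" using m0 by simp
    finally show ?thesis .
  qed
  have one: "0 < (1::real)" by simp
  note evP = matmul_first_order[OF Rt VBt m1 R VB0n one]
  have evR: "\<forall>\<^sub>F e in at_right 0. fnorm (residual A B C (fst (SylR (fl e) k A B C))) \<le> e * (8 * L * (2 ^ (d + 3)) ^ k * M * ?r)"
    using SylR_residual[OF M sv mat_tendsto_const[OF Cc] Mb(1,2) R[unfolded R_def]] .
  \<comment> \<open>Below \<open>?t1\<close> the lower bound for the column norm is so close to 1 that dividing by it increases
    \<open>X\<close> by at most 1; below \<open>?t2\<close> the normalization error is linear in \<open>e\<close>.\<close>
  let ?t1 = "1 / (2 * ?c * (X + 1))" and ?t2 = "1 / (4 * (real (2 * ?m) + 2) * L)"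
  have t: "0 < ?t1" "0 < ?t2" using c0 X0 L1 by (auto intro!: divide_pos_pos mult_pos_pos add_nonneg_pos)
  from accA accB evP evR ev_sq ev_fp eventually_eps_less[of 1, simplified] eventually_eps_less[OF t(1)] eventually_eps_less[OF t(2)]
  show ?case
  proof eventually_elim
    case (elim e)
    note sqe = elim(5) and fpe = elim(6)
    have e: "0 < e" using elim by simp
    have ke: "0 \<le> \<kappa> * e" "\<kappa> * e \<le> L * e" using kappa e by (auto intro: mult_right_mono)
    have "2 * ?c * (X + 1) * e \<le> 1"
    proof -
      have Y: "0 < 2 * ?c * (X + 1)" using L1 c0 X0 by (intro mult_pos_pos add_nonneg_pos) auto
      have "e < ?t1" using elim(8) by (rule conjunct2)
      then have "e * (2 * ?c * (X + 1)) < 1" by (simp only: pos_less_divide_eq[OF Y])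
      then show ?thesis by (simp only: mult.commute[of "2 * ?c * (X + 1)"] less_imp_le)
    qed
    moreover have "2 * ?c * (X + 1) * e = 2 * (e * ?c * X) + 2 * (e * ?c)" by (simp add: algebra_simps)
    moreover have "0 \<le> e * ?c" "0 \<le> e * ?c * X"
      using e L1 X0 by (intro mult_nonneg_nonneg less_imp_le[OF c0] less_imp_le[OF e] X0)+
    ultimately have ec: "e * ?c \<le> 1 / 2" "2 * (e * ?c) * X \<le> 1" by linarith+
    have "4 * (real (2 * ?m) + 2) * (\<kappa> * e) \<le> 4 * (real (2 * ?m) + 2) * (L * e)"
      using ke by (intro mult_left_mono) auto
    also have "\<dots> \<le> 1"
    proof -
      have Y: "0 < 4 * (real (2 * ?m) + 2) * L" using L1 by (intro mult_pos_pos add_nonneg_pos) auto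
      have "e < ?t2" using elim(9) by (rule conjunct2)
      then have "e * (4 * (real (2 * ?m) + 2) * L) < 1" by (simp only: pos_less_divide_eq[OF Y])
      then show ?thesis by (simp only: mult_ac less_imp_le)
    qed
    finally have small: "4 * (real (2 * ?m) + 2) * (\<kappa> * e) \<le> 1" .
    define V where "V = fst (EVecR (fl e) (Suc k) T)"
    define W where "W = evec_blocks (fl e) k T"
    define P where "P = fst (matmul (fl e) (fst (SylR (fl e) k A B C)) (fst (EVecR (fl e) k B)))"
    define VB where "VB = fst (EVecR (fl e) k B)"
    define Re where "Re = fst (SylR (fl e) k A B C)"
    have VBc: "VB \<in> sq_mat ?m" unfolding VB_def by (rule EVecR_carrier[OF sqe Bc])
    have Rec: "Re \<in> sq_mat ?m" unfolding Re_def by (intro SylR_carrier[OF sqe] Ac Bc Cc)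
    have Pc: "P \<in> sq_mat ?m" unfolding P_def by (intro matmul_carrier[OF sqe] Rec[unfolded Re_def] VBc[unfolded VB_def])
    have Wc: "W \<in> sq_mat (2 * ?m)" unfolding W_def by (rule evec_blocks_carrier[OF sqe])
    have Vc: "V \<in> sq_mat (2 * ?m)" unfolding V_def using EVecR_carrier[OF sqe, of T "Suc k"] T by simp
    have dR: "fnorm (Re - R) \<le> e * (8 * L * (2 ^ (d + 3)) ^ k * (?q * ?r))"
    proof -
      have "fnorm (Re - R) \<le> fnorm (residual A B C Re) / s"
        unfolding R_def by (rule SylR_exact_error(1)[OF sv Cc Rec s])
      also have "\<dots> \<le> (e * (8 * L * (2 ^ (d + 3)) ^ k * M * ?r)) / s"
        using elim(4) s unfolding Re_def by (intro divide_right_mono) auto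
      finally show ?thesis by (simp add: mult_ac)
    qed
    have growth: "X + 1 + sqrt (2 * real ?m) * (2 * ?H + 14 * L * (2 * real ?m)) \<le> growth (Suc k) ?q"
      using growth_Suc[of ?q k] q0 unfolding X_def b_def by simp
    have sq0: "0 \<le> sqrt (2 * real ?m) * (2 * ?H + 14 * L * (2 * real ?m))"
      using L1 q0 by (intro mult_nonneg_nonneg add_nonneg_nonneg) auto
    have "(\<exists>\<alpha> \<delta>. 0 \<le> \<alpha> \<and> col V j = complex_of_real \<alpha> \<cdot>\<^sub>v col (fst (EVecR exact (Suc k) T)) j + \<delta> \<and>
       commutant_span T (e * growth (Suc k) ?q) \<delta>) \<and> \<bar>vnorm (col V j) - 1\<bar> \<le> e * (14 * L * 2 ^ Suc k)"
      if j: "j < 2 ^ Suc k" for j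
    proof (cases "j < ?m")
      case True
      have cV: "col V j = col (fst (EVecR (fl e) k A)) j @\<^sub>v 0\<^sub>v ?m"
        unfolding V_def A_def by (rule EVecR_col_upper[OF sqe T True])
      have cV0: "col (fst (EVecR exact (Suc k) T)) j = col (fst (EVecR exact k A)) j @\<^sub>v 0\<^sub>v ?m"
        unfolding A_def by (rule EVecR_col_upper[OF square_matmul_exact T True])
      obtain \<alpha> \<delta> where a: "0 \<le> \<alpha>" "col (fst (EVecR (fl e) k A)) j = complex_of_real \<alpha> \<cdot>\<^sub>v col (fst (EVecR exact k A)) j + \<delta>"
        "commutant_span A (e * b) \<delta>" "\<bar>vnorm (col (fst (EVecR (fl e) k A)) j) - 1\<bar> \<le> e * (14 * L * 2 ^ k)"
        using elim(1) True unfolding columns_accurate_def b_def by blast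
      have d: "\<delta> \<in> carrier_vec ?m" using commutant_span_carrier[OF a(3)] Ac by simp
      have x: "col (fst (EVecR exact k A)) j \<in> carrier_vec ?m"
        by (rule col_carrier_vec[OF True EVecR_carrier[OF square_matmul_exact Ac]])
      have "col V j = complex_of_real \<alpha> \<cdot>\<^sub>v col (fst (EVecR exact (Suc k) T)) j + (\<delta> @\<^sub>v 0\<^sub>v ?m)"
        unfolding cV cV0 a(2) by (rule append_zero_linear[OF x d])
      moreover have "commutant_span T (e * growth (Suc k) ?q) (\<delta> @\<^sub>v 0\<^sub>v ?m)"
      proof (rule commutant_span_mono[OF T])
        show "commutant_span T ((1 + M / s) * (e * b)) (\<delta> @\<^sub>v 0\<^sub>v ?m)"
          using commutant_span_upper[OF a(3)] unfolding Teq .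
        have "X \<le> growth (Suc k) ?q" using growth sq0 by simp
        then show "(1 + M / s) * (e * b) \<le> e * growth (Suc k) ?q"
          using mult_left_mono[of X "growth (Suc k) ?q" e] e by (simp add: X_def mult_ac)
      qed
      moreover have "\<bar>vnorm (col V j) - 1\<bar> \<le> e * (14 * L * 2 ^ Suc k)"
        using a(4) e L1 mult_nonneg_nonneg[of e "14 * L * 2 ^ k"] unfolding cV vnorm_append_zero by simp
      ultimately show ?thesis using a(1) by blast
    next
      case False
      define i where "i = j - ?m"
      have i: "j = ?m + i" "i < ?m" using False j by (auto simp: i_def)
      define x where "x = col VB0 i"
      define y where "y = col VB i"
      define p where "p = col P i"
      have x: "x \<in> carrier_vec ?m" "vnorm x = 1"
        using col_carrier_vec[OF i(2) VB0c] EVecR_exact_col_vnorm[OF Bc i(2)] by (simp_all add: x_def VB0_def)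
      have y: "y \<in> carrier_vec ?m" and p: "p \<in> carrier_vec ?m"
        using col_carrier_vec[OF i(2)] VBc Pc by (simp_all add: y_def p_def)
      obtain \<alpha> \<delta> where a: "0 \<le> \<alpha>" "y = complex_of_real \<alpha> \<cdot>\<^sub>v x + \<delta>"
        "commutant_span B (e * b) \<delta>" "\<bar>vnorm y - 1\<bar> \<le> e * ?c"
        using elim(2) i(2) unfolding columns_accurate_def b_def y_def x_def VB_def VB0_def by auto
      have ny: "1 - e * ?c \<le> vnorm y" "vnorm y \<le> 2" using a(4) ec by auto
      have py: "vnorm (p - R *\<^sub>v y) \<le> e * ?H"
      proof -
        have eq: "p - R *\<^sub>v y = col (P - Re * VB) i + (Re - R) *\<^sub>v y"
          unfolding p_def y_def by (rule perturbed_product_col[OF Pc Rec VBc Rc i(2)])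
        have "vnorm (p - R *\<^sub>v y) \<le> vnorm (col (P - Re * VB) i) + vnorm ((Re - R) *\<^sub>v y)"
          unfolding eq
          by (rule vnorm_triangle[OF col_carrier_vec[OF i(2) minus_carrier_mat[OF mult_carrier_mat[OF Rec VBc]]]
            mult_mat_vec_carrier[OF minus_carrier_mat[OF Rc] y]])
        also have "vnorm (col (P - Re * VB) i) \<le> fnorm (P - Re * VB)"
          using VBc i(2) by (intro vnorm_col_le_fnorm) auto
        also have "fnorm (P - Re * VB) \<le> e * (L * real ?m ^ d * ?r * (2 * real ?m) + 1)"
          using elim(3) unfolding P_def Re_def VB_def .
        also have "vnorm ((Re - R) *\<^sub>v y) \<le> fnorm (Re - R) * vnorm y"
          using Rec Rc y by (intro vnorm_mult_le_fnorm[of _ ?m ?m]) auto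
        also have "fnorm (Re - R) * vnorm y \<le> (e * (8 * L * (2 ^ (d + 3)) ^ k * (?q * ?r))) * 2"
          using dR ny(2) order_trans[OF fnorm_nonneg dR] by (intro mult_mono) auto
        finally show ?thesis by (simp add: distrib_left mult.assoc)
      qed
      define N where "N = vnorm (p @\<^sub>v y)"
      have Ny: "1 - e * ?c \<le> N" using ny(1) vnorm_append_le(2)[of y p] by (simp add: N_def)
      then have N2: "1 / 2 \<le> N" using ec by simp
      then have N0: "0 < N" by simp
      have cW: "col W (?m + i) = p @\<^sub>v y"
        unfolding W_def evec_blocks_cols(2)[OF sqe i(2)] p_def y_def P_def VB_def A_def B_def C_def ..
      have VW: "V = fst (normalize_cols_from (fl e) ?m W)" unfolding V_def W_def by (rule EVecR_Suc_fst[OF T])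
      have "vnorm (col V j - complex_of_real (1 / N) \<cdot>\<^sub>v (p @\<^sub>v y)) \<le> (4 * real (2 * ?m) + 10) * (\<kappa> * e)"
        using normalize_error[OF fpe ke(1) small Wc, of ?m "?m + i"] i N0 unfolding cW N_def[symmetric] VW i(1) by simp
      also have "\<dots> \<le> (14 * (2 * real ?m)) * (L * e)"
      proof (rule mult_mono[OF _ ke(2)])
        have "1 \<le> real ?m" by simp
        then show "4 * real (2 * ?m) + 10 \<le> 14 * (2 * real ?m)" unfolding of_nat_mult of_nat_numeral by linarith
      qed (use ke in auto)
      also have "\<dots> = e * (14 * L * (2 * real ?m))" by simp
      finally have vt: "vnorm (col V j - complex_of_real (1 / N) \<cdot>\<^sub>v (p @\<^sub>v y)) \<le> e * (14 * L * (2 * real ?m))" .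
      have vc: "col V j \<in> carrier_vec (2 * ?m)" using Vc j by (intro col_carrier_vec) auto
      have v0: "col (fst (EVecR exact (Suc k) T)) j = complex_of_real (1 / vnorm ((R *\<^sub>v x) @\<^sub>v x)) \<cdot>\<^sub>v ((R *\<^sub>v x) @\<^sub>v x)"
        unfolding i(1) using x(2) by (intro EVecR_exact_col_lower[OF T i(2)]) (simp_all add: x_def VB0_def B_def R_def A_def C_def)
      note st = column_step[OF x a(1,3,2) p py N_def N2 vc vt v0, unfolded Teq]
      have le: "(1 / N) * ((1 + M / s) * (e * b)) + sqrt (2 * ?m) * (2 * (e * ?H) + e * (14 * L * (2 * real ?m))) \<le> e * growth (Suc k) ?q"
      proof -
        have "1 / N \<le> 1 + 2 * (e * ?c)"
        proof -
          have *: "1 \<le> (1 + 2 * w) * (1 - w)" if "0 \<le> w" "w \<le> 1 / 2" for w :: real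
            using mult_left_mono[OF that(2,1)] by (simp add: algebra_simps)
          have w: "0 \<le> e * ?c" by (intro mult_nonneg_nonneg less_imp_le[OF e] less_imp_le[OF c0])
          have "1 \<le> (1 + 2 * (e * ?c)) * (1 - e * ?c)" by (rule *[OF w ec(1)])
          also have "\<dots> \<le> (1 + 2 * (e * ?c)) * N" using w by (intro mult_left_mono[OF Ny]) simp
          finally show ?thesis using N0 by (simp add: pos_divide_le_eq)
        qed
        then have "(1 / N) * X \<le> (1 + 2 * (e * ?c)) * X" using X0 by (intro mult_right_mono)
        also have "\<dots> \<le> X + 1" using ec(2) by (simp add: distrib_right)
        finally have 1: "e * ((1 / N) * X) \<le> e * (X + 1)" using e by (intro mult_left_mono) auto
        define S where "S = sqrt (2 * real ?m) * (2 * ?H + 14 * L * (2 * real ?m))"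
        have 2: "(1 / N) * ((1 + M / s) * (e * b)) = e * ((1 / N) * X)" by (simp add: X_def mult_ac)
        have 3: "sqrt (2 * ?m) * (2 * (e * ?H) + e * (14 * L * (2 * real ?m))) = e * S"
          unfolding S_def by (simp only: of_nat_mult of_nat_numeral distrib_left mult_ac)
        have "e * (X + 1) + e * S \<le> e * growth (Suc k) ?q"
          unfolding distrib_left[symmetric] S_def by (rule mult_left_mono[OF growth less_imp_le[OF e]])
        then show ?thesis unfolding 2 3 using 1 by linarith
      qed
      have "\<bar>vnorm (col V j) - 1\<bar> \<le> e * (14 * L * 2 ^ Suc k)"
      proof -
        let ?w = "complex_of_real (1 / N) \<cdot>\<^sub>v (p @\<^sub>v y)"
        have wc: "?w \<in> carrier_vec (2 * ?m)" using p y by (auto simp: mult_2)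
        have w1: "vnorm ?w = 1" using N0 unfolding vnorm_smult N_def[symmetric] norm_of_real by simp
        show ?thesis using vnorm_diff_abs[OF vc wc] vt w1 by simp
      qed
      with st commutant_span_mono[OF T _ le] show ?thesis by blast
    qed
    then show ?case unfolding columns_accurate_def V_def by blast
  qed
qed

end

section \<open>Operation counts\<close>

text \<open>With \<open>g = 2 powr (\<omega> + \<eta>)\<close> the recurrence is \<open>S (k + 1) \<le> 4 * S k + O(g ^ k)\<close>, and \<open>g > 4\<close> makes the
right-hand side dominate, so that \<open>S k\<close> is a multiple of \<open>g ^ k\<close>.\<close>

lemma SylR_cost:
  assumes sq: "square_matmul ar" and g: "4 < g" and c: "0 \<le> c"
    and mc: "\<And>k A B. A \<in> sq_mat (2 ^ k) \<Longrightarrow> B \<in> sq_mat (2 ^ k) \<Longrightarrow>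
      real (snd (matmul ar A B)) \<le> c * g ^ k"
  shows "A \<in> sq_mat (2 ^ k) \<Longrightarrow> B \<in> sq_mat (2 ^ k) \<Longrightarrow> C \<in> sq_mat (2 ^ k) \<Longrightarrow>
    real (snd (SylR ar k A B C)) \<le> (3 + (4 * c + 4) / (g - 4)) * g ^ k"
proof (induction k arbitrary: A B C)
  case 0
  then show ?case using g c by simp
next
  case (Suc k)
  let ?m = "2 ^ k :: nat" and ?a = "3 + (4 * c + 4) / (g - 4)"
  have AB: "A \<in> sq_mat (2 * ?m)" "B \<in> sq_mat (2 * ?m)" "C \<in> sq_mat (2 * ?m)"
    using Suc.prems by auto
  note sc = syl_carrier[OF sq, of k A B C]
  have a: "real (snd (SylR ar k (blk ?m p p A) (blk ?m q q B) D)) \<le> ?a * g ^ k" if "D \<in> sq_mat ?m" for p q D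
    by (intro Suc.IH blk_carrier that)
  have "real (?m * ?m) = 4 ^ k" by (simp add: power_mult_distrib[symmetric])
  also have "\<dots> \<le> g ^ k" using g by (intro power_mono) auto
  finally have mm: "real (?m * ?m) \<le> g ^ k" .
  have "real (snd (SylR ar (Suc k) A B C)) \<le> 4 * (?a * g ^ k) + 4 * (c * g ^ k) + 4 * g ^ k"
    unfolding SylR_Suc_snd[OF AB]
    using a[OF blk_carrier[of ?m 1 0 C], of 1 0] a[OF rhs_carrier(1)[of ar k A B C], of 0 0]
      a[OF rhs_carrier(2)[of ar k A B C], of 1 1] a[OF rhs_carrier(4)[of ar k A B C], of 0 1]
      mc[OF blk_carrier sc(1), of 0 1 A] mc[OF sc(1) blk_carrier, of 0 1 B] mc[OF sc(2) blk_carrier, of 0 1 B]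
      mc[OF blk_carrier sc(3), of 0 1 A] mm
    by simp
  also have "\<dots> = (4 * ?a + (4 * c + 4)) * g ^ k" by (simp add: algebra_simps)
  also have "\<dots> \<le> (?a * g) * g ^ k"
  proof (rule mult_right_mono)
    have "(4 * c + 4) / (g - 4) * (g - 4) = 4 * c + 4" using g by simp
    then have "4 * c + 4 \<le> ?a * (g - 4)" unfolding distrib_right using g by simp
    then show "4 * ?a + (4 * c + 4) \<le> ?a * g" by (simp only: right_diff_distrib)
  qed (use g in simp)
  finally show ?case by (simp add: mult_ac)
qed

lemma sum_squares_cost: "snd (sum_squares ar f n) = 2 * n"
  by (induction n) (simp_all add: split_beta)

lemma EVecR_Suc_snd:
  assumes T: "T \<in> sq_mat (2 * 2 ^ k)" and sq: "square_matmul ar"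
  shows "snd (EVecR ar (Suc k) T)
    = snd (SylR ar k (blk (2 ^ k) 0 0 T) (blk (2 ^ k) 1 1 T) (blk (2 ^ k) 0 1 T))
      + snd (EVecR ar k (blk (2 ^ k) 0 0 T)) + snd (EVecR ar k (blk (2 ^ k) 1 1 T))
      + snd (matmul ar (fst (SylR ar k (blk (2 ^ k) 0 0 T) (blk (2 ^ k) 1 1 T) (blk (2 ^ k) 0 1 T)))
          (fst (EVecR ar k (blk (2 ^ k) 1 1 T))))
      + 2 ^ k * (6 * 2 ^ k + 1)"
proof -
  have "snd (normalize_cols_from ar (2 ^ k) (evec_blocks ar k T)) = 2 ^ k * (6 * 2 ^ k + 1)"
    using evec_blocks_carrier[OF sq, of k T]
    by (simp add: normalize_cols_from_def col_norm_def split_beta sum_squares_cost)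
  then show ?thesis using T by (simp add: evec_blocks_def split_block_blk Let_def split_beta)
qed

lemma EVecR_cost:
  assumes sq: "square_matmul ar" and g: "4 < g" and c: "0 \<le> c"
    and mc: "\<And>k A B. A \<in> sq_mat (2 ^ k) \<Longrightarrow> B \<in> sq_mat (2 ^ k) \<Longrightarrow>
      real (snd (matmul ar A B)) \<le> c * g ^ k"
  defines "b \<equiv> (3 + (4 * c + 4) / (g - 4) + c + 7) / (g - 2)"
  shows "T \<in> sq_mat (2 ^ k) \<Longrightarrow> real (snd (EVecR ar k T)) \<le> b * g ^ k"
proof (induction k arbitrary: T)
  case 0
  then show ?case using g c by (simp add: b_def)
next
  case (Suc k)
  let ?m = "2 ^ k :: nat" and ?a = "3 + (4 * c + 4) / (g - 4)"
  have T: "T \<in> sq_mat (2 * ?m)" using Suc.prems by simp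
  have "real (?m * (6 * ?m + 1)) \<le> 7 * real (?m * ?m)" using self_le_power[of "real ?m" 2] by (simp add: algebra_simps power2_eq_square)
  also have "real (?m * ?m) = 4 ^ k" by (simp add: power_mult_distrib[symmetric])
  also have "(4::real) ^ k \<le> g ^ k" using g by (intro power_mono) auto
  finally have mm: "real (?m * (6 * ?m + 1)) \<le> 7 * g ^ k" by simp
  have "real (snd (EVecR ar (Suc k) T)) \<le> ?a * g ^ k + b * g ^ k + b * g ^ k + c * g ^ k + 7 * g ^ k"
    unfolding EVecR_Suc_snd[OF T sq] of_nat_add
    by (intro add_mono SylR_cost[OF sq g c mc] Suc.IH mc SylR_carrier[OF sq] EVecR_carrier[OF sq] blk_carrier
      mm)
  also have "\<dots> = (2 * b + (?a + c + 7)) * g ^ k" by (simp add: algebra_simps)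
  also have "\<dots> \<le> (b * g) * g ^ k"
  proof (rule mult_right_mono)
    have "?a + c + 7 = b * (g - 2)" using g by (simp add: b_def)
    then show "2 * b + (?a + c + 7) \<le> b * g" by (simp add: right_diff_distrib)
  qed (use g in simp)
  finally show ?case by (simp add: mult_ac)
qed

lemma power2_powr: "real (2 ^ k) powr \<gamma> = (2 powr \<gamma>) ^ k"
  by (simp add: powr_realpow[symmetric] powr_powr mult.commute)

section \<open>Asymptotic form of the bounds\<close>

lemma bigo_powr_bound:
  assumes "M \<in> O(\<lambda>n. real n powr \<gamma>)"
  obtains c where "0 \<le> c" "\<And>n. 1 \<le> n \<Longrightarrow> 0 \<le> \<gamma> \<Longrightarrow> M n \<le> c * real n powr \<gamma>"
proof -
  obtain c where c: "0 < c" "\<forall>\<^sub>F n in sequentially. norm (M n) \<le> c * norm (real n powr \<gamma>)"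
    using assms by (elim landau_o.bigE)
  then obtain N where N: "\<And>n. N \<le> n \<Longrightarrow> \<bar>M n\<bar> \<le> c * (real n powr \<gamma>)"
    unfolding eventually_sequentially by auto
  define S where "S = (\<Sum>i<N. \<bar>M i\<bar>)"
  have S: "0 \<le> S" by (simp add: S_def sum_nonneg)
  show ?thesis
  proof (rule that)
    show "0 \<le> c + S" using c S by simp
    fix n :: nat assume n: "1 \<le> n" and \<gamma>: "0 \<le> \<gamma>"
    have p: "1 \<le> real n powr \<gamma>" using n \<gamma> by (simp add: ge_one_powr_ge_zero)
    show "M n \<le> (c + S) * real n powr \<gamma>"
    proof (cases "N \<le> n")
      case True
      then show ?thesis using N[OF True] mult_nonneg_nonneg[OF S, of "real n powr \<gamma>"] by (simp add: distrib_right)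
    next
      case False
      then have "\<bar>M n\<bar> \<le> S" unfolding S_def by (intro member_le_sum) auto
      also have "\<dots> \<le> S * real n powr \<gamma>" using mult_left_mono[OF p S] by simp
      finally have "M n \<le> S * real n powr \<gamma>" by simp
      moreover have "0 \<le> c * real n powr \<gamma>" using c by simp
      ultimately show ?thesis unfolding distrib_right by linarith
    qed
  qed
qed

lemma poly_le_power:
  fixes p :: "real poly"
  assumes "1 \<le> x"
  shows "poly p x \<le> (\<Sum>i\<le>degree p. \<bar>coeff p i\<bar>) * x ^ degree p"
  unfolding poly_altdef sum_distrib_right
proof (rule sum_mono)
  fix i assume "i \<in> {..degree p}"
  then have "x ^ i \<le> x ^ degree p" using assms by (intro power_increasing) auto
  then show "coeff p i * x ^ i \<le> \<bar>coeff p i\<bar> * x ^ degree p"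
    using assms by (intro mult_mono) auto
qed

text \<open>The polynomial bound on the error constant is replaced by a monomial, and the remainder \<open>K * e\<^sup>2\<close> is
at most \<open>e * \<tau>\<close> as soon as \<open>e\<close> is small enough.  That \<open>\<kappa>\<close> is nonnegative follows from the rounding model.\<close>

lemma stable_flI:
  assumes fp: "\<And>\<epsilon>. 0 < \<epsilon> \<Longrightarrow> \<epsilon> < 1 \<Longrightarrow> fp_arith \<kappa> \<epsilon> (fl \<epsilon>)"
    and sq: "\<And>\<epsilon>. 0 < \<epsilon> \<Longrightarrow> \<epsilon> < 1 \<Longrightarrow> square_matmul (fl \<epsilon>)"
    and st: "stable_matmul fl"
  obtains L d where "stable_fl fl \<kappa> L d"
proof -
  obtain \<mu> :: "nat \<Rightarrow> real" where ex: "\<exists>p :: real poly. \<forall>n. \<mu> n \<le> poly p (real n)"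
    and st: "\<forall>n \<ge> 1. \<forall>\<rho>. \<exists>K. \<forall>\<^sub>F \<epsilon> in at_right 0. \<forall>A \<in> carrier_mat n n. \<forall>B \<in> carrier_mat n n.
      mnorm A \<le> \<rho> \<longrightarrow> mnorm B \<le> \<rho> \<longrightarrow>
        mnorm (fst (matmul (fl \<epsilon>) A B) - A * B) \<le> \<mu> n * \<epsilon> * mnorm A * mnorm B + K * \<epsilon>\<^sup>2"
    using st unfolding stable_matmul_def by (rule exE) (erule conjE, rule that)
  from ex obtain p :: "real poly" where \<mu>: "\<And>n. \<mu> n \<le> poly p (real n)" by blast
  have "fp_arith \<kappa> (1 / 2) (fl (1 / 2))" by (rule fp) auto
  then have "\<forall>x y. cmod (add (fl (1 / 2)) x y - (x + y)) \<le> \<kappa> * (1 / 2) * cmod (x + y)"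
    unfolding fp_arith_def by (rule conjunct1)
  from order_trans[OF norm_ge_zero this[rule_format, of 1 0]] have \<kappa>: "0 \<le> \<kappa>" by simp
  define P where "P = (\<Sum>i\<le>degree p. \<bar>coeff p i\<bar>)"
  have P: "0 \<le> P" by (simp add: P_def sum_nonneg)
  define L where "L = \<kappa> + P + 1"
  define d where "d = degree p + 1"
  have "stable_fl fl \<kappa> L d"
  proof
    show "fp_arith \<kappa> e (fl e)" "square_matmul (fl e)" if "0 < e" "e < 1" for e using fp sq that by auto
    show "0 \<le> \<kappa>" "\<kappa> \<le> L" "1 \<le> L" using \<kappa> P by (auto simp: L_def)
    fix n :: nat and \<rho> \<tau> :: real
    assume n: "1 \<le> n" and \<tau>: "0 < \<tau>"
    obtain K where K: "\<forall>\<^sub>F \<epsilon> in at_right 0. \<forall>A \<in> carrier_mat n n. \<forall>B \<in> carrier_mat n n.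
      mnorm A \<le> \<rho> \<longrightarrow> mnorm B \<le> \<rho> \<longrightarrow>
        mnorm (fst (matmul (fl \<epsilon>) A B) - A * B) \<le> \<mu> n * \<epsilon> * mnorm A * mnorm B + K * \<epsilon>\<^sup>2"
      using st[rule_format, OF n, of \<rho>] by (elim exE)
    have t: "0 < \<tau> / (real n * (\<bar>K\<bar> + 1))" using n \<tau> by (intro divide_pos_pos mult_pos_pos) auto
    from K eventually_eps_less[OF t]
    show "\<forall>\<^sub>F e in at_right 0. \<forall>A \<in> carrier_mat n n. \<forall>B \<in> carrier_mat n n.
      fnorm A \<le> \<rho> \<longrightarrow> fnorm B \<le> \<rho> \<longrightarrow>
      fnorm (fst (matmul (fl e) A B) - A * B) \<le> e * (L * real n ^ d * fnorm A * fnorm B + \<tau>)"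
    proof eventually_elim
      case (elim e)
      show ?case
      proof (intro ballI impI)
        fix A B :: "complex mat" assume A: "A \<in> sq_mat n" and B: "B \<in> sq_mat n"
          and r: "fnorm A \<le> \<rho>" "fnorm B \<le> \<rho>"
        have e: "0 < e" and n0: "0 < n" using elim n by auto
        note mA = mnorm_le_fnorm[OF A n0] mnorm_nonneg[OF A n0] and mB = mnorm_le_fnorm[OF B n0] mnorm_nonneg[OF B n0]
        let ?D = "fst (matmul (fl e) A B) - A * B"
        have D: "?D \<in> sq_mat n" by (intro minus_carrier_mat mult_carrier_mat[OF A B])
        have pn: "\<mu> n \<le> L * real n ^ degree p"
        proof -
          have "\<mu> n \<le> P * real n ^ degree p"
            using order_trans[OF \<mu> poly_le_power[of "real n" p]] n unfolding P_def by simp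
          also have "\<dots> \<le> L * real n ^ degree p" using \<kappa> by (intro mult_right_mono) (auto simp: L_def)
          finally show ?thesis .
        qed
        have L0: "0 \<le> L" using \<kappa> P by (simp add: L_def)
        have "mnorm ?D \<le> \<mu> n * e * mnorm A * mnorm B + K * e\<^sup>2"
          using elim(1) A B r mA(1) mB(1) by auto
        also have "\<mu> n * e * mnorm A * mnorm B \<le> (L * real n ^ degree p) * e * fnorm A * fnorm B"
        proof -
          have "\<mu> n * (e * mnorm A * mnorm B) \<le> (L * real n ^ degree p) * (e * mnorm A * mnorm B)"
            using pn e mA mB by (intro mult_right_mono mult_nonneg_nonneg) auto
          also have "\<dots> \<le> (L * real n ^ degree p) * (e * fnorm A * fnorm B)"
            using L0 e mA mB by (intro mult_left_mono mult_mono mult_nonneg_nonneg) auto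
          finally show ?thesis by (simp add: mult_ac)
        qed
        also have "K * e\<^sup>2 \<le> (\<bar>K\<bar> + 1) * e\<^sup>2" by (intro mult_right_mono) auto
        finally have "mnorm ?D \<le> (L * real n ^ degree p) * e * fnorm A * fnorm B + (\<bar>K\<bar> + 1) * e\<^sup>2" by simp
        moreover have "fnorm ?D \<le> sqrt n * mnorm ?D" by (rule fnorm_le_sqrt_mnorm[OF D n0])
        moreover have "sqrt n * mnorm ?D \<le> real n * mnorm ?D"
          using n mnorm_nonneg[OF D n0] by (intro mult_right_mono sqrt_le_self) auto
        ultimately have "fnorm ?D \<le> real n * ((L * real n ^ degree p) * e * fnorm A * fnorm B + (\<bar>K\<bar> + 1) * e\<^sup>2)"
          by (meson mult_left_mono of_nat_0_le_iff order_trans)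
        also have "\<dots> = e * (L * real n ^ d * fnorm A * fnorm B + e * (real n * (\<bar>K\<bar> + 1)))"
          by (simp add: d_def distrib_left power2_eq_square mult_ac)
        also have "e * (real n * (\<bar>K\<bar> + 1)) \<le> \<tau>"
        proof -
          have Y: "0 < real n * (\<bar>K\<bar> + 1)" using n0 by (intro mult_pos_pos) auto
          have "e < \<tau> / (real n * (\<bar>K\<bar> + 1))" using elim(2) by (rule conjunct2)
          then show ?thesis by (simp only: pos_less_divide_eq[OF Y] less_imp_le)
        qed
        finally show "fnorm ?D \<le> e * (L * real n ^ d * fnorm A * fnorm B + \<tau>)" using e by simp
      qed
    qed
  qed
  then show ?thesis by (rule that)
qed

text \<open>The bound in terms of \<open>1 + q\<close> is turned into one in terms of \<open>q = \<parallel>T\<parallel> / s \<ge> 1 / 2\<close>.  The power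
\<open>3 ^ (k + 2)\<close> produced by \<open>1 + q \<le> 3 * q\<close> is itself a power of the dimension \<open>2 ^ k\<close>.\<close>

lemma (in stable_fl) EVecR_error_bound:
  assumes sep: "separated (Suc k) T s (mnorm T)" and s: "0 < s"
  shows "\<forall>\<^sub>F e in at_right 0. EVecR_error (fl e) (Suc k) T
    \<le> 2450 * L * ((6 * (4 * 2 ^ (d + 3))) ^ Suc k * e * (mnorm T / s) ^ (Suc k + 2))"
proof -
  let ?n = "2 ^ Suc k :: nat" and ?k = "Suc k" and ?M = "mnorm T"
  define q where "q = ?M / s"
  have T: "T \<in> sq_mat ?n" by (rule separated_carrier[OF sep])
  have n0: "0 < ?n" by simp
  have sM: "s \<le> 2 * ?M" by (rule separated_le[OF sep s])
  then have M0: "0 < ?M" using s by simp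
  have q: "1 / 2 \<le> q" using sM s by (simp add: q_def pos_le_divide_eq)
  have q0: "0 \<le> q" using q by simp
  define h where "h = (4 * 2 ^ (d + 3) :: real)"
  have "1 \<le> (2::real) ^ (d + 3)" by (rule one_le_power) simp
  then have h4: "4 \<le> h" unfolding h_def by linarith
  have "(1 + q) ^ (?k + 2) \<le> (3 * q) ^ (?k + 2)" using q by (intro power_mono) auto
  also have "\<dots> = 9 * (3 ^ ?k * q ^ (?k + 2))" by (simp only: power_mult_distrib power_add) simp
  finally have gr: "growth ?k q \<le> 133 * L * h ^ ?k * (9 * (3 ^ ?k * q ^ (?k + 2)))"
    unfolding growth_def h_def[symmetric] using L1 h4 by (intro mult_left_mono) auto
  have "1 \<le> (2 * q) ^ (?k + 2)" using q by (intro one_le_power) simp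
  also have "\<dots> = 4 * (2 ^ ?k * q ^ (?k + 2))" by (simp only: power_mult_distrib power_add) simp
  finally have "14 * L * 2 ^ ?k * 1 \<le> 14 * L * 2 ^ ?k * (4 * (2 ^ ?k * q ^ (?k + 2)))"
    using L1 by (intro mult_left_mono) auto
  also have "\<dots> = 56 * L * ((2 * 2) ^ ?k * q ^ (?k + 2))" by (simp only: power_mult_distrib)
  also have "\<dots> \<le> 56 * L * ((3 * h) ^ ?k * q ^ (?k + 2))"
    using L1 h4 q0 by (intro mult_left_mono mult_right_mono power_mono) auto
  finally have "2 * growth ?k q + 14 * L * 2 ^ ?k \<le> 2450 * L * ((3 * h) ^ ?k * q ^ (?k + 2))"
    using gr by (simp only: power_mult_distrib) (simp add: mult_ac)
  then have "2 ^ ?k * (2 * growth ?k q + 14 * L * 2 ^ ?k) \<le> 2 ^ ?k * (2450 * L * ((3 * h) ^ ?k * q ^ (?k + 2)))"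
    by (intro mult_left_mono) auto
  also have "\<dots> = 2450 * L * ((2 * (3 * h)) ^ ?k * q ^ (?k + 2))" by (simp only: power_mult_distrib mult_ac)
  finally have total: "2 ^ ?k * (2 * growth ?k q + 14 * L * 2 ^ ?k) \<le> 2450 * L * ((6 * h) ^ ?k * q ^ (?k + 2))" by simp
  from EVecR_columns_accurate[OF s M0 sep] ev_sq eventually_eps_less[of 1, simplified]
  show ?thesis
  proof eventually_elim
    case (elim e)
    have e: "0 \<le> e" using elim by simp
    have "EVecR_error (fl e) ?k T \<le> fnorm (fst (EVecR (fl e) ?k T) - fst (EVecR exact ?k T))"
      unfolding EVecR_error_def
      by (rule mnorm_le_fnorm[OF minus_carrier_mat[OF EVecR_carrier[OF square_matmul_exact T]] n0])
    also have "\<dots> \<le> e * (2 ^ ?k * (2 * growth ?k q + 14 * L * 2 ^ ?k))"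
      using columns_accurate_error[OF elim(1,2) T e] q0 unfolding q_def by blast
    also have "\<dots> \<le> e * (2450 * L * ((6 * h) ^ ?k * q ^ (?k + 2)))" using total e by (rule mult_left_mono)
    finally show ?case unfolding h_def q_def by (simp only: mult_ac)
  qed
qed

lemma EVecR_error_0: "EVecR_error ar 0 T \<le> 0"
proof -
  have "mnorm (0\<^sub>m 1 1) \<le> 0" using mnorm_le_fnorm[of "0\<^sub>m 1 1" 1 1] by simp
  moreover have "1\<^sub>m 1 - 1\<^sub>m 1 = (0\<^sub>m 1 1 :: complex mat)" by (intro eq_matI) auto
  ultimately show ?thesis by (simp only: EVecR_error_def EVecR.simps fst_conv)
qed

theorem mainTheorem5:
  fixes \<omega> \<eta> \<kappa> :: real and fl :: "real \<Rightarrow> arith"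
  assumes "\<And>\<epsilon>. 0 < \<epsilon> \<Longrightarrow> \<epsilon> < 1 \<Longrightarrow> fp_arith \<kappa> \<epsilon> (fl \<epsilon>)"
    and "\<And>\<epsilon>. 0 < \<epsilon> \<Longrightarrow> \<epsilon> < 1 \<Longrightarrow> square_matmul (fl \<epsilon>)"
    and "\<omega> + \<eta> > 2"
    and "matmul_cost_bounded fl (\<omega> + \<eta>)"
  shows "(\<exists>W \<in> O(\<lambda>n. real n powr (\<omega> + \<eta>)). \<forall>\<epsilon> \<in> {0<..<1}. \<forall>n k T s.
            EVecR_input n k T s \<longrightarrow> real (snd (EVecR (fl \<epsilon>) k T)) \<le> W n) \<and>
         (stable_matmul fl \<longrightarrow>
            (\<exists>c' K. \<forall>n k T s. EVecR_input n k T s \<longrightarrow>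
               (\<exists>h \<in> O[at_right 0](\<lambda>\<epsilon>. \<epsilon>\<^sup>2). \<forall>\<^sub>F \<epsilon> in at_right 0.
                  EVecR_error (fl \<epsilon>) k T
                    \<le> K * (real n powr c' * \<epsilon> * (mnorm T / s) powr (2 + log 2 (real n))) + h \<epsilon>)))"
proof (intro conjI impI)
  let ?\<gamma> = "\<omega> + \<eta>"
  obtain M where M: "M \<in> O(\<lambda>n. real n powr ?\<gamma>)"
    and cost: "\<And>\<epsilon> n A B. \<epsilon> \<in> {0<..<1} \<Longrightarrow> 1 \<le> n \<Longrightarrow> A \<in> sq_mat n \<Longrightarrow> B \<in> sq_mat n \<Longrightarrow>
      real (snd (matmul (fl \<epsilon>) A B)) \<le> M n"
    using assms(4) unfolding matmul_cost_bounded_def by blast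
  obtain c where c: "0 \<le> c" "\<And>n. 1 \<le> n \<Longrightarrow> M n \<le> c * real n powr ?\<gamma>"
    using bigo_powr_bound[OF M] assms(3) by (metis less_eq_real_def less_trans zero_less_numeral)
  define g where "g = 2 powr ?\<gamma>"
  have "(2::real) powr 2 < g" unfolding g_def using assms(3) by (intro powr_less_mono) auto
  then have g: "4 < g" by simp
  define b where "b = (3 + (4 * c + 4) / (g - 4) + c + 7) / (g - 2)"
  have mc: "real (snd (matmul (fl \<epsilon>) A B)) \<le> c * g ^ k"
    if "\<epsilon> \<in> {0<..<1}" "A \<in> sq_mat (2 ^ k)" "B \<in> sq_mat (2 ^ k)" for \<epsilon> k A B
    using order_trans[OF cost[OF that(1) _ that(2,3)] c(2)] unfolding g_def power2_powr[symmetric] by simp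
  show "\<exists>W \<in> O(\<lambda>n. real n powr ?\<gamma>). \<forall>\<epsilon> \<in> {0<..<1}. \<forall>n k T s.
      EVecR_input n k T s \<longrightarrow> real (snd (EVecR (fl \<epsilon>) k T)) \<le> W n"
  proof (intro bexI ballI allI impI)
    fix \<epsilon> :: real and n k T s
    assume \<epsilon>: "\<epsilon> \<in> {0<..<1}" and inp: "EVecR_input n k T s"
    have "real (snd (EVecR (fl \<epsilon>) k T)) \<le> b * g ^ k"
      unfolding b_def using inp \<epsilon> by (intro EVecR_cost g c mc assms(2)) (auto simp: EVecR_input_def)
    then show "real (snd (EVecR (fl \<epsilon>) k T)) \<le> b * real n powr ?\<gamma>"
      using inp unfolding g_def power2_powr[symmetric] by (simp add: EVecR_input_def)
  qed simp
next
  assume "stable_matmul fl"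
  then obtain L d where "stable_fl fl \<kappa> L d" using stable_flI[of \<kappa> fl] assms(1,2) by blast
  then interpret stable_fl fl \<kappa> L d .
  define G where "G = (6 * (4 * 2 ^ (d + 3)) :: real)"
  have G: "0 < G" by (simp add: G_def)
  \<comment> \<open>The first-order bound has slack, so the second-order term can be taken to be zero.\<close>
  show "\<exists>c' K. \<forall>n k T s. EVecR_input n k T s \<longrightarrow>
     (\<exists>h \<in> O[at_right 0](\<lambda>\<epsilon>. \<epsilon>\<^sup>2). \<forall>\<^sub>F \<epsilon> in at_right 0.
        EVecR_error (fl \<epsilon>) k T \<le> K * (real n powr c' * \<epsilon> * (mnorm T / s) powr (2 + log 2 (real n))) + h \<epsilon>)"
  proof (rule exI[of _ "log 2 G"], rule exI[of _ "2450 * L"], intro allI impI bexI[of _ "\<lambda>_. 0"])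
    fix n k T s assume inp: "EVecR_input n k T s"
    have n: "n = 2 ^ k" and s: "0 < s" and sep: "separated k T s (mnorm T)"
      using inp by (auto simp: EVecR_input_def separated_def)
    show "\<forall>\<^sub>F \<epsilon> in at_right 0. EVecR_error (fl \<epsilon>) k T
        \<le> 2450 * L * (real n powr log 2 G * \<epsilon> * (mnorm T / s) powr (2 + log 2 (real n))) + 0"
    proof (cases k)
      case 0
      show ?thesis using eventually_eps_less[of 1, simplified]
      proof eventually_elim
        case (elim \<epsilon>)
        have "0 \<le> 2450 * L * (real n powr log 2 G * \<epsilon> * (mnorm T / s) powr (2 + log 2 (real n)))"
          using L1 elim by (intro mult_nonneg_nonneg) auto
        then show ?case using EVecR_error_0[of "fl \<epsilon>" T] unfolding 0 by linarith
      qed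
    next
      case (Suc l)
      have q: "0 < mnorm T / s" using separated_le[OF sep[unfolded Suc] s] s by simp
      have "2 + log 2 (real n) = real (k + 2)" unfolding n by (simp add: log_nat_power)
      then have 1: "(mnorm T / s) powr (2 + log 2 (real n)) = (mnorm T / s) ^ (k + 2)"
        using q by (simp only: powr_realpow)
      have 2: "real n powr log 2 G = G ^ k" unfolding n power2_powr using G by simp
      show ?thesis unfolding 1 2 add_0_right unfolding G_def Suc
        using EVecR_error_bound[OF sep[unfolded Suc] s] .
    qed
  qed simp
qed

end
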